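(* Consider the continuous piecewise quadratic family $$\dot x=-y+d_jx+l_jx^2+m_jxy+n\,y^2,\qquad \dot y=x(1-y),\qquad \text{if } (-1)^jx<0,\quad j=1,2,$$ with real parameters $(d_1,d_2,l_1,l_2,m_1,m_2,n)$. The maximal weak-focus order of the origin in this family is $3$. This maximal order is attained when the parameters lie on $$\mathcal F^c=\{d_1=d_2=l_1-l_2=0,\ \ (m_1+m_2)(l_2+n)\neq0\}.$$ Additionally, the weak-foci on $\mathcal F^c$ unfold $2$ crossing limit cycles of small amplitude bifurcating from the origin, multiplicities taken into account, when perturbing inside this family.
   Context: Here $j=1$ on $\{x>0\}$ and $j=2$ on $\{x<0\}$. When $|d_j|<2$, orbits near the origin turn counterclockwise around it. Let $\Pi_1$ be the half-return map from the negative to the positive $y$-half-axis through $x>0$, and $\Pi_2$ the half-return map from the positive to the negative $y$-half-axis through $x<0$, points being parametrized by their distance $r_0$ to the origin. The displacement map is $\Delta(r_0)=\Pi_2^{-1}(r_0)-\Pi_1(r_0)=\sum_{k\ge1}W_kr_0^k$. Weak-focus order: for $d_1=d_2=0$ (then $W_1=0$), the origin is a weak-focus of order $\ell$ if $W_k=0$ for $1\le k\le \ell-1$ and $W_\ell\ne0$. A crossing limit cycle is an isolated periodic orbit meeting $\{x=0\}$ only at points where both vector fields are transversal to this line and point to the same side. Those near and surrounding the origin correspond to isolated positive zeros of $\Delta$, and the multiplicity of a limit cycle is the multiplicity of the zero. A parameter value $\lambda_0$ "unfolds $k$ limit cycles of small amplitude bifurcating from the origin, multiplicities taken into account" if for every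 neighborhood $U$ of the origin and every neighborhood $V$ of $\lambda_0$ in the parameter space of the family there is $\lambda\in V$ for which the system has $k$ crossing limit cycles in $U$ surrounding the origin, counted with multiplicity. *)

theory Defs
  imports "HOL-Analysis.Analysis"
begin

section \<open>Planar piecewise systems with switching line \<open>x = 0\<close>\<close>

type_synonym vfield = "real \<times> real \<Rightarrow> real \<times> real"

text \<open>On the switching line itself we take the value of the right field. For continuous
  piecewise systems this is no choice: both fields agree there, and solutions are ordinary
  classical solutions.\<close>

definition glue :: "vfield \<Rightarrow> vfield \<Rightarrow> vfield" where
  "glue X1 X2 = (\<lambda>p. if fst p < 0 then X2 p else X1 p)"

definition solution_on :: "vfield \<Rightarrow> (real \<Rightarrow> real \<times> real) \<Rightarrow> real set \<Rightarrow> bool" where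
  "solution_on F \<gamma> I \<longleftrightarrow>
     (\<forall>t\<in>I. (\<gamma> has_vector_derivative F (\<gamma> t)) (at t within I))"

text \<open>Graphs of the half-return maps: \<open>right_return F r s\<close> means \<open>\<Pi>\<^sub>1(r) = s\<close> (orbit
  from \<open>(0,-r)\<close> to \<open>(0,s)\<close> through \<open>x > 0\<close>), and \<open>left_return F r s\<close> means
  \<open>\<Pi>\<^sub>2(r) = s\<close> (orbit from \<open>(0,r)\<close> to \<open>(0,-s)\<close> through \<open>x < 0\<close>).\<close>

definition right_return :: "vfield \<Rightarrow> real \<Rightarrow> real \<Rightarrow> bool" where
  "right_return F r s \<longleftrightarrow> r > 0 \<and> s > 0 \<and>
     (\<exists>T>0. \<exists>\<gamma>. solution_on F \<gamma> {0..T} \<and> \<gamma> 0 = (0, - r) \<and> \<gamma> T = (0, s) \<and>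
        (\<forall>t\<in>{0<..<T}. fst (\<gamma> t) > 0))"

definition left_return :: "vfield \<Rightarrow> real \<Rightarrow> real \<Rightarrow> bool" where
  "left_return F r s \<longleftrightarrow> r > 0 \<and> s > 0 \<and>
     (\<exists>T>0. \<exists>\<gamma>. solution_on F \<gamma> {0..T} \<and> \<gamma> 0 = (0, r) \<and> \<gamma> T = (0, - s) \<and>
        (\<forall>t\<in>{0<..<T}. fst (\<gamma> t) < 0))"

definition Pi1 :: "vfield \<Rightarrow> real \<Rightarrow> real" where
  "Pi1 F r = (THE s. right_return F r s)"

definition Pi2_inv :: "vfield \<Rightarrow> real \<Rightarrow> real" where
  "Pi2_inv F r = (THE u. left_return F u r)"

definition displacement :: "vfield \<Rightarrow> real \<Rightarrow> real" where
  "displacement F r = Pi2_inv F r - Pi1 F r"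

definition displacement_defined :: "vfield \<Rightarrow> real \<Rightarrow> bool" where
  "displacement_defined F r \<longleftrightarrow> (\<exists>s. right_return F r s) \<and> (\<exists>u. left_return F u r)"

text \<open>The expansion \<open>\<Delta>(r) = \<Sum>k\<ge>1. W\<^sub>k r\<^sup>k\<close>, valid for all small \<open>r > 0\<close>. The condition
  \<open>W 0 = 0\<close> encodes that summation starts at \<open>k = 1\<close>.\<close>

definition displacement_series :: "vfield \<Rightarrow> (nat \<Rightarrow> real) \<Rightarrow> bool" where
  "displacement_series F W \<longleftrightarrow> W 0 = 0 \<and>
     (\<exists>\<rho>>0. \<forall>r. 0 < r \<and> r < \<rho> \<longrightarrow>
        displacement_defined F r \<and> (\<lambda>k. W k * r ^ k) sums displacement F r)"

definition W_coeff :: "vfield \<Rightarrow> nat \<Rightarrow> real" where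
  "W_coeff F = (THE W. displacement_series F W)"

definition periodic_orbit :: "vfield \<Rightarrow> (real \<times> real) set \<Rightarrow> bool" where
  "periodic_orbit F C \<longleftrightarrow>
     (\<exists>\<gamma> T. T > 0 \<and> solution_on F \<gamma> UNIV \<and> (\<forall>t. \<gamma> (t + T) = \<gamma> t) \<and>
        \<not> \<gamma> constant_on UNIV \<and> C = range \<gamma>)"

definition isolated_periodic_orbit :: "vfield \<Rightarrow> (real \<times> real) set \<Rightarrow> bool" where
  "isolated_periodic_orbit F C \<longleftrightarrow> periodic_orbit F C \<and>
     (\<exists>N. open N \<and> C \<subseteq> N \<and> (\<forall>C'. periodic_orbit F C' \<and> C' \<subseteq> N \<longrightarrow> C' = C))"

definition crossing_limit_cycle :: "vfield \<Rightarrow> vfield \<Rightarrow> (real \<times> real) set \<Rightarrow> bool" where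
  "crossing_limit_cycle X1 X2 C \<longleftrightarrow> isolated_periodic_orbit (glue X1 X2) C \<and>
     (\<forall>p\<in>C. fst p = 0 \<longrightarrow> fst (X1 p) * fst (X2 p) > 0)"

text \<open>Higher derivatives are required to exist, since \<open>deriv\<close> is a total function.\<close>

definition zero_multiplicity :: "(real \<Rightarrow> real) \<Rightarrow> real \<Rightarrow> nat \<Rightarrow> bool" where
  "zero_multiplicity f r m \<longleftrightarrow> m \<ge> 1 \<and>
     (\<forall>j<m. (deriv ^^ j) f r = 0 \<and>
        (\<forall>\<^sub>F x in nhds r. (deriv ^^ j) f field_differentiable at x)) \<and>
     (deriv ^^ m) f r \<noteq> 0"

text \<open>The zero of the displacement map attached to a cycle is the distance to the origin of
  its intersection with the negative \<open>y\<close>-half-axis.\<close>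

definition cycle_multiplicity :: "vfield \<Rightarrow> (real \<times> real) set \<Rightarrow> nat \<Rightarrow> bool" where
  "cycle_multiplicity F C m \<longleftrightarrow>
     (\<exists>r>0. (0, - r) \<in> C \<and> zero_multiplicity (displacement F) r m)"


section \<open>The continuous piecewise quadratic family\<close>

text \<open>Parameters \<open>(d\<^sub>1, d\<^sub>2, l\<^sub>1, l\<^sub>2, m\<^sub>1, m\<^sub>2, n)\<close>.\<close>

type_synonym params = "real \<times> real \<times> real \<times> real \<times> real \<times> real \<times> real"

definition quad :: "real \<Rightarrow> real \<Rightarrow> real \<Rightarrow> real \<Rightarrow> vfield" where
  "quad d l m n = (\<lambda>(x, y). (- y + d * x + l * x^2 + m * x * y + n * y^2, x * (1 - y)))"

definition X_right :: "params \<Rightarrow> vfield" where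
  "X_right = (\<lambda>(d1, d2, l1, l2, m1, m2, n). quad d1 l1 m1 n)"

definition X_left :: "params \<Rightarrow> vfield" where
  "X_left = (\<lambda>(d1, d2, l1, l2, m1, m2, n). quad d2 l2 m2 n)"

definition pw_field :: "params \<Rightarrow> vfield" where
  "pw_field p = glue (X_right p) (X_left p)"

lemma X_right_eq_X_left_on_switching_line: "X_right p (0, y) = X_left p (0, y)"
  by (cases p) (simp add: X_right_def X_left_def quad_def)

definition weak_focus_order :: "params \<Rightarrow> nat \<Rightarrow> bool" where
  "weak_focus_order = (\<lambda>(d1, d2, l1, l2, m1, m2, n) k. d1 = 0 \<and> d2 = 0 \<and> k \<ge> 1 \<and>
     (\<forall>i. 1 \<le> i \<and> i \<le> k - 1 \<longrightarrow> W_coeff (pw_field (d1, d2, l1, l2, m1, m2, n)) i = 0) \<and>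
     W_coeff (pw_field (d1, d2, l1, l2, m1, m2, n)) k \<noteq> 0)"

definition Fc :: "params set" where
  "Fc = {(d1, d2, l1, l2, m1, m2, n).
           d1 = 0 \<and> d2 = 0 \<and> l1 - l2 = 0 \<and> (m1 + m2) * (l2 + n) \<noteq> 0}"

text \<open>``Has \<open>k\<close> limit cycles in \<open>U\<close>, counted with multiplicity'' means that there is a finite
  set of limit cycles of total multiplicity \<open>k\<close>. Further limit cycles in \<open>U\<close> are not excluded,
  since \<open>U\<close> ranges over all neighborhoods of the origin, including large ones.\<close>

definition unfolds_limit_cycles :: "params \<Rightarrow> nat \<Rightarrow> bool" where
  "unfolds_limit_cycles p0 k \<longleftrightarrow>
     (\<forall>U V. open U \<and> (0, 0) \<in> U \<and> open V \<and> p0 \<in> V \<longrightarrow>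
        (\<exists>p\<in>V. \<exists>S \<mu>. finite S \<and>
           (\<forall>C\<in>S. crossing_limit_cycle (X_right p) (X_left p) C \<and>
              C \<subseteq> U \<and> (0, 0) \<in> inside C \<and> cycle_multiplicity (pw_field p) C (\<mu> C)) \<and>
           (\<Sum>C\<in>S. \<mu> C) = k))"

end

theory Submission
  imports Defs "HOL-Complex_Analysis.Complex_Analysis"
begin

text \<open>The reflection \<open>(x, y, t) \<mapsto> (- x, y, - t)\<close> turns the left half system into a right half system, so that
  the displacement map is the difference of two half-return maps of the same kind, namely
  \<open>r f(d, l, m, n; r)\<close> at \<open>(- d\<^sub>2, l\<^sub>2, - m\<^sub>2, n)\<close> and at \<open>(d\<^sub>1, l\<^sub>1, m\<^sub>1, n)\<close>. In polar
  coordinates \<open>f\<close> is the endpoint of a scalar equation that Picard iteration solves holomorphically in a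
  complex \<open>r\<close>, and
  \<open>f = 1 + d \<pi> / 2 + A r + (A\<^sup>2 + \<pi> m (l + n) / 8) r\<^sup>2 + O(r\<^sup>3)\<close> with \<open>A = (4 l + 2 (n - 1)) / 3\<close>.
  Hence \<open>W\<^sub>2 = 4 (l\<^sub>2 - l\<^sub>1) / 3\<close>, and \<open>W\<^sub>3 = - \<pi> (m\<^sub>1 + m\<^sub>2) (l + n) / 8\<close> if \<open>l\<^sub>1 = l\<^sub>2 = l\<close>. If these vanish,
  the origin is a center: for \<open>m\<^sub>1 = - m\<^sub>2\<close> by symmetry, and for \<open>n = - l\<close> because the half-return map
  does not depend on \<open>m\<close>. For \<open>W\<^sub>3 \<noteq> 0\<close>, a perturbation of size \<open>\<epsilon>\<^sup>2\<close> in \<open>d\<^sub>1\<close> and of size \<open>\<epsilon>\<close> in \<open>l\<^sub>1\<close>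
  produces two simple zeros of the displacement map at distance of order \<open>\<epsilon>\<close>.\<close>

subsection \<open>Holomorphic dependence of ODE solutions on a parameter\<close>

text \<open>Two obstacles shape the proof. The numbers W_k are coefficients of a convergent power
  series, so finite Taylor estimates of the half-return maps do not suffice: hence a complex initial
  distance, and the polar angle as independent variable, which replaces the unknown return time by
  the fixed angle pi. The trace parameter is counted as a quantity of second order, |d| <= e^2 for
  distances up to e. With this weight a single third-order expansion yields both the coefficients at
  d = 0 and the rescaled displacement map of the unfolding, where d is of the size of the squared
  distance. The other obstacle is isolation: a limit cycle must be isolated among all periodic
  orbits of the glued field, including orbits that might cross the axis many times. Instead of
  monotonicity of the half-return maps, the extreme point of an orbit on the negative half-axis and
  the intermediate value theorem are used to produce a zero of the displacement map. The numerical
  constants are generous roundings valid for E <= 1/300 and pi <= 3.15.\<close>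

definition param_smooth :: "complex set \<Rightarrow> real \<Rightarrow> (complex \<Rightarrow> real \<Rightarrow> complex) \<Rightarrow> bool" where
  "param_smooth S b f \<longleftrightarrow> continuous_on (S \<times> {0..b}) (\<lambda>(z, t). f z t) \<and>
     (\<exists>f'. continuous_on (S \<times> {0..b}) (\<lambda>(z, t). f' z t) \<and>
        (\<forall>z\<in>S. \<forall>t\<in>{0..b}. ((\<lambda>z. f z t) has_field_derivative f' z t) (at z)))"

lemma param_smooth_time:
  assumes "continuous_on {0..b} g"
  shows "param_smooth S b (\<lambda>z t. g t)"
proof -
  have "continuous_on (S \<times> {0..b}) (\<lambda>p. g (snd p))"
    by (rule continuous_on_compose2[OF assms]) (auto intro!: continuous_intros)
  then show ?thesis
    unfolding param_smooth_def by (auto simp: case_prod_unfold intro!: exI[of _ "\<lambda>_ _. 0"])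
qed

lemma param_smooth_param: "param_smooth S b (\<lambda>z t. z)"
  unfolding param_smooth_def
  by (auto simp: case_prod_unfold intro!: exI[of _ "\<lambda>_ _. 1"] continuous_intros)

lemma param_smooth_add:
  assumes "param_smooth S b f" "param_smooth S b g"
  shows "param_smooth S b (\<lambda>z t. f z t + g z t)"
proof -
  obtain f' g' where "continuous_on (S \<times> {0..b}) (\<lambda>(z, t). f' z t)"
    "continuous_on (S \<times> {0..b}) (\<lambda>(z, t). g' z t)"
    "\<forall>z\<in>S. \<forall>t\<in>{0..b}. ((\<lambda>z. f z t) has_field_derivative f' z t) (at z)"
    "\<forall>z\<in>S. \<forall>t\<in>{0..b}. ((\<lambda>z. g z t) has_field_derivative g' z t) (at z)"
    using assms unfolding param_smooth_def by blast
  with assms show ?thesis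
    unfolding param_smooth_def
    by (auto simp: case_prod_unfold intro!: exI[of _ "\<lambda>z t. f' z t + g' z t"] continuous_intros
        derivative_eq_intros)
qed

lemma param_smooth_mult:
  assumes "param_smooth S b f" "param_smooth S b g"
  shows "param_smooth S b (\<lambda>z t. f z t * g z t)"
proof -
  obtain f' g' where "continuous_on (S \<times> {0..b}) (\<lambda>(z, t). f' z t)"
    "continuous_on (S \<times> {0..b}) (\<lambda>(z, t). g' z t)"
    "\<forall>z\<in>S. \<forall>t\<in>{0..b}. ((\<lambda>z. f z t) has_field_derivative f' z t) (at z)"
    "\<forall>z\<in>S. \<forall>t\<in>{0..b}. ((\<lambda>z. g z t) has_field_derivative g' z t) (at z)"
    using assms unfolding param_smooth_def by blast
  with assms show ?thesis
    unfolding param_smooth_def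
    by (auto simp: case_prod_unfold intro!: exI[of _ "\<lambda>z t. f' z t * g z t + g' z t * f z t"]
        continuous_intros DERIV_mult)
qed

lemma param_smooth_divide:
  assumes "param_smooth S b f" "param_smooth S b g"
    and nz: "\<And>z t. z \<in> S \<Longrightarrow> t \<in> {0..b} \<Longrightarrow> g z t \<noteq> 0"
  shows "param_smooth S b (\<lambda>z t. f z t / g z t)"
proof -
  obtain f' g' where "continuous_on (S \<times> {0..b}) (\<lambda>(z, t). f' z t)"
    "continuous_on (S \<times> {0..b}) (\<lambda>(z, t). g' z t)"
    "\<forall>z\<in>S. \<forall>t\<in>{0..b}. ((\<lambda>z. f z t) has_field_derivative f' z t) (at z)"
    "\<forall>z\<in>S. \<forall>t\<in>{0..b}. ((\<lambda>z. g z t) has_field_derivative g' z t) (at z)"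
    using assms unfolding param_smooth_def by blast
  with assms show ?thesis
    unfolding param_smooth_def
    by (auto simp: case_prod_unfold
        intro!: exI[of _ "\<lambda>z t. (f' z t * g z t - f z t * g' z t) / (g z t * g z t)"]
        continuous_intros DERIV_divide)
qed

lemma continuous_on_slice:
  assumes "continuous_on (S \<times> A) (\<lambda>(z, t). h z t)" "z \<in> S"
  shows "continuous_on A (h z)"
proof -
  have "continuous_on A (\<lambda>t. case (z, t) of (z, t) \<Rightarrow> h z t)"
    by (rule continuous_on_compose2[OF assms(1)], intro continuous_intros) (use assms in auto)
  then show ?thesis by simp
qed

text \<open>The variable upper limit is removed by freezing the integrand beyond \<open>t\<close>.\<close>

lemma continuous_on_integral_upto:
  fixes h :: "complex \<Rightarrow> real \<Rightarrow> complex"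
  assumes h: "continuous_on (S \<times> {0..b}) (\<lambda>(z, t). h z t)"
  shows "continuous_on (S \<times> {0..b}) (\<lambda>(z, t). integral {0..t} (h z))"
proof -
  have hz: "continuous_on {0..b} (h z)" if "z \<in> S" for z
    using continuous_on_slice[OF h that] .
  have eq: "integral {0..t} (h z) =
      integral (cbox 0 b) (\<lambda>u. h z (min u t)) - of_real (b - t) * h z t"
    if "z \<in> S" "t \<in> {0..b}" for z t
  proof -
    have c: "continuous_on {0..b} (\<lambda>u. h z (min u t))"
      by (rule continuous_on_compose2[OF hz[OF that(1)]]) (use that in \<open>auto intro!: continuous_intros\<close>)
    have "integral {0..b} (\<lambda>u. h z (min u t)) =
        integral {0..t} (\<lambda>u. h z (min u t)) + integral {t..b} (\<lambda>u. h z (min u t))"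
      by (rule Henstock_Kurzweil_Integration.integral_combine[symmetric])
        (use that c in \<open>auto intro: integrable_continuous_real\<close>)
    also have "integral {0..t} (\<lambda>u. h z (min u t)) = integral {0..t} (h z)"
      by (rule integral_cong) (auto simp: min_def)
    also have "integral {t..b} (\<lambda>u. h z (min u t)) = integral {t..b} (\<lambda>u. h z t)"
      by (rule integral_cong) (auto simp: min_def intro: arg_cong)
    also have "\<dots> = of_real (b - t) * h z t"
      using that by (simp add: scaleR_conv_of_real)
    finally show ?thesis by simp
  qed
  have "continuous_on ((S \<times> {0..b}) \<times> cbox 0 b)
      (\<lambda>q. case (fst (fst q), min (snd q) (snd (fst q))) of (z, t) \<Rightarrow> h z t)"
    by (rule continuous_on_compose2[OF h], intro continuous_intros) auto
  then have "continuous_on ((S \<times> {0..b}) \<times> cbox 0 b) (\<lambda>(p, u). h (fst p) (min u (snd p)))"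
    by (simp add: case_prod_unfold)
  then have "continuous_on (S \<times> {0..b})
      (\<lambda>p. integral (cbox 0 b) (\<lambda>u. h (fst p) (min u (snd p))))"
    by (rule integral_continuous_on_param)
  moreover have "continuous_on (S \<times> {0..b}) (\<lambda>p. of_real (b - snd p) * h (fst p) (snd p))"
    using h by (auto simp: case_prod_unfold intro!: continuous_intros)
  ultimately have "continuous_on (S \<times> {0..b})
      (\<lambda>p. integral (cbox 0 b) (\<lambda>u. h (fst p) (min u (snd p))) - of_real (b - snd p) * h (fst p) (snd p))"
    by (rule continuous_on_diff)
  then show ?thesis
    by (rule continuous_on_eq) (auto simp: eq)
qed

lemma param_smooth_imp_continuous:
  assumes "param_smooth S b h" "z \<in> S"
  shows "continuous_on {0..b} (h z)"
  using assms continuous_on_slice unfolding param_smooth_def by blast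

text \<open>The Leibniz rule needs a parameter derivative that is jointly continuous in both
  variables; this is why \<open>param_smooth\<close> carries one. Closure under integration is what
  keeps the Picard iterates inside the class.\<close>

lemma param_smooth_integral:
  assumes h: "param_smooth S b h" and S: "open S" "convex S"
  shows "param_smooth S b (\<lambda>z t. integral {0..t} (h z))"
proof -
  obtain h' where h': "continuous_on (S \<times> {0..b}) (\<lambda>(z, t). h' z t)"
    "\<And>z t. z \<in> S \<Longrightarrow> t \<in> {0..b} \<Longrightarrow> ((\<lambda>z. h z t) has_field_derivative h' z t) (at z)"
    using h unfolding param_smooth_def by blast
  have "((\<lambda>z. integral {0..t} (h z)) has_field_derivative integral {0..t} (h' z)) (at z)"
    if "z \<in> S" "t \<in> {0..b}" for z t
  proof -
    have "((\<lambda>z. integral (cbox 0 t) (h z)) has_field_derivative integral (cbox 0 t) (h' z)) (at z within S)"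
    proof (rule leibniz_rule_field_derivative)
      show "((\<lambda>z. h z u) has_field_derivative h' z u) (at z within S)"
        if "z \<in> S" "u \<in> cbox 0 t" for z u
        using h'(2)[of z u] that \<open>t \<in> {0..b}\<close> by (auto intro: has_field_derivative_at_within)
      show "h z integrable_on cbox 0 t" if "z \<in> S" for z
        unfolding cbox_interval
        by (rule integrable_continuous_real, rule continuous_on_subset[OF param_smooth_imp_continuous[OF h that]])
          (use \<open>t \<in> {0..b}\<close> in auto)
      show "continuous_on (S \<times> cbox 0 t) (\<lambda>(x, t). h' x t)"
        by (rule continuous_on_subset[OF h'(1)]) (use \<open>t \<in> {0..b}\<close> in auto)
    qed (fact that(1) S(2))+
    then show ?thesis unfolding at_within_open[OF that(1) S(1)] cbox_interval .
  qed
  moreover have "continuous_on (S \<times> {0..b}) (\<lambda>(z, t). integral {0..t} (h z))"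
    using h continuous_on_integral_upto unfolding param_smooth_def by blast
  ultimately show ?thesis
    using continuous_on_integral_upto[OF h'(1)] unfolding param_smooth_def
    by (intro conjI exI[of _ "\<lambda>z t. integral {0..t} (h' z)"]) blast+
qed

lemma param_smooth_imp_holomorphic:
  assumes "param_smooth S b h" "t \<in> {0..b}"
  shows "(\<lambda>z. h z t) holomorphic_on S"
  using assms unfolding param_smooth_def holomorphic_on_def
  by (meson field_differentiable_at_within field_differentiable_def)

lemma integral_in_Reals:
  fixes g :: "real \<Rightarrow> complex"
  assumes "\<And>t. t \<in> {a..b} \<Longrightarrow> g t \<in> \<real>"
  shows "integral {a..b} g \<in> \<real>"
proof (cases "g integrable_on {a..b}")
  case True
  have "Im (integral {a..b} g) = integral {a..b} (\<lambda>t. Im (g t))"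
    using integral_linear[OF True bounded_linear_Im] by (simp add: o_def)
  also have "\<dots> = integral {a..b} (\<lambda>t. 0)"
    by (rule integral_cong) (use assms in \<open>auto simp: complex_is_Real_iff\<close>)
  finally show ?thesis by (simp add: complex_is_Real_iff)
next
  case False
  then show ?thesis by (simp add: not_integrable_integral)
qed

section \<open>Picard iteration, uniform in a complex parameter\<close>

primrec picard_iter ::
  "(real \<Rightarrow> complex \<Rightarrow> complex \<Rightarrow> complex) \<Rightarrow> nat \<Rightarrow> complex \<Rightarrow> real \<Rightarrow> complex" where
  "picard_iter G 0 = (\<lambda>z t. 1)"
| "picard_iter G (Suc j) = (\<lambda>z t. 1 + integral {0..t} (\<lambda>\<tau>. G \<tau> z (picard_iter G j z \<tau>)))"

text \<open>The two bounds by 1/2 make the integral operator preserve functions with values in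
  \<open>cball 1 (1/2)\<close> and contract by 1/2, uniformly in the parameter; a uniform limit of
  holomorphic iterates is holomorphic. Smoothness of \<open>G\<close> is required only along
  functions with values in that ball, because the denominator of the polar equation is controlled
  only there. Reality passes to the limit since the real line is closed.\<close>

theorem picard_holomorphic:
  fixes G :: "real \<Rightarrow> complex \<Rightarrow> complex \<Rightarrow> complex"
  assumes S: "open S" "convex S" and b: "b > 0"
    and bd: "\<And>t z u. t \<in> {0..b} \<Longrightarrow> z \<in> S \<Longrightarrow> u \<in> cball 1 (1/2) \<Longrightarrow> b * norm (G t z u) \<le> 1/2"
    and lip: "\<And>t z u v. t \<in> {0..b} \<Longrightarrow> z \<in> S \<Longrightarrow> u \<in> cball 1 (1/2) \<Longrightarrow> v \<in> cball 1 (1/2) \<Longrightarrow>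
      b * norm (G t z u - G t z v) \<le> 1/2 * norm (u - v)"
    and smooth: "\<And>f. param_smooth S b f \<Longrightarrow> (\<And>z t. z \<in> S \<Longrightarrow> t \<in> {0..b} \<Longrightarrow> f z t \<in> cball 1 (1/2)) \<Longrightarrow>
      param_smooth S b (\<lambda>z t. G t z (f z t))"
    and real: "\<And>t z u. t \<in> {0..b} \<Longrightarrow> z \<in> \<real> \<Longrightarrow> u \<in> \<real> \<Longrightarrow> G t z u \<in> \<real>"
  shows "\<exists>f. (\<forall>z\<in>S. f z 0 = 1 \<and> (\<forall>t\<in>{0..b}. f z t \<in> cball 1 (1/2) \<and>
        (f z has_vector_derivative G t z (f z t)) (at t within {0..b}))) \<and>
      (\<forall>t\<in>{0..b}. (\<lambda>z. f z t) holomorphic_on S) \<and>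
      (\<forall>z\<in>S \<inter> \<real>. \<forall>t\<in>{0..b}. f z t \<in> \<real>)"
proof -
  let ?p = "picard_iter G"
  have inv: "param_smooth S b (?p j) \<and> (\<forall>z\<in>S. \<forall>t\<in>{0..b}. ?p j z t \<in> cball 1 (1/2))" for j
  proof (induction j)
    case 0
    then show ?case using param_smooth_time[of b "\<lambda>t. 1" S] by simp
  next
    case (Suc j)
    let ?h = "\<lambda>z t. G t z (?p j z t)"
    have h: "param_smooth S b ?h" using smooth Suc by blast
    have "norm (integral {0..t} (?h z)) \<le> 1/2" if "z \<in> S" "t \<in> {0..b}" for z t
    proof -
      have "norm (integral {0..t} (?h z)) \<le> 1 / (2*b) * (t - 0)"
        by (rule integral_bound)
          (use that continuous_on_subset[OF param_smooth_imp_continuous[OF h that(1)], of "{0..t}"] bd Suc b in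
            \<open>auto simp: field_simps\<close>)
      also have "\<dots> \<le> 1/2" using that b by (simp add: field_simps)
      finally show ?thesis .
    qed
    then show ?case
      using param_smooth_add[OF param_smooth_time[OF continuous_on_const[of _ 1]] param_smooth_integral[OF h S]]
      by (simp add: dist_norm)
  qed
  have hint: "continuous_on {0..b} (\<lambda>t. G t z (?p j z t))" if "z \<in> S" for j z
    using param_smooth_imp_continuous[OF smooth that, of "?p j"] inv[of j] by auto
  have step: "norm (?p (Suc j) z t - ?p j z t) \<le> (1/2) ^ Suc j" if "z \<in> S" "t \<in> {0..b}" for j z t
    using that(2)
  proof (induction j arbitrary: t)
    case 0
    then have "dist 1 (?p 1 z t) \<le> 1/2" using inv[of 1] that by (auto simp del: One_nat_def)
    then show ?case by (simp add: dist_norm norm_minus_commute)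
  next
    case (Suc j)
    have sub: "{0..t} \<subseteq> {0..b}" using Suc by auto
    have ig: "(\<lambda>\<tau>. G \<tau> z (?p i z \<tau>)) integrable_on {0..t}" for i
      using continuous_on_subset[OF hint[OF that(1), of i] sub] by (rule integrable_continuous_real)
    have "?p (Suc (Suc j)) z t - ?p (Suc j) z t =
        integral {0..t} (\<lambda>\<tau>. G \<tau> z (?p (Suc j) z \<tau>) - G \<tau> z (?p j z \<tau>))"
      using ig[of "Suc j"] ig[of j] by (subst integral_diff) (auto)
    also have "norm \<dots> \<le> (1/2) ^ Suc (Suc j) / b * (t - 0)"
    proof (rule integral_bound)
      show "continuous_on {0..t} (\<lambda>\<tau>. G \<tau> z (?p (Suc j) z \<tau>) - G \<tau> z (?p j z \<tau>))"
        using continuous_on_subset[OF hint[OF that(1)] sub] by (intro continuous_on_diff)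
      fix \<tau> assume "\<tau> \<in> {0..t}"
      then have \<tau>: "\<tau> \<in> {0..b}" using sub by auto
      have "b * norm (G \<tau> z (?p (Suc j) z \<tau>) - G \<tau> z (?p j z \<tau>)) \<le>
          1/2 * norm (?p (Suc j) z \<tau> - ?p j z \<tau>)"
        using lip[OF \<tau> that(1)] inv[of j] inv[of "Suc j"] \<tau> that(1) by blast
      also have "\<dots> \<le> 1/2 * (1/2) ^ Suc j" using Suc.IH[OF \<tau>] by simp
      finally show "norm (G \<tau> z (?p (Suc j) z \<tau>) - G \<tau> z (?p j z \<tau>)) \<le> (1/2) ^ Suc (Suc j) / b"
        using b by (simp add: field_simps)
    qed (use Suc in auto)
    also have "\<dots> \<le> (1/2) ^ Suc (Suc j)" using Suc b by (simp add: field_simps)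
    finally show ?case .
  qed
  \<comment> \<open>The bound is the exact partial sum of the geometric series, written as a
    difference of two powers so that the induction closes.\<close>
  have far: "norm (?p (i + k) z t - ?p i z t) \<le> (1/2) ^ i - (1/2) ^ (i + k)"
    if "z \<in> S" "t \<in> {0..b}" for i k z t
  proof (induction k)
    case (Suc k)
    have "norm (?p (i + Suc k) z t - ?p i z t) \<le>
        norm (?p (Suc (i + k)) z t - ?p (i + k) z t) + norm (?p (i + k) z t - ?p i z t)"
      by (metis add_Suc_right norm_triangle_ineq diff_add_cancel add_diff_eq)
    also have "\<dots> \<le> (1/2) ^ Suc (i + k) + ((1/2) ^ i - (1/2) ^ (i + k))"
      using step[OF that, of "i + k"] Suc by linarith
    finally show ?case by simp
  qed simp
  have cauchy: "Cauchy (\<lambda>j. ?p j z t)" if "z \<in> S" "t \<in> {0..b}" for z t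
  proof (rule metric_CauchyI)
    fix e :: real assume "e > 0"
    obtain M where M: "(1/2::real) ^ M < e/2"
      using real_arch_pow_inv[of "e/2" "1/2"] \<open>e > 0\<close> by auto
    have near: "norm (?p m z t - ?p M z t) < e/2" if "m \<ge> M" for m
      using far[OF \<open>z \<in> S\<close> \<open>t \<in> {0..b}\<close>, of M "m - M"] that M
      by (smt (verit, best) le_add_diff_inverse zero_le_power divide_nonneg_nonneg)
    show "\<exists>M. \<forall>m\<ge>M. \<forall>n\<ge>M. dist (?p m z t) (?p n z t) < e"
      using near by (intro exI[of _ M]) (metis dist_norm dist_triangle_half_l norm_minus_commute)
  qed
  define f where "f z t = lim (\<lambda>j. ?p j z t)" for z t
  have lim: "(\<lambda>j. ?p j z t) \<longlonglongrightarrow> f z t" if "z \<in> S" "t \<in> {0..b}" for z t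
    using cauchy[OF that] unfolding f_def by (simp add: Cauchy_convergent_iff convergent_LIMSEQ_iff)
  have near: "norm (f z t - ?p i z t) \<le> (1/2) ^ i" if "z \<in> S" "t \<in> {0..b}" for i z t
  proof (rule LIMSEQ_le_const2)
    show "(\<lambda>k. norm (?p (i + k) z t - ?p i z t)) \<longlonglongrightarrow> norm (f z t - ?p i z t)"
      using LIMSEQ_ignore_initial_segment[OF lim[OF that], of i]
      by (auto intro!: tendsto_intros simp: add.commute)
    show "\<exists>N. \<forall>n\<ge>N. norm (?p (i + n) z t - ?p i z t) \<le> (1/2) ^ i"
      using far[OF that, of i] by (intro exI[of _ 0] allI impI) (smt (verit) zero_le_power divide_nonneg_nonneg)
  qed
  have pw0: "(\<lambda>i. (1/2::real) ^ i) \<longlonglongrightarrow> 0" by (rule LIMSEQ_power_zero) simp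
  have ulim: "uniform_limit (S \<times> {0..b}) (\<lambda>j (z, t). ?p j z t) (\<lambda>(z, t). f z t) sequentially"
  proof (rule uniform_limitI)
    fix e :: real assume "e > 0"
    then have "\<forall>\<^sub>F i in sequentially. (1/2::real) ^ i < e"
      using order_tendstoD(2)[OF pw0] by auto
    then show "\<forall>\<^sub>F j in sequentially. \<forall>x\<in>S \<times> {0..b}.
        dist (case x of (z, t) \<Rightarrow> ?p j z t) (case x of (z, t) \<Rightarrow> f z t) < e"
      by eventually_elim (auto simp: dist_norm norm_minus_commute intro: le_less_trans[OF near])
  qed
  have fball: "f z t \<in> cball 1 (1/2)" if "z \<in> S" "t \<in> {0..b}" for z t
    by (rule Lim_in_closed_set[OF closed_cball _ _ lim[OF that]]) (use inv that in \<open>simp_all del: mem_cball\<close>)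
  have fcont: "continuous_on {0..b} (f z)" if "z \<in> S" for z
  proof -
    have "continuous_on (S \<times> {0..b}) (\<lambda>(z, t). f z t)"
      by (rule uniform_limit_theorem[OF _ ulim]) (use inv in \<open>auto simp: param_smooth_def\<close>)
    then show ?thesis
      using continuous_on_slice that by blast
  qed
  have Gcont: "continuous_on {0..b} (\<lambda>t. G t z (f z t))" if "z \<in> S" for z
  proof (rule uniform_limit_theorem)
    show "\<forall>\<^sub>F j in sequentially. continuous_on {0..b} (\<lambda>t. G t z (?p j z t))"
      using hint[OF that] by auto
    show "uniform_limit {0..b} (\<lambda>j t. G t z (?p j z t)) (\<lambda>t. G t z (f z t)) sequentially"
    proof (rule uniform_limitI)
      fix e :: real assume "e > 0"
      then have "\<forall>\<^sub>F i in sequentially. (1/2::real) ^ i < e * b"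
        using order_tendstoD(2)[OF pw0] b by auto
      then show "\<forall>\<^sub>F j in sequentially. \<forall>t\<in>{0..b}. dist (G t z (?p j z t)) (G t z (f z t)) < e"
      proof eventually_elim
        case (elim j)
        show ?case
        proof
          fix t assume t: "t \<in> {0..b}"
          have "b * norm (G t z (?p j z t) - G t z (f z t)) \<le> 1/2 * norm (?p j z t - f z t)"
            using lip[OF t that] inv[of j] fball t that by blast
          also have "\<dots> \<le> (1/2) ^ j"
            using near[OF that t, of j] norm_ge_zero[of "f z t - ?p j z t"]
            unfolding norm_minus_commute[of "?p j z t"] by linarith
          also have "\<dots> < e * b" by fact
          finally show "dist (G t z (?p j z t)) (G t z (f z t)) < e"
            using b by (simp add: dist_norm mult.commute)
        qed
      qed
    qed
  qed simp
  have feq: "f z t = 1 + integral {0..t} (\<lambda>\<tau>. G \<tau> z (f z \<tau>))" if "z \<in> S" "t \<in> {0..b}" for z t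
  proof -
    have sub: "{0..t} \<subseteq> {0..b}" using that by auto
    have ig: "(\<lambda>\<tau>. G \<tau> z (?p i z \<tau>)) integrable_on {0..t}" for i
      using continuous_on_subset[OF hint[OF that(1), of i] sub] by (rule integrable_continuous_real)
    have igf: "(\<lambda>\<tau>. G \<tau> z (f z \<tau>)) integrable_on {0..t}"
      using continuous_on_subset[OF Gcont[OF that(1)] sub] by (rule integrable_continuous_real)
    \<comment> \<open>The limit is compared with iterate i + 1, which is the integral operator
      applied to iterate i. Both resulting errors are at most (1/2)^i.\<close>
    have "norm (f z t - (1 + integral {0..t} (\<lambda>\<tau>. G \<tau> z (f z \<tau>)))) \<le> 2 * (1/2) ^ i" for i
    proof -
      have "norm (integral {0..t} (\<lambda>\<tau>. G \<tau> z (?p i z \<tau>) - G \<tau> z (f z \<tau>))) \<le> (1/2) ^ i / b * (t - 0)"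
      proof (rule integral_bound)
        show "continuous_on {0..t} (\<lambda>\<tau>. G \<tau> z (?p i z \<tau>) - G \<tau> z (f z \<tau>))"
          using continuous_on_subset[OF hint[OF that(1)] sub] continuous_on_subset[OF Gcont[OF that(1)] sub]
          by (intro continuous_on_diff)
        fix \<tau> assume "\<tau> \<in> {0..t}"
        then have \<tau>: "\<tau> \<in> {0..b}" using sub by auto
        have "b * norm (G \<tau> z (?p i z \<tau>) - G \<tau> z (f z \<tau>)) \<le> 1/2 * norm (?p i z \<tau> - f z \<tau>)"
          using lip[OF \<tau> that(1)] inv[of i] fball \<tau> that(1) by blast
        also have "\<dots> \<le> (1/2) ^ i"
          using near[OF that(1) \<tau>, of i] norm_ge_zero[of "f z \<tau> - ?p i z \<tau>"]
          unfolding norm_minus_commute[of "?p i z \<tau>"] by linarith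
        finally show "norm (G \<tau> z (?p i z \<tau>) - G \<tau> z (f z \<tau>)) \<le> (1/2) ^ i / b"
          using b by (simp add: field_simps)
      qed (use that in auto)
      also have "\<dots> \<le> (1/2) ^ i" using that b by (simp add: field_simps)
      finally have "norm (?p (Suc i) z t - (1 + integral {0..t} (\<lambda>\<tau>. G \<tau> z (f z \<tau>)))) \<le> (1/2) ^ i"
        using ig igf by (simp add: integral_diff)
      moreover have "norm (f z t - ?p (Suc i) z t) \<le> (1/2) ^ i"
        using near[OF that, of "Suc i"] norm_ge_zero[of "f z t - ?p (Suc i) z t"]
        by (simp del: picard_iter.simps norm_ge_zero)
      ultimately show ?thesis by (smt (verit) norm_diff_triangle_le)
    qed
    then have "norm (f z t - (1 + integral {0..t} (\<lambda>\<tau>. G \<tau> z (f z \<tau>)))) \<le> 2 * 0"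
      by (intro LIMSEQ_le_const[OF tendsto_mult[OF tendsto_const pw0]]) blast
    then show ?thesis by simp
  qed
  have deriv: "(f z has_vector_derivative G t z (f z t)) (at t within {0..b})"
    if "z \<in> S" "t \<in> {0..b}" for z t
  proof -
    have "((\<lambda>t. 1 + integral {0..t} (\<lambda>\<tau>. G \<tau> z (f z \<tau>))) has_vector_derivative G t z (f z t))
        (at t within {0..b})"
      using has_vector_derivative_add[OF has_vector_derivative_const
          integral_has_vector_derivative[OF Gcont[OF that(1)] that(2)]] by simp
    then show ?thesis
      by (rule has_vector_derivative_transform[rotated 2]) (use that feq in auto)
  qed
  have hol: "(\<lambda>z. f z t) holomorphic_on S" if "t \<in> {0..b}" for t
  proof (rule holomorphic_uniform_sequence[OF S(1)])
    show "(\<lambda>z. ?p j z t) holomorphic_on S" for j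
      using param_smooth_imp_holomorphic inv that by blast
    fix x assume "x \<in> S"
    then obtain e where "e > 0" "cball x e \<subseteq> S" using S(1) open_contains_cball by blast
    moreover have "uniform_limit (cball x e) (\<lambda>j z. ?p j z t) (\<lambda>z. f z t) sequentially"
    proof (rule uniform_limitI)
      fix r :: real assume "r > 0"
      from uniform_limitD[OF ulim this]
      show "\<forall>\<^sub>F j in sequentially. \<forall>z\<in>cball x e. dist (?p j z t) (f z t) < r"
      proof eventually_elim
        case (elim j)
        show ?case
        proof
          fix z assume "z \<in> cball x e"
          then have "(z, t) \<in> S \<times> {0..b}" using \<open>cball x e \<subseteq> S\<close> that by auto
          from bspec[OF elim this] show "dist (?p j z t) (f z t) < r" by simp
        qed
      qed
    qed
    ultimately show "\<exists>d>0. cball x d \<subseteq> S \<and> uniform_limit (cball x d) (\<lambda>j z. ?p j z t) (\<lambda>z. f z t) sequentially"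
      by blast
  qed
  have real': "f z t \<in> \<real>" if "z \<in> S" "z \<in> \<real>" "t \<in> {0..b}" for z t
  proof -
    have "\<forall>t\<in>{0..b}. ?p j z t \<in> \<real>" for j
    proof (induction j)
      case (Suc j)
      show ?case
      proof
        fix t assume "t \<in> {0..b}"
        have "integral {0..t} (\<lambda>\<tau>. G \<tau> z (?p j z \<tau>)) \<in> \<real>"
          by (rule integral_in_Reals, rule real) (use Suc \<open>t \<in> {0..b}\<close> that in auto)
        then show "?p (Suc j) z t \<in> \<real>" by simp
      qed
    qed simp
    then show ?thesis
      by (intro Lim_in_closed_set[OF closed_complex_Reals _ _ lim[OF that(1,3)]]) (use that in simp_all)
  qed
  have f0: "f z 0 = 1" if "z \<in> S" for z
    using feq[OF that, of 0] b by simp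
  show ?thesis
    using fball deriv hol real' f0 by (intro exI[of _ f]) auto
qed

subsection \<open>The polar equation of the right half system\<close>

text \<open>With \<open>X = R sin t\<close>, \<open>Y = - R cos t\<close> and \<open>R = z u\<close>, an orbit of the right system starting at
  distance \<open>z\<close> satisfies \<open>u' = polar_rhs d l m n t z u\<close>, \<open>u 0 = 1\<close>, which makes sense for complex \<open>z\<close>.\<close>

definition radial_coeff :: "real \<Rightarrow> real \<Rightarrow> real \<Rightarrow> real \<Rightarrow> real" where
  "radial_coeff l m n t = l * sin t ^ 3 - m * sin t ^ 2 * cos t + (n - 1) * sin t * cos t ^ 2"

text \<open>The quadratic part of the field in polar form: along orbits R' = d R sin^2 t +
  \<open>radial_coeff\<close> R^2 and t' = 1 + d sin t cos t + \<open>angular_coeff\<close> R. The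
  quotient of the two, with R = z u, is \<open>polar_rhs\<close>.\<close>

definition angular_coeff :: "real \<Rightarrow> real \<Rightarrow> real \<Rightarrow> real \<Rightarrow> real" where
  "angular_coeff l m n t = (l + 1) * sin t ^ 2 * cos t - m * sin t * cos t ^ 2 + n * cos t ^ 3"

text \<open>One number that bounds both trigonometric polynomials. Being at least 1, it lets E = e *
  \<open>coeff_bound\<close> dominate e, so that |d| <= e^2 implies |d| <= E^2. It depends on m only
  through |m| and is therefore insensitive to the reflection.\<close>

definition coeff_bound :: "real \<Rightarrow> real \<Rightarrow> real \<Rightarrow> real" where
  "coeff_bound l m n = \<bar>l\<bar> + \<bar>m\<bar> + \<bar>n\<bar> + 1"

definition polar_rhs :: "real \<Rightarrow> real \<Rightarrow> real \<Rightarrow> real \<Rightarrow> real \<Rightarrow> complex \<Rightarrow> complex \<Rightarrow> complex" where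
  "polar_rhs d l m n t z u =
     (of_real (d * sin t ^ 2) * u + (z * of_real (radial_coeff l m n t)) * u ^ 2) /
     (1 + of_real (d * sin t * cos t) + (z * of_real (angular_coeff l m n t)) * u)"

lemma coeff_bound_ge_1: "coeff_bound l m n \<ge> 1"
  by (simp add: coeff_bound_def)

lemma abs_mult_le_left:
  fixes x y :: real
  assumes "\<bar>y\<bar> \<le> 1" shows "\<bar>x * y\<bar> \<le> \<bar>x\<bar>"
  using mult_left_mono[OF assms, of "\<bar>x\<bar>"] by (simp add: abs_mult)

lemma abs_le_1_mult:
  fixes x y :: real
  assumes "\<bar>x\<bar> \<le> 1" "\<bar>y\<bar> \<le> 1" shows "\<bar>x * y\<bar> \<le> 1"
  using mult_mono[OF assms] by (simp add: abs_mult)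

lemma abs_le_1_power:
  fixes x :: real
  assumes "\<bar>x\<bar> \<le> 1" shows "\<bar>x ^ k\<bar> \<le> 1"
  using power_le_one[OF abs_ge_zero assms] by (simp add: power_abs)

lemma radial_coeff_bound: "\<bar>radial_coeff l m n t\<bar> \<le> coeff_bound l m n"
proof -
  have "\<bar>l * sin t ^ 3\<bar> \<le> \<bar>l\<bar>" "\<bar>m * (sin t ^ 2 * cos t)\<bar> \<le> \<bar>m\<bar>"
    "\<bar>(n - 1) * (sin t * cos t ^ 2)\<bar> \<le> \<bar>n - 1\<bar>"
    by (intro abs_mult_le_left abs_le_1_mult abs_le_1_power abs_sin_le_one abs_cos_le_one)+
  then show ?thesis
    unfolding radial_coeff_def coeff_bound_def mult.assoc by linarith
qed

lemma angular_coeff_bound: "\<bar>angular_coeff l m n t\<bar> \<le> coeff_bound l m n"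
proof -
  have "\<bar>(l + 1) * (sin t ^ 2 * cos t)\<bar> \<le> \<bar>l + 1\<bar>" "\<bar>m * (sin t * cos t ^ 2)\<bar> \<le> \<bar>m\<bar>"
    "\<bar>n * cos t ^ 3\<bar> \<le> \<bar>n\<bar>"
    by (intro abs_mult_le_left abs_le_1_mult abs_le_1_power abs_sin_le_one abs_cos_le_one)+
  then show ?thesis
    unfolding angular_coeff_def coeff_bound_def mult.assoc by linarith
qed

section \<open>Estimates for the quotient in the polar equation\<close>

context
  fixes p q w z :: complex and E :: real
  assumes p: "norm p \<le> E^2" and q: "norm q \<le> E" and w: "norm w \<le> E^2" and z: "norm z \<le> E"
    and E: "E \<le> 1/300"
begin

lemma frac_bound_nonneg: "E \<ge> 0" using q norm_ge_zero[of q] by linarith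

lemma frac_bound_sq: "E^2 \<le> E / 300"
  using mult_left_mono[OF E frac_bound_nonneg] by (simp add: power2_eq_square)

lemma norm_near_1: "norm (u - 1) \<le> 1/2 \<Longrightarrow> norm (u::complex) \<le> 3/2"
  using norm_triangle_ineq[of "u - 1" 1] by simp

text \<open>In the application p = d sin^2 t, q is the initial distance times
  \<open>radial_coeff\<close>, w = d sin t cos t, and \<open>z\<close> is the initial distance times
  \<open>angular_coeff\<close>. So p and w are of second order in E, while q and \<open>z\<close>
  are of first order. The denominator differs from 1 by at most E^2 + 3 E / 2.\<close>

lemma frac_den:
  assumes u: "norm (u - 1) \<le> 1/2"
  shows "norm (1 + w + z * u) \<ge> 1/2"
proof -
  have "norm (z * u) \<le> E * (3/2)"
    unfolding norm_mult by (intro mult_mono z norm_near_1 u frac_bound_nonneg norm_ge_zero)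
  then have "norm (w + z * u) \<le> 1/2"
    using norm_triangle_ineq[of w "z * u"] w frac_bound_sq E by linarith
  then show ?thesis
    using norm_triangle_ineq[of "1 + w + z * u" "-(w + z * u)"]
    by (simp only: norm_minus_cancel) simp
qed

lemma frac_bound:
  assumes u: "norm (u - 1) \<le> 1/2"
  shows "norm ((p * u + q * u^2) / (1 + w + z * u)) \<le> 8 * E"
proof -
  have u': "norm u \<le> 3/2" using norm_near_1[OF u] .
  have "norm (p * u) \<le> E^2 * (3/2)" "norm (q * u^2) \<le> E * (3/2)^2"
    unfolding norm_mult norm_power
    by (intro mult_mono p q u' power_mono norm_ge_zero frac_bound_nonneg zero_le_power)+
  then have "norm (p * u + q * u^2) \<le> 8 * E * (1/2)"
    using norm_triangle_ineq[of "p * u" "q * u^2"] frac_bound_sq E frac_bound_nonneg by (simp add: power2_eq_square)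
  also have "\<dots> \<le> 8 * E * norm (1 + w + z * u)"
    using frac_den[OF u] frac_bound_nonneg by (intro mult_left_mono) auto
  finally show ?thesis
    unfolding norm_divide using frac_den[OF u] by (subst pos_divide_le_eq) (linarith, simp)
qed

text \<open>Cross-multiplication exposes the factor u - v. The cofactor is at most 9 E, and the two
  denominators, each at least 1/2, contribute the factor 4.\<close>

lemma frac_lipschitz:
  assumes u: "norm (u - 1) \<le> 1/2" and v: "norm (v - 1) \<le> 1/2"
  shows "norm ((p * u + q * u^2) / (1 + w + z * u) - (p * v + q * v^2) / (1 + w + z * v)) \<le>
    36 * E * norm (u - v)"
proof -
  let ?Du = "1 + w + z * u" and ?Dv = "1 + w + z * v"
  have nz: "?Du \<noteq> 0" "?Dv \<noteq> 0" using frac_den[OF u] frac_den[OF v] by auto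
  have u': "norm u \<le> 3/2" and v': "norm v \<le> 3/2" using norm_near_1 u v by auto
  let ?K = "p * (1 + w) + q * (1 + w) * (u + v) + q * z * (u * v)"
  have eq: "(p * u + q * u^2) / ?Du - (p * v + q * v^2) / ?Dv = (u - v) * ?K / (?Du * ?Dv)"
    using nz by (simp add: divide_simps) (simp add: algebra_simps power2_eq_square)
  have w2: "norm (1 + w) \<le> 2"
    using norm_triangle_ineq[of 1 w] w frac_bound_sq E by simp
  have "norm (p * (1 + w)) \<le> E^2 * 2" "norm (q * (1 + w) * (u + v)) \<le> E * 2 * 3"
    "norm (q * z * (u * v)) \<le> E * E * (3/2 * (3/2))"
    unfolding norm_mult
    using u' v' norm_triangle_ineq[of u v]
    by (intro mult_mono p q z w2 norm_ge_zero frac_bound_nonneg zero_le_power mult_nonneg_nonneg; simp)+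
  then have K: "norm ?K \<le> 9 * E"
    using norm_triangle_ineq[of "p * (1 + w) + q * (1 + w) * (u + v)" "q * z * (u * v)"]
      norm_triangle_ineq[of "p * (1 + w)" "q * (1 + w) * (u + v)"] frac_bound_sq frac_bound_nonneg
    by (simp add: power2_eq_square)
  have D: "1/4 \<le> norm ?Du * norm ?Dv"
    using mult_mono[OF frac_den[OF u] frac_den[OF v]] by simp
  have "norm (u - v) * norm ?K \<le> norm (u - v) * (9 * E)"
    by (intro mult_left_mono K norm_ge_zero)
  also have "\<dots> = 36 * E * norm (u - v) * (1/4)" by simp
  also have "\<dots> \<le> 36 * E * norm (u - v) * (norm ?Du * norm ?Dv)"
    by (intro mult_left_mono D mult_nonneg_nonneg norm_ge_zero) (use frac_bound_nonneg in auto)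
  finally show ?thesis
    unfolding eq norm_divide norm_mult using D by (subst pos_divide_le_eq) (linarith, simp)
qed

text \<open>The hypothesis radius 26 E is what integrating \<open>frac_bound\<close> over [0, pi]
  provides: 8 * 3.15 < 26. The numerator of the difference is at most 69 E^2, and dividing by a
  number of size at least 1/2 doubles this.\<close>

lemma frac_first_order:
  assumes u: "norm (u - 1) \<le> 26 * E"
  shows "norm ((p * u + q * u^2) / (1 + w + z * u) - q) \<le> 138 * E^2"
proof -
  have u2: "norm (u - 1) \<le> 1/2" using u E by linarith
  let ?D = "1 + w + z * u"
  have nz: "?D \<noteq> 0" using frac_den[OF u2] by auto
  have u': "norm u \<le> 3/2" using norm_near_1 u2 by auto
  have u1: "norm (u + 1) \<le> 5/2" using norm_triangle_ineq[of u 1] u' by simp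
  let ?N = "p * u + q * ((u - 1) * (u + 1)) - q * w - q * z * u"
  have eq: "(p * u + q * u^2) / ?D - q = ?N / ?D"
    using nz by (simp add: divide_simps) (simp add: algebra_simps power2_eq_square)
  have "norm (p * u) \<le> E^2 * (3/2)" "norm (q * ((u - 1) * (u + 1))) \<le> E * (26 * E * (5/2))"
    "norm (q * w) \<le> E * E^2" "norm (q * z * u) \<le> E * E * (3/2)"
    unfolding norm_mult
    by (intro mult_mono p q z w u u' u1 norm_ge_zero frac_bound_nonneg zero_le_power mult_nonneg_nonneg; simp add: frac_bound_nonneg)+
  moreover have "E * E^2 \<le> E^2" using E frac_bound_nonneg by (intro mult_left_le_one_le) auto
  moreover have "norm ?N \<le> norm (p * u) + norm (q * ((u - 1) * (u + 1))) + norm (q * w) + norm (q * z * u)"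
    using norm_triangle_ineq4[of "p * u + q * ((u - 1) * (u + 1)) - q * w" "q * z * u"]
      norm_triangle_ineq4[of "p * u + q * ((u - 1) * (u + 1))" "q * w"]
      norm_triangle_ineq[of "p * u" "q * ((u - 1) * (u + 1))"] by linarith
  ultimately have "norm ?N \<le> 138 * E^2 * (1/2)" by (simp add: power2_eq_square)
  also have "\<dots> \<le> 138 * E^2 * norm ?D"
    using frac_den[OF u2] by (intro mult_left_mono) auto
  finally show ?thesis
    unfolding eq norm_divide using frac_den[OF u2] by (subst pos_divide_le_eq) (linarith, simp)
qed

text \<open>Substituting u = 1 + h up to order E^2 and 1 / (1 + z) = 1 - z up to order E^2 produces
  the approximant p + q + 2 q h - q z. The term h will be the first-order part of the solution, and
  440 = 138 * 3.15 rounded up.\<close>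

lemma frac_second_order:
  assumes u: "norm (u - 1) \<le> 26 * E" and h: "norm h \<le> 4 * E" and uh: "norm (u - 1 - h) \<le> 440 * E^2"
  shows "norm ((p * u + q * u^2) / (1 + w + z * u) - (p + q + 2 * q * h - q * z)) \<le> 3300 * E^3"
proof -
  have u2: "norm (u - 1) \<le> 1/2" using u E by linarith
  let ?D = "1 + w + z * u" and ?v = "u - 1"
  have nz: "?D \<noteq> 0" using frac_den[OF u2] by auto
  \<comment> \<open>The second-order part of the approximant q + r. Multiplying q + r by the
    denominator cancels all terms of first and second order, so each summand of \<open>?N\<close> is
    of third order.\<close>
  define r where "r = p + 2 * q * h - q * z"
  let ?N = "p * ?v + 2 * q * (u - 1 - h) + q * ?v^2 - (q + r) * w - r * z - (q + r) * z * ?v"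
  have eq: "(p * u + q * u^2) / ?D - (p + q + 2 * q * h - q * z) = ?N / ?D"
    unfolding r_def using nz by (simp add: divide_simps) (simp add: algebra_simps power2_eq_square)
  have "norm (2 * q * h) \<le> 2 * E * (4 * E)" "norm (q * z) \<le> E * E"
    unfolding norm_mult by (intro mult_mono q z h norm_ge_zero frac_bound_nonneg mult_nonneg_nonneg; simp add: frac_bound_nonneg q)+
  then have r: "norm r \<le> 10 * E^2"
    using norm_triangle_ineq4[of "p + 2 * q * h" "q * z"] norm_triangle_ineq[of p "2 * q * h"] p
    by (simp add: r_def power2_eq_square)
  have qr: "norm (q + r) \<le> 2 * E"
    using norm_triangle_ineq[of q r] q r frac_bound_sq frac_bound_nonneg by linarith
  have "norm (p * ?v) \<le> E^2 * (26 * E)" "norm (2 * q * (u - 1 - h)) \<le> 2 * E * (440 * E^2)"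
    "norm (q * ?v^2) \<le> E * (26 * E)^2" "norm ((q + r) * w) \<le> 2 * E * E^2"
    "norm (r * z) \<le> 10 * E^2 * E" "norm ((q + r) * z * ?v) \<le> 2 * E * E * (26 * E)"
    unfolding norm_mult norm_power
    by (intro mult_mono p q z w u r qr uh power_mono norm_ge_zero frac_bound_nonneg zero_le_power mult_nonneg_nonneg;
        simp add: frac_bound_nonneg q)+
  moreover have "norm ?N \<le> norm (p * ?v) + norm (2 * q * (u - 1 - h)) + norm (q * ?v^2) +
      norm ((q + r) * w) + norm (r * z) + norm ((q + r) * z * ?v)"
    by (intro order.trans[OF norm_triangle_ineq4] order.trans[OF norm_triangle_ineq] add_mono order.refl)
  moreover have "E^2 * (26 * E) = 26 * E^3" "2 * E * (440 * E^2) = 880 * E^3"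
    "E * (26 * E)^2 = 676 * E^3" "2 * E * E^2 = 2 * E^3" "10 * E^2 * E = 10 * E^3"
    "2 * E * E * (26 * E) = 52 * E^3"
    by (simp_all add: power2_eq_square power3_eq_cube)
  ultimately have "norm ?N \<le> 3300 * E^3 * (1/2)"
    using zero_le_power[OF frac_bound_nonneg, of 3] by linarith
  also have "\<dots> \<le> 3300 * E^3 * norm ?D"
    using frac_den[OF u2] frac_bound_nonneg by (intro mult_left_mono) auto
  finally show ?thesis
    unfolding eq norm_divide using frac_den[OF u2] by (subst pos_divide_le_eq) (linarith, simp)
qed

end


section \<open>Explicit integrals of the first- and second-order terms\<close>

definition radial_primitive :: "real \<Rightarrow> real \<Rightarrow> real \<Rightarrow> real \<Rightarrow> real" where
  "radial_primitive l m n t =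
     l * (2/3 - cos t + cos t ^ 3 / 3) - m * sin t ^ 3 / 3 + (n - 1) * (1 - cos t ^ 3) / 3"

text \<open>The antiderivative, vanishing at 0, of the product of the radial and the angular
  coefficient. The local names are the integrals from 0 to t of sin^2, sin^4, sin^4 cos^2 and sin^2
  cos^4, each reduced to the previous ones by partial integration.\<close>

definition product_primitive :: "real \<Rightarrow> real \<Rightarrow> real \<Rightarrow> real \<Rightarrow> real" where
  "product_primitive l m n t =
     (let s2 = (t - sin t * cos t) / 2; s4 = (3 * s2 - sin t ^ 3 * cos t) / 4;
        s4c2 = (s4 + sin t ^ 5 * cos t) / 6; s2c4 = s2 - s4 - s4c2
      in l * (l + 1) * sin t ^ 6 / 6 + (l * n + (n - 1) * (l + 1) + m^2) * (sin t ^ 4 / 4 - sin t ^ 6 / 6)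
        + (n - 1) * n * (1 - cos t ^ 6) / 6 - m * ((2 * l + 1) * s4c2 + (2 * n - 1) * s2c4))"

lemma has_derivative_radial_primitive:
  "(radial_primitive l m n has_real_derivative radial_coeff l m n t) (at t)"
proof -
  have c3: "cos t ^ 3 = cos t * (1 - sin t ^ 2)"
    unfolding cos_squared_eq[symmetric] by (simp add: power2_eq_square power3_eq_cube)
  have "(radial_primitive l m n has_real_derivative
      (l * (sin t - cos t ^ 2 * sin t) - m * sin t ^ 2 * cos t + (n - 1) * (cos t ^ 2 * sin t))) (at t)"
    unfolding radial_primitive_def
    by (rule derivative_eq_intros refl | simp)+
  moreover have "(l * (sin t - cos t ^ 2 * sin t) - m * sin t ^ 2 * cos t + (n - 1) * (cos t ^ 2 * sin t)) =
      radial_coeff l m n t"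
    unfolding radial_coeff_def cos_squared_eq by (simp add: algebra_simps power2_eq_square power3_eq_cube)
  ultimately show ?thesis by simp
qed

lemma has_derivative_product_primitive:
  "(product_primitive l m n has_real_derivative radial_coeff l m n t * angular_coeff l m n t) (at t)"
proof -
  define s c where "s = sin t" and "c = cos t"
  have cs: "c * c = 1 - s * s"
    using cos_squared_eq[of t] by (simp add: s_def c_def power2_eq_square)
  \<comment> \<open>\<open>D2\<close>, \<open>D4\<close> and \<open>D42\<close> are the raw
    derivatives of the auxiliary integrals. They are first identified with s^2, s^4 and s^4 c^2,
    which leaves a polynomial identity modulo c^2 = 1 - s^2.\<close>
  define D2 where "D2 = (1 - (c * c - s * s)) / 2"
  define D4 where "D4 = (3 * D2 - (3 * s^2 * c * c - s^3 * s)) / 4"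
  define D42 where "D42 = (D4 + (5 * s^4 * c * c - s^5 * s)) / 6"
  have D2: "D2 = s * s" unfolding D2_def cs by simp
  have "3 * (s * s) - (3 * s^2 * c * c - s^3 * s) = 4 * s^4" using cs by algebra
  then have D4: "D4 = s^4" unfolding D4_def D2 by simp
  have "s^4 + (5 * s^4 * c * c - s^5 * s) = 6 * (s^4 * (c * c))" using cs by algebra
  then have D42: "D42 = s^4 * (c * c)" unfolding D42_def D4 by simp
  have "(product_primitive l m n has_real_derivative
      (l * (l + 1) * (s^5 * c) + (l * n + (n - 1) * (l + 1) + m^2) * (s^3 * c - s^5 * c)
        + (n - 1) * n * (c^5 * s) - m * ((2 * l + 1) * D42 + (2 * n - 1) * (D2 - D4 - D42)))) (at t)"
    unfolding product_primitive_def Let_def D42_def D4_def D2_def s_def c_def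
    by (rule derivative_eq_intros refl | simp)+ (simp add: field_simps eval_nat_numeral)
  moreover have "l * (l + 1) * (s^5 * c) + (l * n + (n - 1) * (l + 1) + m^2) * (s^3 * c - s^5 * c)
        + (n - 1) * n * (c^5 * s) - m * ((2 * l + 1) * D42 + (2 * n - 1) * (D2 - D4 - D42)) =
      radial_coeff l m n t * angular_coeff l m n t"
    unfolding radial_coeff_def angular_coeff_def D2 D4 D42 s_def[symmetric] c_def[symmetric]
    using cs by algebra
  ultimately show ?thesis by simp
qed

lemma radial_primitive_0: "radial_primitive l m n 0 = 0"
  by (simp add: radial_primitive_def)

lemma product_primitive_0: "product_primitive l m n 0 = 0"
  by (simp add: product_primitive_def)

lemma radial_primitive_pi: "radial_primitive l m n pi = (4 * l + 2 * (n - 1)) / 3"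
  by (simp add: radial_primitive_def field_simps)

text \<open>At pi the powers of sin and 1 - cos^6 vanish, and only the terms with the factor m
  remain. The integrals of sin^4 cos^2 and of sin^2 cos^4 both equal pi/16, and (2 l + 1) + (2 n -
  1) = 2 (l + n): this is the origin of the factor l + n in the third coefficient.\<close>

lemma product_primitive_pi: "product_primitive l m n pi = - (pi / 8 * m * (l + n))"
  by (simp add: product_primitive_def field_simps)

lemma radial_primitive_bound: "\<bar>radial_primitive l m n t\<bar> \<le> 4 * coeff_bound l m n"
proof -
  have c3: "\<bar>cos t ^ 3\<bar> \<le> 1" and s3: "\<bar>sin t ^ 3\<bar> \<le> 1"
    by (intro abs_le_1_power abs_sin_le_one abs_cos_le_one)+
  have "\<bar>2/3 - cos t + cos t ^ 3 / 3\<bar> \<le> 2" using c3 abs_cos_le_one[of t] by arith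
  moreover have "\<bar>sin t ^ 3 / 3\<bar> \<le> 1" using s3 by arith
  moreover have "\<bar>(1 - cos t ^ 3) / 3\<bar> \<le> 1" using c3 by (simp add: abs_le_iff)
  ultimately have "\<bar>(2 * l) * ((2/3 - cos t + cos t ^ 3 / 3) / 2)\<bar> \<le> \<bar>2 * l\<bar>"
    "\<bar>m * (sin t ^ 3 / 3)\<bar> \<le> \<bar>m\<bar>" "\<bar>(n - 1) * ((1 - cos t ^ 3) / 3)\<bar> \<le> \<bar>n - 1\<bar>"
    by (intro abs_mult_le_left; simp)+
  moreover have "radial_primitive l m n t = (2 * l) * ((2/3 - cos t + cos t ^ 3 / 3) / 2)
      - m * (sin t ^ 3 / 3) + (n - 1) * ((1 - cos t ^ 3) / 3)"
    by (simp add: radial_primitive_def)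
  moreover have "\<bar>A - B + C\<bar> \<le> 4 * coeff_bound l m n"
    if "\<bar>A\<bar> \<le> \<bar>2 * l\<bar>" "\<bar>B\<bar> \<le> \<bar>m\<bar>" "\<bar>C\<bar> \<le> \<bar>n - 1\<bar>" for A B C
    using that unfolding coeff_bound_def by (smt (verit))
  ultimately show ?thesis by simp
qed


section \<open>Third-order expansion of the half map\<close>

lemma vector_derivative_bound:
  fixes f :: "real \<Rightarrow> 'a::real_normed_vector"
  assumes f: "\<And>t. t \<in> {a..b} \<Longrightarrow> (f has_vector_derivative f' t) (at t within {a..b})"
    and K: "\<And>t. t \<in> {a..b} \<Longrightarrow> norm (f' t) \<le> K" and t: "t \<in> {a..b}"
  shows "norm (f t - f a) \<le> K * (t - a)"
proof -
  have "norm (f t - f a) \<le> K * norm (t - a)"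
  proof (rule differentiable_bound[of "{a..b}" f "\<lambda>t h. h *\<^sub>R f' t"])
    show "onorm (\<lambda>h. h *\<^sub>R f' t) \<le> K" if "t \<in> {a..b}" for t
      using K[OF that] by (intro onorm_le) (metis abs_ge_zero mult.commute mult_right_mono norm_scaleR real_norm_def)
  qed (use f t in \<open>auto simp: has_vector_derivative_def\<close>)
  then show ?thesis using t by simp
qed

context
  fixes d l m n e :: real and z :: complex
  assumes e0: "0 \<le> e" and e: "e * coeff_bound l m n \<le> 1/300" and d: "\<bar>d\<bar> \<le> e^2" and z: "norm z \<le> e"
begin

lemma small_terms:
  "norm (complex_of_real (d * sin t ^ 2)) \<le> (e * coeff_bound l m n)^2"
  "norm (z * of_real (radial_coeff l m n t)) \<le> e * coeff_bound l m n"
  "norm (complex_of_real (d * sin t * cos t)) \<le> (e * coeff_bound l m n)^2"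
  "norm (z * of_real (angular_coeff l m n t)) \<le> e * coeff_bound l m n"
proof -
  have e2: "e^2 \<le> (e * coeff_bound l m n)^2"
    using coeff_bound_ge_1[of l m n] e0 by (intro power_mono) (simp_all add: mult_le_cancel_left1)
  have "\<bar>d * sin t ^ 2\<bar> \<le> \<bar>d\<bar>" "\<bar>d * (sin t * cos t)\<bar> \<le> \<bar>d\<bar>"
    by (intro abs_mult_le_left abs_le_1_mult abs_le_1_power abs_sin_le_one abs_cos_le_one)+
  then show "norm (complex_of_real (d * sin t ^ 2)) \<le> (e * coeff_bound l m n)^2"
    "norm (complex_of_real (d * sin t * cos t)) \<le> (e * coeff_bound l m n)^2"
    using e2 d by (simp_all only: norm_of_real mult.assoc)
  show "norm (z * of_real (radial_coeff l m n t)) \<le> e * coeff_bound l m n"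
    "norm (z * of_real (angular_coeff l m n t)) \<le> e * coeff_bound l m n"
    unfolding norm_mult norm_of_real
    using radial_coeff_bound[of l m n t] angular_coeff_bound[of l m n t] z e0
    by (auto intro!: mult_mono)
qed

text \<open>A bootstrap: each estimate of the solution, inserted into the right-hand side and
  integrated over [0, pi], gains one order. This gives u - 1 of order E, then u - 1 - h of order
  E^2, then the error of the full approximation of order E^3; 11000 is 3300 * 3.15 rounded
  up.\<close>

lemma polar_expansion:
  assumes f0: "f 0 = 1" and fb: "\<And>t. t \<in> {0..pi} \<Longrightarrow> f t \<in> cball 1 (1/2)"
    and f: "\<And>t. t \<in> {0..pi} \<Longrightarrow> (f has_vector_derivative polar_rhs d l m n t z (f t)) (at t within {0..pi})"
  shows "norm (f pi - (1 + of_real (d * pi / 2) + of_real ((4 * l + 2 * (n - 1)) / 3) * z +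
    of_real (((4 * l + 2 * (n - 1)) / 3)^2 + pi / 8 * m * (l + n)) * z^2)) \<le> 11000 * (e * coeff_bound l m n)^3"
proof -
  define E where "E = e * coeff_bound l m n"
  have E0: "E \<ge> 0" using e0 coeff_bound_ge_1[of l m n] by (simp add: E_def)
  note E = e[folded E_def] and small = small_terms[folded E_def]
  have pi: "0 \<le> pi" "pi \<le> 3.15" using pi_approx pi_ge_zero by (auto simp: numeral_eq_Suc)
  have u: "norm (f t - 1) \<le> 26 * E" if t: "t \<in> {0..pi}" for t
  proof -
    have "norm (f t - f 0) \<le> 8 * E * (t - 0)"
    proof (rule vector_derivative_bound[OF f _ t])
      fix t assume "t \<in> {0..pi}"
      then show "norm (polar_rhs d l m n t z (f t)) \<le> 8 * E"
        unfolding polar_rhs_def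
        using fb by (intro frac_bound small E) (auto simp: dist_norm norm_minus_commute)
    qed
    also have "\<dots> \<le> 8 * E * 3.15" using t pi E0 by (intro mult_left_mono) auto
    finally show ?thesis using E0 by (simp add: f0)
  qed
  define h where "h t = z * of_real (radial_primitive l m n t)" for t
  have dh: "(h has_vector_derivative z * of_real (radial_coeff l m n t)) (at t within {0..pi})" for t
    unfolding h_def
    by (intro has_vector_derivative_mult_right has_vector_derivative_of_real)
      (use has_derivative_radial_primitive[of l m n t] in
        \<open>auto simp: has_real_derivative_iff_has_vector_derivative intro: has_vector_derivative_at_within\<close>)
  have h: "norm (h t) \<le> 4 * E" for t
    unfolding h_def norm_mult norm_of_real E_def
    using mult_mono[OF z radial_primitive_bound[of l m n t]] e0 by (simp add: mult.left_commute)
  have uh: "norm (f t - 1 - h t) \<le> 440 * E^2" if t: "t \<in> {0..pi}" for t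
  proof -
    have "norm ((f t - h t) - (f 0 - h 0)) \<le> 138 * E^2 * (t - 0)"
    proof (rule vector_derivative_bound[OF has_vector_derivative_diff[OF f dh] _ t])
      fix t assume t: "t \<in> {0..pi}"
      then show "norm (polar_rhs d l m n t z (f t) - z * of_real (radial_coeff l m n t)) \<le> 138 * E^2"
        unfolding polar_rhs_def by (intro frac_first_order small E u)
    qed
    also have "\<dots> \<le> 138 * E^2 * 3.15" using t pi by (intro mult_left_mono) auto
    also have "\<dots> \<le> 440 * E^2" by simp
    also have "(f t - h t) - (f 0 - h 0) = f t - 1 - h t"
      by (simp add: f0 h_def radial_primitive_0)
    finally show ?thesis .
  qed
  \<comment> \<open>The antiderivative of the second-order right-hand side \<open>M'\<close>. The
    term 2 q h integrates to h^2 because q is the derivative of h. The constant 1 is left out since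
    only increments from t = 0 are compared.\<close>
  define M where "M t = of_real (d * (t - sin t * cos t) / 2) + h t + h t ^ 2
      - z^2 * of_real (product_primitive l m n t)" for t
  define M' where "M' t = of_real (d * sin t ^ 2) + z * of_real (radial_coeff l m n t)
      + 2 * (z * of_real (radial_coeff l m n t)) * h t
      - (z * of_real (radial_coeff l m n t)) * (z * of_real (angular_coeff l m n t))" for t
  have dM: "(M has_vector_derivative M' t) (at t within {0..pi})" for t
  proof -
    have "((\<lambda>t. d * (t - sin t * cos t) / 2) has_real_derivative d * (1 - (cos t * cos t - sin t * sin t)) / 2)
        (at t within {0..pi})"
      by (rule derivative_eq_intros refl | simp)+
    moreover have "d * (1 - (cos t * cos t - sin t * sin t)) / 2 = d * sin t ^ 2"
      by (simp add: power2_eq_square[symmetric] cos_squared_eq)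
    ultimately have 1: "((\<lambda>t. complex_of_real (d * (t - sin t * cos t) / 2)) has_vector_derivative
        of_real (d * sin t ^ 2)) (at t within {0..pi})"
      by (intro has_vector_derivative_of_real) (simp add: has_real_derivative_iff_has_vector_derivative)
    have 2: "((\<lambda>t. z^2 * of_real (product_primitive l m n t)) has_vector_derivative
        z^2 * of_real (radial_coeff l m n t * angular_coeff l m n t)) (at t within {0..pi})"
      by (intro has_vector_derivative_mult_right has_vector_derivative_of_real)
        (use has_derivative_product_primitive[of l m n t] in
          \<open>auto simp: has_real_derivative_iff_has_vector_derivative intro: has_vector_derivative_at_within\<close>)
    have 3: "((\<lambda>t. h t ^ 2) has_vector_derivative
        2 * (z * of_real (radial_coeff l m n t)) * h t) (at t within {0..pi})"
      using has_vector_derivative_mult[OF dh[of t] dh[of t]] by (simp add: power2_eq_square algebra_simps)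
    have "(M has_vector_derivative of_real (d * sin t ^ 2) + z * of_real (radial_coeff l m n t)
      + 2 * (z * of_real (radial_coeff l m n t)) * h t
      - z^2 * of_real (radial_coeff l m n t * angular_coeff l m n t)) (at t within {0..pi})"
      unfolding M_def
      by (intro has_vector_derivative_diff has_vector_derivative_add 1 2 3 dh)
    then show ?thesis by (simp add: M'_def power2_eq_square mult_ac)
  qed
  have "norm ((f pi - M pi) - (f 0 - M 0)) \<le> 3300 * E^3 * (pi - 0)"
  proof (rule vector_derivative_bound[OF has_vector_derivative_diff[OF f dM]])
    fix t assume t: "t \<in> {0..pi}"
    then show "norm (polar_rhs d l m n t z (f t) - M' t) \<le> 3300 * E^3"
      unfolding polar_rhs_def M'_def by (intro frac_second_order small E u h uh)
  qed auto
  also have "\<dots> \<le> 3300 * E^3 * 3.15" using pi E0 by (intro mult_left_mono) auto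
  also have "\<dots> \<le> 11000 * E^3" using E0 by simp
  also have "(f pi - M pi) - (f 0 - M 0) = f pi - (1 + of_real (d * pi / 2) + of_real ((4 * l + 2 * (n - 1)) / 3) * z +
    of_real (((4 * l + 2 * (n - 1)) / 3)^2 + pi / 8 * m * (l + n)) * z^2)"
    unfolding M_def h_def f0 radial_primitive_0 product_primitive_0 radial_primitive_pi product_primitive_pi
    by (simp add: algebra_simps power2_eq_square)
  finally show ?thesis unfolding E_def .
qed

end

text \<open>The contraction requirement is the strictest one on E: 3.15 * 36 / 300 < 1/2.\<close>

theorem polar_solution:
  assumes e: "0 < e" "e * coeff_bound l m n \<le> 1/300" "\<bar>d\<bar> \<le> e^2"
  shows "\<exists>f. (\<forall>z\<in>ball 0 e. f z 0 = 1 \<and> (\<forall>t\<in>{0..pi}. f z t \<in> cball 1 (1/2) \<and>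
        (f z has_vector_derivative polar_rhs d l m n t z (f z t)) (at t within {0..pi}))) \<and>
      (\<forall>t\<in>{0..pi}. (\<lambda>z. f z t) holomorphic_on ball 0 e) \<and>
      (\<forall>z\<in>ball 0 e \<inter> \<real>. \<forall>t\<in>{0..pi}. f z t \<in> \<real>)"
proof (rule picard_holomorphic)
  define E where "E = e * coeff_bound l m n"
  have E0: "E \<ge> 0" using e coeff_bound_ge_1[of l m n] by (simp add: E_def)
  have pi: "0 \<le> pi" "pi \<le> 3.15" using pi_approx by auto
  fix t and z u :: complex
  assume t: "t \<in> {0..pi}" and z: "z \<in> ball 0 e" and u: "u \<in> cball 1 (1/2)"
  have small: "norm (complex_of_real (d * sin t ^ 2)) \<le> E^2"
    "norm (z * of_real (radial_coeff l m n t)) \<le> E"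
    "norm (complex_of_real (d * sin t * cos t)) \<le> E^2"
    "norm (z * of_real (angular_coeff l m n t)) \<le> E"
    unfolding E_def using small_terms[of e l m n d z t] e z by simp_all
  have u1: "norm (u - 1) \<le> 1/2" using u by (simp add: dist_norm norm_minus_commute)
  have "pi * norm (polar_rhs d l m n t z u) \<le> 3.15 * (8 * E)"
    unfolding polar_rhs_def
    by (intro mult_mono pi frac_bound small u1) (use e E0 in \<open>auto simp: E_def\<close>)
  then show "pi * norm (polar_rhs d l m n t z u) \<le> 1/2"
    using e E0 by (simp add: E_def)
  fix v :: complex assume v: "v \<in> cball 1 (1/2)"
  have v1: "norm (v - 1) \<le> 1/2" using v by (simp add: dist_norm norm_minus_commute)
  have "pi * norm (polar_rhs d l m n t z u - polar_rhs d l m n t z v) \<le> 3.15 * (36 * E * norm (u - v))"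
    unfolding polar_rhs_def
    by (intro mult_mono pi frac_lipschitz small u1 v1) (use e E0 in \<open>auto simp: E_def\<close>)
  also have "\<dots> = (3.15 * (36 * E)) * norm (u - v)" by simp
  also have "\<dots> \<le> 1/2 * norm (u - v)"
    using e E0 by (intro mult_right_mono) (auto simp: E_def)
  finally show "pi * norm (polar_rhs d l m n t z u - polar_rhs d l m n t z v) \<le> 1/2 * norm (u - v)" .
next
  fix f assume f: "param_smooth (ball 0 e) pi f"
    and fb: "\<And>z t. z \<in> ball 0 e \<Longrightarrow> t \<in> {0..pi} \<Longrightarrow> f z t \<in> cball 1 (1/2)"
  have den: "1 + of_real (d * sin t * cos t) + z * of_real (angular_coeff l m n t) * f z t \<noteq> 0"
    if zt: "z \<in> ball 0 e" "t \<in> {0..pi}" for z t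
  proof -
    have "norm (f z t - 1) \<le> 1/2" using fb[OF zt] by (simp add: dist_norm norm_minus_commute)
    moreover have "norm z \<le> e" "0 \<le> e" using zt e by auto
    ultimately have "1/2 \<le> norm (1 + of_real (d * sin t * cos t) + z * of_real (angular_coeff l m n t) * f z t)"
      using frac_den[OF small_terms[of e l m n d z t] e(2)] e by blast
    then show ?thesis by auto
  qed
  show "param_smooth (ball 0 e) pi (\<lambda>z t. polar_rhs d l m n t z (f z t))"
    unfolding polar_rhs_def power2_eq_square[of "f _ _"]
    by (intro param_smooth_divide param_smooth_add param_smooth_mult param_smooth_param f den)
      (auto intro!: param_smooth_time continuous_intros simp: radial_coeff_def angular_coeff_def)
qed (auto simp: polar_rhs_def)

subsection \<open>Uniqueness of orbits and mirror symmetry\<close>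

text \<open>Lipschitz on every ball, since quadratic fields are not globally Lipschitz. The notion
  is closed under sums and products and contains max and min, so it reaches the glued field, which
  need not be differentiable on the switching line.\<close>

definition bounded_lipschitz :: "('a::real_normed_vector \<Rightarrow> 'b::real_normed_vector) \<Rightarrow> bool" where
  "bounded_lipschitz F \<longleftrightarrow>
     (\<forall>M. \<exists>L. \<forall>p q. norm p \<le> M \<longrightarrow> norm q \<le> M \<longrightarrow> norm (F p - F q) \<le> L * norm (p - q))"

lemma bounded_lipschitz_const: "bounded_lipschitz (\<lambda>_. c)"
  unfolding bounded_lipschitz_def by (auto intro!: exI[of _ 0])

lemma bounded_lipschitz_nonexpansive:
  assumes "\<And>p q. norm (F p - F q) \<le> norm (p - q)"
  shows "bounded_lipschitz F"
  unfolding bounded_lipschitz_def using assms by (auto intro!: exI[of _ 1])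

lemma bounded_lipschitz_add:
  assumes "bounded_lipschitz F" "bounded_lipschitz G"
  shows "bounded_lipschitz (\<lambda>p. F p + G p)"
  unfolding bounded_lipschitz_def
proof
  fix M
  obtain K L where KL: "\<And>p q. norm p \<le> M \<Longrightarrow> norm q \<le> M \<Longrightarrow> norm (F p - F q) \<le> K * norm (p - q)"
    "\<And>p q. norm p \<le> M \<Longrightarrow> norm q \<le> M \<Longrightarrow> norm (G p - G q) \<le> L * norm (p - q)"
    using assms unfolding bounded_lipschitz_def by metis
  show "\<exists>L. \<forall>p q. norm p \<le> M \<longrightarrow> norm q \<le> M \<longrightarrow> norm (F p + G p - (F q + G q)) \<le> L * norm (p - q)"
    by (intro exI[of _ "K + L"] allI impI, subst add_diff_add, subst distrib_right)
      (intro norm_triangle_mono KL)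
qed

lemma bounded_lipschitz_mult:
  fixes F G :: "'a::real_normed_vector \<Rightarrow> real"
  assumes "bounded_lipschitz F" "bounded_lipschitz G"
  shows "bounded_lipschitz (\<lambda>p. F p * G p)"
  unfolding bounded_lipschitz_def
proof
  fix M :: real
  obtain K L where KL: "\<And>p q. norm p \<le> M \<Longrightarrow> norm q \<le> M \<Longrightarrow> norm (F p - F q) \<le> K * norm (p - q)"
    "\<And>p q. norm p \<le> M \<Longrightarrow> norm q \<le> M \<Longrightarrow> norm (G p - G q) \<le> L * norm (p - q)"
    using assms unfolding bounded_lipschitz_def by metis
  define BF where "BF = \<bar>F 0\<bar> + \<bar>K\<bar> * M"
  define BG where "BG = \<bar>G 0\<bar> + \<bar>L\<bar> * M"
  have bd: "\<bar>F p\<bar> \<le> BF \<and> \<bar>G p\<bar> \<le> BG" if p: "norm p \<le> M" for p :: 'a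
  proof -
    have M: "norm (0::'a) \<le> M" using order.trans[OF norm_ge_zero p] by simp
    have "\<bar>F p - F 0\<bar> \<le> K * norm p" "\<bar>G p - G 0\<bar> \<le> L * norm p" using KL[OF p M] by simp_all
    moreover have "K * norm p \<le> \<bar>K\<bar> * M" "L * norm p \<le> \<bar>L\<bar> * M"
      using p by (auto intro!: mult_mono)
    ultimately show ?thesis unfolding BF_def BG_def by linarith
  qed
  show "\<exists>L. \<forall>p q. norm p \<le> M \<longrightarrow> norm q \<le> M \<longrightarrow> norm (F p * G p - F q * G q) \<le> L * norm (p - q)"
  proof (intro exI[of _ "BF * L + BG * K"] allI impI)
    fix p q :: 'a assume p: "norm p \<le> M" and q: "norm q \<le> M"
    have "F p * G p - F q * G q = F p * (G p - G q) + G q * (F p - F q)" by (simp add: algebra_simps)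
    also have "norm \<dots> \<le> \<bar>F p\<bar> * \<bar>G p - G q\<bar> + \<bar>G q\<bar> * \<bar>F p - F q\<bar>"
      using norm_triangle_ineq[of "F p * (G p - G q)" "G q * (F p - F q)"] by (simp add: abs_mult)
    also have "\<dots> \<le> BF * (L * norm (p - q)) + BG * (K * norm (p - q))"
      using bd[OF p] bd[OF q] KL[OF p q] abs_ge_zero[of "F p"] abs_ge_zero[of "G q"]
      by (intro add_mono mult_mono) (auto simp del: abs_ge_zero)
    finally show "norm (F p * G p - F q * G q) \<le> (BF * L + BG * K) * norm (p - q)"
      by (simp add: algebra_simps)
  qed
qed

lemma bounded_lipschitz_Pair:
  assumes "bounded_lipschitz F" "bounded_lipschitz G"
  shows "bounded_lipschitz (\<lambda>p. (F p, G p))"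
  unfolding bounded_lipschitz_def
proof
  fix M
  obtain K L where KL: "\<And>p q. norm p \<le> M \<Longrightarrow> norm q \<le> M \<Longrightarrow> norm (F p - F q) \<le> K * norm (p - q)"
    "\<And>p q. norm p \<le> M \<Longrightarrow> norm q \<le> M \<Longrightarrow> norm (G p - G q) \<le> L * norm (p - q)"
    using assms unfolding bounded_lipschitz_def by metis
  show "\<exists>L. \<forall>p q. norm p \<le> M \<longrightarrow> norm q \<le> M \<longrightarrow> norm ((F p, G p) - (F q, G q)) \<le> L * norm (p - q)"
    using KL
    by (intro exI[of _ "K + L"] allI impI)
      (auto simp: norm_Pair distrib_right intro!: order.trans[OF sqrt_sum_squares_le_sum] add_mono)
qed

lemma bounded_lipschitz_uminus:
  "bounded_lipschitz F \<Longrightarrow> bounded_lipschitz (\<lambda>p. - F p)"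
  unfolding bounded_lipschitz_def by (metis minus_diff_commute norm_minus_cancel minus_diff_minus)

lemma solution_on_at:
  assumes "solution_on F \<gamma> {a..b}" "a < t" "t < b"
  shows "(\<gamma> has_vector_derivative F (\<gamma> t)) (at t)"
  using assms at_within_Icc_at[of a t b] unfolding solution_on_def
  by (metis atLeastAtMost_iff less_imp_le)

lemma solution_on_continuous: "solution_on F \<gamma> I \<Longrightarrow> continuous_on I \<gamma>"
  unfolding solution_on_def continuous_on_eq_continuous_within
  by (blast intro: has_vector_derivative_continuous)

lemma solution_on_subset: "solution_on F \<gamma> I \<Longrightarrow> J \<subseteq> I \<Longrightarrow> solution_on F \<gamma> J"
  unfolding solution_on_def by (blast intro: has_vector_derivative_within_subset)

text \<open>Gronwall argument: with L a Lipschitz constant on a ball containing both orbits, the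
  squared distance times exp(- 2 L t) is nonincreasing and starts at 0. Only the forward direction
  is covered; backward uniqueness is obtained later by reversing time.\<close>

theorem solution_unique:
  fixes F :: vfield
  assumes F: "bounded_lipschitz F" and s1: "solution_on F \<gamma> {a..b}" and s2: "solution_on F \<delta> {a..b}"
    and eq: "\<gamma> a = \<delta> a" and t: "t \<in> {a..b}"
  shows "\<gamma> t = \<delta> t"
proof -
  note c = solution_on_continuous[OF s1] solution_on_continuous[OF s2]
  have "bounded (\<gamma> ` {a..b} \<union> \<delta> ` {a..b})"
    using c by (simp add: compact_continuous_image compact_imp_bounded)
  then obtain M where M: "\<And>t. t \<in> {a..b} \<Longrightarrow> norm (\<gamma> t) \<le> M \<and> norm (\<delta> t) \<le> M"
    unfolding bounded_iff by blast
  obtain L where L: "\<And>p q. norm p \<le> M \<Longrightarrow> norm q \<le> M \<Longrightarrow> norm (F p - F q) \<le> L * norm (p - q)"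
    using F unfolding bounded_lipschitz_def by blast
  define g where "g t = ((\<gamma> t - \<delta> t) \<bullet> (\<gamma> t - \<delta> t)) * exp (- 2 * L * t)" for t
  have "g t \<le> g a"
  proof (rule DERIV_nonpos_imp_decreasing_open[of a t g])
    show "a \<le> t" using t by simp
    show "continuous_on {a..t} g"
      unfolding g_def using continuous_on_subset[OF c(1)] continuous_on_subset[OF c(2)] t
      by (auto intro!: continuous_intros)
    fix x assume x: "a < x" "x < t"
    let ?D = "\<gamma> x - \<delta> x" and ?D' = "F (\<gamma> x) - F (\<delta> x)"
    have dv: "((\<lambda>t. \<gamma> t - \<delta> t) has_vector_derivative ?D') (at x)"
      using x t by (intro has_vector_derivative_diff solution_on_at[OF s1] solution_on_at[OF s2]) auto
    have "((\<lambda>t. (\<gamma> t - \<delta> t) \<bullet> (\<gamma> t - \<delta> t)) has_vector_derivative ?D \<bullet> ?D' + ?D' \<bullet> ?D) (at x)"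
      by (rule bounded_bilinear.has_vector_derivative[OF bounded_bilinear_inner dv dv])
    then have "((\<lambda>t. (\<gamma> t - \<delta> t) \<bullet> (\<gamma> t - \<delta> t)) has_real_derivative ?D \<bullet> ?D' + ?D' \<bullet> ?D) (at x)"
      by (simp add: has_real_derivative_iff_has_vector_derivative)
    then have "(g has_real_derivative (?D \<bullet> ?D' + ?D' \<bullet> ?D) * exp (- 2 * L * x)
        + (- 2 * L * exp (- 2 * L * x)) * (?D \<bullet> ?D)) (at x)"
      unfolding g_def by (rule DERIV_mult) (auto intro!: derivative_eq_intros)
    moreover have "(?D \<bullet> ?D' + ?D' \<bullet> ?D) * exp (- 2 * L * x) + (- 2 * L * exp (- 2 * L * x)) * (?D \<bullet> ?D) =
        2 * exp (- 2 * L * x) * (?D \<bullet> ?D' - L * (?D \<bullet> ?D))"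
      by (simp add: inner_commute algebra_simps)
    moreover have "?D \<bullet> ?D' - L * (?D \<bullet> ?D) \<le> 0"
    proof -
      have "?D \<bullet> ?D' \<le> norm ?D * norm ?D'" by (rule norm_cauchy_schwarz)
      also have "\<dots> \<le> norm ?D * (L * norm ?D)"
        using x t M by (intro mult_left_mono L) auto
      finally show ?thesis by (simp add: dot_square_norm power2_eq_square algebra_simps)
    qed
    ultimately show "\<exists>y. (g has_real_derivative y) (at x) \<and> y \<le> 0"
      by (metis exp_ge_zero mult_nonneg_nonpos mult_nonneg_nonneg zero_le_numeral)
  qed
  then have "(\<gamma> t - \<delta> t) \<bullet> (\<gamma> t - \<delta> t) \<le> 0"
    by (simp add: g_def eq mult_le_0_iff)
  then show ?thesis by (metis inner_gt_zero_iff not_less right_minus_eq)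
qed

text \<open>By uniqueness the two orbits agree as long as both exist. If one arrived earlier, the
  other would lie on the axis at a time at which it has to be in x > 0. This makes the definite
  description in \<open>Pi1\<close> meaningful.\<close>

lemma right_return_unique:
  assumes F: "bounded_lipschitz F" and "right_return F r s" "right_return F r s'"
  shows "s = s'"
proof -
  obtain T \<gamma> where T: "T > 0" "solution_on F \<gamma> {0..T}" "\<gamma> 0 = (0, - r)" "\<gamma> T = (0, s)"
    "\<And>t. t \<in> {0<..<T} \<Longrightarrow> fst (\<gamma> t) > 0" using assms(2) unfolding right_return_def by blast
  obtain T' \<delta> where T': "T' > 0" "solution_on F \<delta> {0..T'}" "\<delta> 0 = (0, - r)" "\<delta> T' = (0, s')"
    "\<And>t. t \<in> {0<..<T'} \<Longrightarrow> fst (\<delta> t) > 0" using assms(3) unfolding right_return_def by blast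
  have eq: "\<gamma> t = \<delta> t" if "0 \<le> t" "t \<le> T" "t \<le> T'" for t
    by (rule solution_unique[OF F, of _ 0 "min T T'"])
      (use that T T' in \<open>auto intro: solution_on_subset\<close>)
  have "T = T'"
  proof (cases T T' rule: linorder_cases)
    case less
    then show ?thesis using T'(5)[of T] eq[of T] T(1,4) by (metis fst_conv greaterThanLessThan_iff less_eq_real_def less_irrefl)
  next
    case greater
    then show ?thesis using T(5)[of T'] eq[of T'] T'(1,4) by (metis fst_conv greaterThanLessThan_iff less_eq_real_def less_irrefl)
  qed
  then show ?thesis using eq[of T] T T' by auto
qed

section \<open>Reflection of the left half system\<close>

definition mirror_field :: "vfield \<Rightarrow> vfield" where
  "mirror_field F = (\<lambda>(x, y). (fst (F (- x, y)), - snd (F (- x, y))))"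

definition mirror_pt :: "real \<times> real \<Rightarrow> real \<times> real" where
  "mirror_pt = (\<lambda>(x, y). (- x, y))"

lemma mirror_field_mirror_field: "mirror_field (mirror_field F) = F"
  by (auto simp: mirror_field_def)

lemma solution_on_mirror:
  assumes "solution_on F \<gamma> {0..T}"
  shows "solution_on (mirror_field F) (\<lambda>t. mirror_pt (\<gamma> (T - t))) {0..T}"
  unfolding solution_on_def
proof
  fix t assume t: "t \<in> {0..T}"
  have im: "(\<lambda>t. T - t) ` {0..T} = {0..T}" by (auto simp: image_iff intro!: bexI[of _ "T - _"])
  have "(\<gamma> has_vector_derivative F (\<gamma> (T - t))) (at (T - t) within (\<lambda>t. T - t) ` {0..T})"
    using assms t unfolding solution_on_def im by auto
  moreover have "((\<lambda>t. T - t) has_vector_derivative - 1) (at t within {0..T})"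
    by (auto intro!: derivative_eq_intros)
  ultimately have "((\<lambda>t. \<gamma> (T - t)) has_vector_derivative - F (\<gamma> (T - t))) (at t within {0..T})"
    using vector_diff_chain_within by (fastforce simp: o_def)
  moreover have "bounded_linear mirror_pt"
    unfolding mirror_pt_def case_prod_unfold
    by (intro bounded_linear_Pair bounded_linear_minus bounded_linear_fst bounded_linear_snd)
  ultimately have "((\<lambda>t. mirror_pt (\<gamma> (T - t))) has_vector_derivative mirror_pt (- F (\<gamma> (T - t)))) (at t within {0..T})"
    by (rule bounded_linear.has_vector_derivative[rotated])
  then show "((\<lambda>t. mirror_pt (\<gamma> (T - t))) has_vector_derivative mirror_field F (mirror_pt (\<gamma> (T - t))))
      (at t within {0..T})"
    by (simp add: mirror_pt_def mirror_field_def case_prod_unfold)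
qed

text \<open>Reversing time exchanges the endpoints, so the relation with its arguments swapped,
  which is the graph of the inverse map, is a forward half return of the reflected field. No map has
  to be inverted to treat \<open>Pi2_inv\<close>.\<close>

lemma left_return_iff_mirror: "left_return F u r \<longleftrightarrow> right_return (mirror_field F) r u"
proof
  assume "left_return F u r"
  then obtain T \<gamma> where T: "u > 0" "r > 0" "T > 0" "solution_on F \<gamma> {0..T}" "\<gamma> 0 = (0, u)" "\<gamma> T = (0, - r)"
    "\<And>t. t \<in> {0<..<T} \<Longrightarrow> fst (\<gamma> t) < 0" unfolding left_return_def by blast
  then show "right_return (mirror_field F) r u"
    unfolding right_return_def
    by (intro conjI exI[of _ T] exI[of _ "\<lambda>t. mirror_pt (\<gamma> (T - t))"])
      (auto simp: mirror_pt_def case_prod_unfold intro!: solution_on_mirror[unfolded mirror_pt_def case_prod_unfold])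
next
  assume "right_return (mirror_field F) r u"
  then obtain T \<gamma> where T: "u > 0" "r > 0" "T > 0" "solution_on (mirror_field F) \<gamma> {0..T}" "\<gamma> 0 = (0, - r)" "\<gamma> T = (0, u)"
    "\<And>t. t \<in> {0<..<T} \<Longrightarrow> fst (\<gamma> t) > 0" unfolding right_return_def by blast
  show "left_return F u r"
    unfolding left_return_def
    by (intro conjI exI[of _ T] exI[of _ "\<lambda>t. mirror_pt (\<gamma> (T - t))"])
      (use T solution_on_mirror[OF T(4)] in \<open>auto simp: mirror_pt_def case_prod_unfold mirror_field_mirror_field\<close>)
qed

lemma displacement_mirror: "displacement F r = Pi1 (mirror_field F) r - Pi1 F r"
  by (simp add: displacement_def Pi2_inv_def Pi1_def left_return_iff_mirror)

lemma displacement_defined_mirror: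
  "displacement_defined F r \<longleftrightarrow> (\<exists>s. right_return F r s) \<and> (\<exists>u. right_return (mirror_field F) r u)"
  by (simp add: displacement_defined_def left_return_iff_mirror)

lemma Pi1_eq: "bounded_lipschitz F \<Longrightarrow> right_return F r s \<Longrightarrow> Pi1 F r = s"
  unfolding Pi1_def using right_return_unique by blast

text \<open>Because the two fields share all terms without a factor x in the first component and the
  whole second component, positive and negative parts of x express the glued field without case
  distinction, as a sum of products of nonexpansive functions. Its Lipschitz property can then be
  read off.\<close>

lemma pw_field_max_min:
  "pw_field (d1, d2, l1, l2, m1, m2, n) = (\<lambda>p.
     (- snd p + d1 * max (fst p) 0 + d2 * min (fst p) 0 + l1 * (max (fst p) 0 * max (fst p) 0)
        + l2 * (min (fst p) 0 * min (fst p) 0) + m1 * (max (fst p) 0 * snd p)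
        + m2 * (min (fst p) 0 * snd p) + n * (snd p * snd p), fst p * (1 + - snd p)))"
  by (rule ext) (auto simp: pw_field_def glue_def X_right_def X_left_def quad_def max_def min_def
      power2_eq_square)

lemma pw_field_lipschitz: "bounded_lipschitz (pw_field p)"
proof -
  have le: "\<bar>fst p - fst q\<bar> \<le> norm (p - q)" "\<bar>snd p - snd q\<bar> \<le> norm (p - q)" for p q :: "real \<times> real"
    using norm_fst_le[of "p - q"] norm_snd_le[of "p - q"] by (simp_all add: norm_prod_def)
  have "\<bar>max (fst p) 0 - max (fst q) 0\<bar> \<le> norm (p - q)" "\<bar>min (fst p) 0 - min (fst q) 0\<bar> \<le> norm (p - q)"
    for p q :: "real \<times> real"
    using le[of p q] by linarith+
  with le have "bounded_lipschitz (\<lambda>p::real \<times> real. max (fst p) 0)"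
    "bounded_lipschitz (\<lambda>p::real \<times> real. min (fst p) 0)"
    "bounded_lipschitz (\<lambda>p::real \<times> real. fst p)" "bounded_lipschitz (\<lambda>p::real \<times> real. snd p)"
    by (auto intro!: bounded_lipschitz_nonexpansive)
  then show ?thesis
    by (cases p) (simp only: pw_field_max_min, intro bounded_lipschitz_Pair bounded_lipschitz_add
        bounded_lipschitz_mult bounded_lipschitz_uminus bounded_lipschitz_const)
qed

lemma mirror_pw_field:
  "mirror_field (pw_field (d1, d2, l1, l2, m1, m2, n)) = pw_field (- d2, - d1, l2, l1, - m2, - m1, n)"
  by (rule ext) (auto simp: mirror_field_def pw_field_def glue_def X_right_def X_left_def quad_def)

subsection \<open>Half orbits\<close>

text \<open>The time needed to reach the angle theta is the integral of 1 / \<open>\<Theta>\<close>;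
  its inverse function solves the autonomous equation for the angle.\<close>

lemma time_change:
  fixes \<Theta> :: "real \<Rightarrow> real"
  assumes b: "b > 0" and cont: "continuous_on {0..b} \<Theta>" and pos: "\<And>\<theta>. \<theta> \<in> {0..b} \<Longrightarrow> \<Theta> \<theta> > 0"
  shows "\<exists>T>0. \<exists>\<phi>. \<phi> 0 = 0 \<and> \<phi> T = b \<and> \<phi> ` {0..T} = {0..b} \<and>
    (\<forall>t\<in>{0..T}. (\<phi> has_real_derivative \<Theta> (\<phi> t)) (at t)) \<and> (\<forall>t\<in>{0<..<T}. 0 < \<phi> t \<and> \<phi> t < b)"
proof -
  \<comment> \<open>Extending the integrand by its boundary values provides an antiderivative on an
    open interval around [0, b], so that the inverse function theorem gives two-sided derivatives at
    the endpoints too.\<close>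
  define g where "g \<theta> = 1 / \<Theta> (max 0 (min b \<theta>))" for \<theta>
  have clamp: "max 0 (min b \<theta>) \<in> {0..b}" for \<theta> using b by auto
  have nz: "\<Theta> (max 0 (min b \<theta>)) \<noteq> 0" for \<theta> using pos[OF clamp] by (metis less_irrefl)
  have g: "continuous_on {-1..b + 1} g"
    unfolding g_def
    by (intro continuous_intros continuous_on_compose2[OF cont] ballI nz) (use b in auto)
  have gpos: "g \<theta> > 0" for \<theta> unfolding g_def using pos[OF clamp] by simp
  obtain \<tau>0 where \<tau>0: "\<And>x. x \<in> {-1..b + 1} \<Longrightarrow> (\<tau>0 has_vector_derivative g x) (at x within {-1..b + 1})"
    using antiderivative_continuous[OF g] by blast
  define \<tau> where "\<tau> x = \<tau>0 x - \<tau>0 0" for x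
  let ?S = "{-1<..<b + 1}"
  have \<tau>: "(\<tau> has_real_derivative g x) (at x)" if "x \<in> ?S" for x
  proof -
    have "(\<tau>0 has_vector_derivative g x) (at x within {-1..b + 1})" using \<tau>0[of x] that by simp
    then have "(\<tau>0 has_vector_derivative g x) (at x)"
      using at_within_Icc_at[of "-1" x "b + 1"] that by (metis greaterThanLessThan_iff)
    from has_vector_derivative_diff[OF this has_vector_derivative_const]
    show ?thesis
      unfolding \<tau>_def[abs_def] has_real_derivative_iff_has_vector_derivative by simp
  qed
  have mono: "\<tau> x < \<tau> y" if "x \<in> ?S" "y \<in> ?S" "x < y" for x y
  proof (rule DERIV_pos_imp_increasing[OF that(3)])
    fix z assume "x \<le> z" "z \<le> y"
    then have "z \<in> ?S" using that by auto
    then show "\<exists>D. (\<tau> has_real_derivative D) (at z) \<and> 0 < D" using \<tau> gpos by blast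
  qed
  have inj: "inj_on \<tau> ?S"
    using mono by (intro linorder_inj_onI') (metis less_irrefl)
  define \<phi> where "\<phi> = inv_into ?S \<tau>"
  have \<phi>: "\<phi> (\<tau> x) = x" if "x \<in> ?S" for x
    unfolding \<phi>_def using inv_into_f_f[OF inj that] .
  have S: "{0..b} \<subseteq> ?S" using b by auto
  have cont\<tau>: "continuous_on ?S \<tau>"
    using \<tau> DERIV_isCont continuous_at_imp_continuous_on by blast
  define T where "T = \<tau> b"
  have \<tau>0': "\<tau> 0 = 0" by (simp add: \<tau>_def)
  have T: "T > 0" using mono[of 0 b] b by (simp add: T_def \<tau>0')
  have sur: "\<exists>x. x \<in> {0..b} \<and> \<tau> x = t" if "t \<in> {0..T}" for t
    using IVT'[of \<tau> 0 t b] that b continuous_on_subset[OF cont\<tau> S] by (auto simp: \<tau>0' T_def)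
  have \<tau>range: "\<tau> x \<in> {0..T}" if "x \<in> {0..b}" for x
    using that mono[of 0 x] mono[of x b] b S \<tau>0' unfolding T_def
    by (cases "x = 0"; cases "x = b") auto
  have deriv: "(\<phi> has_real_derivative \<Theta> (\<phi> t)) (at t)" if t: "t \<in> {0..T}" for t
  proof -
    obtain x where x: "x \<in> {0..b}" "\<tau> x = t" using sur[OF t] by blast
    have "(\<phi> has_real_derivative inverse (g x)) (at (\<tau> x))"
      by (rule has_field_derivative_inverse_strong[OF \<tau> _ _ _ cont\<tau>])
        (use x S gpos[of x] \<phi> in \<open>auto simp del: greaterThanLessThan_iff simp: less_imp_neq[symmetric]\<close>)
    moreover have "inverse (g x) = \<Theta> x" using x by (simp add: g_def)
    moreover have "x \<in> ?S" using x S by blast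
    ultimately show ?thesis using x \<phi>[of x] by simp
  qed
  have "0 \<in> ?S" "b \<in> ?S" using b by auto
  then have "\<phi> 0 = 0" "\<phi> T = b" using \<phi>[of 0] \<phi>[of b] unfolding T_def \<tau>0' by blast+
  moreover have "\<phi> ` {0..T} = {0..b}"
  proof
    show "\<phi> ` {0..T} \<subseteq> {0..b}"
    proof
      fix y assume "y \<in> \<phi> ` {0..T}"
      then obtain t where t: "t \<in> {0..T}" "y = \<phi> t" by blast
      obtain x where x: "x \<in> {0..b}" "\<tau> x = t" using sur[OF t(1)] by blast
      then have "x \<in> ?S" using S by blast
      then show "y \<in> {0..b}" using \<phi> x t by metis
    qed
    show "{0..b} \<subseteq> \<phi> ` {0..T}"
    proof
      fix x assume x: "x \<in> {0..b}"
      then have "\<phi> (\<tau> x) = x" using \<phi> S by blast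
      with \<tau>range[OF x] show "x \<in> \<phi> ` {0..T}" by (metis imageI)
    qed
  qed
  moreover have "0 < \<phi> t \<and> \<phi> t < b" if t: "t \<in> {0<..<T}" for t
  proof -
    obtain x where x: "x \<in> {0..b}" "\<tau> x = t" using sur[of t] t by auto
    then have "x \<noteq> 0" "x \<noteq> b" using t by (auto simp: \<tau>0' T_def)
    moreover have "x \<in> ?S" using x S by blast
    ultimately show ?thesis using x \<phi>[of x] by auto
  qed
  ultimately show ?thesis using T deriv by blast
qed

text \<open>The same arc in two descriptions: as a solution in time, used for concatenation and
  uniqueness, and as a polar graph over [0, pi], used for norm bounds and for the topology of the
  closed curve.\<close>

definition half_orbit :: "vfield \<Rightarrow> real \<Rightarrow> real \<Rightarrow> (real \<Rightarrow> real) \<Rightarrow> real \<Rightarrow> (real \<Rightarrow> real \<times> real) \<Rightarrow> bool" where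
  "half_orbit F r s \<rho> T \<gamma> \<longleftrightarrow> T > 0 \<and> solution_on F \<gamma> {0..T} \<and> \<gamma> 0 = (0, - r) \<and> \<gamma> T = (0, s) \<and>
     (\<forall>t\<in>{0<..<T}. fst (\<gamma> t) > 0) \<and>
     continuous_on {0..pi} \<rho> \<and> \<rho> 0 = r \<and> \<rho> pi = s \<and> (\<forall>\<theta>\<in>{0..pi}. r / 2 \<le> \<rho> \<theta> \<and> \<rho> \<theta> \<le> 3 / 2 * r) \<and>
     \<gamma> ` {0..T} = (\<lambda>\<theta>. (\<rho> \<theta> * sin \<theta>, - \<rho> \<theta> * cos \<theta>)) ` {0..pi}"

lemma half_orbit_imp_right_return:
  assumes "half_orbit F r s \<rho> T \<gamma>" "r > 0"
  shows "right_return F r s"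
proof -
  have "\<rho> pi = s" and "\<forall>\<theta>\<in>{0..pi}. r / 2 \<le> \<rho> \<theta> \<and> \<rho> \<theta> \<le> 3 / 2 * r"
    using assms(1) unfolding half_orbit_def by blast+
  then have "r / 2 \<le> s" using pi_ge_zero by force
  then have "s > 0" using assms(2) by simp
  then show ?thesis using assms unfolding half_orbit_def right_return_def by blast
qed

lemma polar_rhs_of_real:
  "polar_rhs d l m n t (of_real r) (of_real v) = of_real
     ((d * sin t ^ 2 * v + r * radial_coeff l m n t * v ^ 2) /
      (1 + d * sin t * cos t + r * angular_coeff l m n t * v))"
  by (simp add: polar_rhs_def)

text \<open>The polar solution supplies the radius as a function of the angle, and
  \<open>time_change\<close> supplies the angle as a function of time. The field is prescribed only
  on the closed right half plane, so the statement applies directly to a glued field.\<close>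

lemma half_orbit_exists:
  assumes F: "\<And>p. fst p \<ge> 0 \<Longrightarrow> F p = quad d l m n p"
    and e: "0 < e" "e * coeff_bound l m n \<le> 1/300" "\<bar>d\<bar> \<le> e^2" and r: "0 < r" "r < e"
    and f0: "f 0 = 1" and freal: "\<And>t. t \<in> {0..pi} \<Longrightarrow> f t \<in> \<real>"
    and fb: "\<And>t. t \<in> {0..pi} \<Longrightarrow> f t \<in> cball 1 (1/2)"
    and f: "\<And>t. t \<in> {0..pi} \<Longrightarrow> (f has_vector_derivative polar_rhs d l m n t (of_real r) (f t)) (at t within {0..pi})"
  shows "\<exists>\<rho> T \<gamma>. half_orbit F r (r * Re (f pi)) \<rho> T \<gamma>"
proof -
  define u where "u t = Re (f t)" for t
  have fu: "f t = of_real (u t)" if "t \<in> {0..pi}" for t using freal[OF that] by (simp add: u_def)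
  define num where "num t = d * sin t ^ 2 * u t + r * radial_coeff l m n t * u t ^ 2" for t
  define \<Theta> where "\<Theta> t = 1 + d * sin t * cos t + r * angular_coeff l m n t * u t" for t
  have du: "(u has_real_derivative num t / \<Theta> t) (at t within {0..pi})" if t: "t \<in> {0..pi}" for t
  proof -
    have "((\<lambda>t. Re (f t)) has_vector_derivative Re (polar_rhs d l m n t (of_real r) (f t))) (at t within {0..pi})"
      by (rule bounded_linear.has_vector_derivative[OF bounded_linear_Re f[OF t]])
    then show ?thesis
      unfolding fu[OF t] polar_rhs_of_real
      by (simp add: u_def[abs_def] num_def \<Theta>_def has_real_derivative_iff_has_vector_derivative)
  qed
  have ub: "1/2 \<le> u t \<and> u t \<le> 3/2" if "t \<in> {0..pi}" for t
    using fb[OF that] abs_Re_le_cmod[of "1 - f t"] by (auto simp: u_def dist_norm)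
  have \<Theta>pos: "\<Theta> t > 0" if t: "t \<in> {0..pi}" for t
  proof -
    have e0: "0 \<le> e" and re: "norm (complex_of_real r) \<le> e" using e r by auto
    have 1: "\<bar>d * sin t * cos t\<bar> \<le> (e * coeff_bound l m n)^2"
      using small_terms(3)[OF e0 e(2,3) re, of t] by (simp only: norm_of_real)
    have 2: "\<bar>r * angular_coeff l m n t\<bar> \<le> 1/300"
      using small_terms(4)[OF e0 e(2,3) re, of t] e(2)
      by (simp only: norm_of_real of_real_mult[symmetric])
    have 3: "(e * coeff_bound l m n)^2 \<le> (1/300)^2"
      using e0 e(2) coeff_bound_ge_1[of l m n] by (intro power_mono) auto
    have 4: "\<bar>r * angular_coeff l m n t * u t\<bar> \<le> (1/300) * (3/2)"
      unfolding abs_mult[of _ "u t"] using 2 ub[OF t] by (intro mult_mono) auto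
    have "(1/300 :: real)^2 \<le> 1/300" by (simp add: power2_eq_square)
    then show ?thesis unfolding \<Theta>_def using 1 3 4 by linarith
  qed
  have ucont: "continuous_on {0..pi} u"
    by (rule DERIV_continuous_on[OF du])
  have \<Theta>cont: "continuous_on {0..pi} \<Theta>"
    unfolding \<Theta>_def angular_coeff_def by (intro continuous_intros ucont)
  obtain T \<phi> where T: "T > 0" and \<phi>: "\<phi> 0 = 0" "\<phi> T = pi" "\<phi> ` {0..T} = {0..pi}"
    "\<And>t. t \<in> {0..T} \<Longrightarrow> (\<phi> has_real_derivative \<Theta> (\<phi> t)) (at t)"
    "\<And>t. t \<in> {0<..<T} \<Longrightarrow> 0 < \<phi> t \<and> \<phi> t < pi"
    using time_change[OF pi_gt_zero \<Theta>cont \<Theta>pos] by blast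
  define \<rho> where "\<rho> t = r * u t" for t
  define \<gamma> where "\<gamma> t = (\<rho> (\<phi> t) * sin (\<phi> t), - \<rho> (\<phi> t) * cos (\<phi> t))" for t
  have "solution_on F \<gamma> {0..T}"
    unfolding solution_on_def
  proof
    fix t assume t: "t \<in> {0..T}"
    define \<theta> where "\<theta> = \<phi> t"
    have \<theta>: "\<theta> \<in> {0..pi}" using \<phi>(3) t by (auto simp: \<theta>_def)
    have "(u has_real_derivative num \<theta> / \<Theta> \<theta>) (at (\<phi> t) within \<phi> ` {0..T})"
      using du[OF \<theta>] \<phi>(3) by (simp add: \<theta>_def)
    moreover have d\<phi>: "(\<phi> has_real_derivative \<Theta> \<theta>) (at t within {0..T})"
      using \<phi>(4)[OF t] by (simp add: \<theta>_def has_field_derivative_at_within)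
    ultimately have "((\<lambda>t. u (\<phi> t)) has_real_derivative num \<theta> / \<Theta> \<theta> * \<Theta> \<theta>) (at t within {0..T})"
      using DERIV_image_chain[unfolded o_def] by blast
    \<comment> \<open>The angular speed produced by the time change cancels the denominator of the
      polar equation. The velocity is now polynomial in s and c, and comparing it with the quadratic
      field is algebra modulo s^2 + c^2 = 1.\<close>
    then have du\<phi>: "((\<lambda>t. u (\<phi> t)) has_real_derivative num \<theta>) (at t within {0..T})"
      using \<Theta>pos[OF \<theta>] by simp
    define U s c where "U = u \<theta>" and "s = sin \<theta>" and "c = cos \<theta>"
    have cs: "s * s + c * c = 1"
      using sin_cos_squared_add[of \<theta>] by (simp add: s_def c_def power2_eq_square)
    have 1: "((\<lambda>t. \<rho> (\<phi> t) * sin (\<phi> t)) has_real_derivative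
        r * num \<theta> * s + r * U * (c * \<Theta> \<theta>)) (at t within {0..T})"
      unfolding \<rho>_def U_def s_def c_def
      by (rule derivative_eq_intros du\<phi> d\<phi> refl)+ (simp add: \<theta>_def)
    have 2: "((\<lambda>t. - \<rho> (\<phi> t) * cos (\<phi> t)) has_real_derivative
        - (r * num \<theta> * c) + r * U * (s * \<Theta> \<theta>)) (at t within {0..T})"
      unfolding \<rho>_def U_def s_def c_def
      by (rule derivative_eq_intros du\<phi> d\<phi> refl)+ (simp add: \<theta>_def)
    have "r * num \<theta> * s + r * U * (c * \<Theta> \<theta>) = fst (quad d l m n (r * U * s, - (r * U) * c))"
      unfolding num_def \<Theta>_def radial_coeff_def angular_coeff_def quad_def prod.case fst_conv
        s_def[symmetric] c_def[symmetric] U_def[symmetric] using cs by algebra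
    moreover have "- (r * num \<theta> * c) + r * U * (s * \<Theta> \<theta>) = snd (quad d l m n (r * U * s, - (r * U) * c))"
      unfolding num_def \<Theta>_def radial_coeff_def angular_coeff_def quad_def prod.case snd_conv
        s_def[symmetric] c_def[symmetric] U_def[symmetric] using cs by algebra
    moreover have "\<gamma> t = (r * U * s, - (r * U) * c)"
      by (simp add: \<gamma>_def \<rho>_def U_def s_def c_def \<theta>_def)
    moreover have "r * U * s \<ge> 0"
      using r ub[OF \<theta>] \<theta> sin_ge_zero[of \<theta>] by (simp add: U_def s_def)
    ultimately have "F (\<gamma> t) = (r * num \<theta> * s + r * U * (c * \<Theta> \<theta>), - (r * num \<theta> * c) + r * U * (s * \<Theta> \<theta>))"
      using F[of "\<gamma> t"] by (metis fst_conv prod.collapse)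
    then show "(\<gamma> has_vector_derivative F (\<gamma> t)) (at t within {0..T})"
      unfolding \<gamma>_def[abs_def] using 1 2
      by (auto simp: has_real_derivative_iff_has_vector_derivative intro!: has_vector_derivative_Pair)
  qed
  moreover have "fst (\<gamma> t) > 0" if "t \<in> {0<..<T}" for t
    using \<phi>(5)[OF that] ub[of "\<phi> t"] r by (auto simp: \<gamma>_def \<rho>_def intro!: mult_pos_pos sin_gt_zero)
  moreover have "continuous_on {0..pi} \<rho>" unfolding \<rho>_def by (intro continuous_intros ucont)
  moreover have "\<rho> 0 = r" "\<rho> pi = r * Re (f pi)" by (auto simp: \<rho>_def u_def f0)
  moreover have "\<forall>\<theta>\<in>{0..pi}. r / 2 \<le> \<rho> \<theta> \<and> \<rho> \<theta> \<le> 3 / 2 * r"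
    using ub r by (auto simp: \<rho>_def field_simps)
  moreover have "\<gamma> ` {0..T} = (\<lambda>\<theta>. (\<rho> \<theta> * sin \<theta>, - \<rho> \<theta> * cos \<theta>)) ` {0..pi}"
    unfolding \<gamma>_def[abs_def] \<phi>(3)[symmetric] image_image ..
  moreover have "\<gamma> 0 = (0, - r)" "\<gamma> T = (0, r * Re (f pi))"
    using \<phi> by (auto simp: \<gamma>_def \<rho>_def u_def f0)
  ultimately show ?thesis using T unfolding half_orbit_def by blast
qed

subsection \<open>Coefficients of the displacement map\<close>

text \<open>The function f is the half-return map divided by the initial distance. The error bound
  is stated for every admissible e' <= e: with d = 0 one may take e' = |z|, which gives a true
  remainder of third order in z, whereas the unfolding takes e' = e, where d and z are
  balanced.\<close>

definition half_map_spec :: "real \<Rightarrow> real \<Rightarrow> real \<Rightarrow> real \<Rightarrow> real \<Rightarrow> (complex \<Rightarrow> complex) \<Rightarrow> bool" where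
  "half_map_spec d l m n e f \<longleftrightarrow> f holomorphic_on ball 0 e \<and> (\<forall>z\<in>ball 0 e. f z \<in> cball 1 (1/2)) \<and>
     (\<forall>z\<in>ball 0 e. \<forall>e'. 0 \<le> e' \<and> e' \<le> e \<and> norm z \<le> e' \<and> \<bar>d\<bar> \<le> e'^2 \<longrightarrow>
        norm (f z - (1 + of_real (d * pi / 2) + of_real ((4 * l + 2 * (n - 1)) / 3) * z +
          of_real (((4 * l + 2 * (n - 1)) / 3)^2 + pi / 8 * m * (l + n)) * z^2))
        \<le> 11000 * (e' * coeff_bound l m n)^3) \<and>
     (\<forall>F. (\<forall>p. fst p \<ge> 0 \<longrightarrow> F p = quad d l m n p) \<longrightarrow>
        (\<forall>r. 0 < r \<and> r < e \<longrightarrow> (\<exists>\<rho> T \<gamma>. half_orbit F r (r * Re (f (of_real r))) \<rho> T \<gamma>)))"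

theorem half_map_exists:
  assumes e: "0 < e" "e * coeff_bound l m n \<le> 1/300" "\<bar>d\<bar> \<le> e^2"
  shows "\<exists>f. half_map_spec d l m n e f"
proof -
  obtain f where P: "\<forall>z\<in>ball 0 e. f z 0 = 1 \<and> (\<forall>t\<in>{0..pi}. f z t \<in> cball 1 (1/2) \<and>
        (f z has_vector_derivative polar_rhs d l m n t z (f z t)) (at t within {0..pi}))"
    "\<forall>t\<in>{0..pi}. (\<lambda>z. f z t) holomorphic_on ball 0 e"
    "\<forall>z\<in>ball 0 e \<inter> \<real>. \<forall>t\<in>{0..pi}. f z t \<in> \<real>"
    using polar_solution[OF e] by (elim exE conjE)
  have f: "f z 0 = 1" "\<And>t. t \<in> {0..pi} \<Longrightarrow> f z t \<in> cball 1 (1/2)"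
    "\<And>t. t \<in> {0..pi} \<Longrightarrow>
      (f z has_vector_derivative polar_rhs d l m n t z (f z t)) (at t within {0..pi})"
    if "z \<in> ball 0 e" for z
    using bspec[OF P(1) that] by blast+
  have pi: "pi \<in> {0..pi}" by simp
  have "half_map_spec d l m n e (\<lambda>z. f z pi)"
    unfolding half_map_spec_def
  proof (intro conjI ballI allI impI)
    show "(\<lambda>z. f z pi) holomorphic_on ball 0 e" by (rule bspec[OF P(2) pi])
    show "f z pi \<in> cball 1 (1/2)" if "z \<in> ball 0 e" for z by (rule f(2)[OF that pi])
    show "norm (f z pi - (1 + of_real (d * pi / 2) + of_real ((4 * l + 2 * (n - 1)) / 3) * z +
          of_real (((4 * l + 2 * (n - 1)) / 3)^2 + pi / 8 * m * (l + n)) * z^2))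
        \<le> 11000 * (e' * coeff_bound l m n)^3"
      if z: "z \<in> ball 0 e" and e': "0 \<le> e' \<and> e' \<le> e \<and> norm z \<le> e' \<and> \<bar>d\<bar> \<le> e'^2" for z e'
    proof (rule polar_expansion)
      show "e' * coeff_bound l m n \<le> 1/300"
        using mult_right_mono[of e' e "coeff_bound l m n"] coeff_bound_ge_1[of l m n] e' e(2) by linarith
      show "f z 0 = 1" by (rule f(1)[OF z])
      show "f z t \<in> cball 1 (1/2)"
        "(f z has_vector_derivative polar_rhs d l m n t z (f z t)) (at t within {0..pi})"
        if "t \<in> {0..pi}" for t
        by (rule f(2)[OF z that], rule f(3)[OF z that])
    qed (use e' in simp_all)
    fix F r assume F: "\<forall>p. 0 \<le> fst p \<longrightarrow> F p = quad d l m n p" and r: "0 < r \<and> r < e"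
    have r': "complex_of_real r \<in> ball 0 e" using r by simp
    show "\<exists>\<rho> T \<gamma>. half_orbit F r (r * Re (f (complex_of_real r) pi)) \<rho> T \<gamma>"
    proof (rule half_orbit_exists[OF _ e])
      show "F p = quad d l m n p" if "0 \<le> fst p" for p using F that by blast
      show "f (complex_of_real r) t \<in> \<real>" if "t \<in> {0..pi}" for t
        using P(3) r' that Reals_of_real[of r] by blast
    qed (use r in simp, use r in simp, rule f(1)[OF r'], erule f(2)[OF r'], erule f(3)[OF r'])
  qed
  then show ?thesis by blast
qed

lemma pw_field_right: "fst p \<ge> 0 \<Longrightarrow> pw_field (d1, d2, l1, l2, m1, m2, n) p = quad d1 l1 m1 n p"
  by (simp add: pw_field_def glue_def X_right_def)

lemma half_map_orbit:
  assumes "half_map_spec d1 l1 m1 n e f" "0 < r" "r < e"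
  shows "\<exists>\<rho> T \<gamma>. half_orbit (pw_field (d1, d2, l1, l2, m1, m2, n)) r (r * Re (f (of_real r))) \<rho> T \<gamma>"
  using assms pw_field_right unfolding half_map_spec_def by blast

lemma half_map_return:
  assumes "half_map_spec d1 l1 m1 n e f" "0 < r" "r < e"
  shows "right_return (pw_field (d1, d2, l1, l2, m1, m2, n)) r (r * Re (f (of_real r)))"
  using half_map_orbit[OF assms] half_orbit_imp_right_return assms(2) by blast

lemma half_map_displacement:
  assumes f1: "half_map_spec d1 l1 m1 n e1 f1" and f2: "half_map_spec (- d2) l2 (- m2) n e2 f2"
    and r: "0 < r" "r < e1" "r < e2"
  shows "displacement_defined (pw_field (d1, d2, l1, l2, m1, m2, n)) r"
    and "displacement (pw_field (d1, d2, l1, l2, m1, m2, n)) r = r * (Re (f2 (of_real r)) - Re (f1 (of_real r)))"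
  using half_map_return[OF f1 r(1,2), of d2 l2 m2] half_map_return[OF f2 r(1,3), of "- d1" l1 "- m1"]
  by (auto simp: displacement_defined_mirror displacement_mirror mirror_pw_field right_diff_distrib
      Pi1_eq[OF pw_field_lipschitz])

section \<open>Identification of the coefficients\<close>

text \<open>Strong induction on k. Once the lower coefficients vanish, the sum divided by r^k is
  again a power series, which tends to the k-th coefficient as r tends to 0 from the right, while
  the hypothesis bounds it by C r^(N - k).\<close>

lemma powser_coeff_zero:
  fixes a :: "nat \<Rightarrow> real"
  assumes \<rho>: "\<rho> > 0" and sums: "\<And>r. 0 < r \<Longrightarrow> r < \<rho> \<Longrightarrow> (\<lambda>k. a k * r ^ k) sums g r"
    and small: "\<And>r. 0 < r \<Longrightarrow> r < \<rho> \<Longrightarrow> \<bar>g r\<bar> \<le> C * r ^ N"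
  shows "k < N \<Longrightarrow> a k = 0"
proof (induction k rule: less_induct)
  case (less k)
  define h where "h x = (\<Sum>i. a (i + k) * x ^ i)" for x
  have summ: "summable (\<lambda>i. a (i + k) * x ^ i)" if "\<bar>x\<bar> < \<rho> / 2" for x
  proof (rule powser_inside)
    have "summable (\<lambda>i. a (i + k) * (\<rho>/2) ^ (i + k))"
      using summable_ignore_initial_segment[OF sums_summable[OF sums[of "\<rho>/2"]], of k] \<rho> by simp
    then have "summable (\<lambda>i. inverse ((\<rho>/2) ^ k) * (a (i + k) * (\<rho>/2) ^ (i + k)))" by (rule summable_mult)
    then show "summable (\<lambda>i. a (i + k) * (\<rho>/2) ^ i)"
      using \<rho> by (simp add: power_add field_simps)
  qed (use that in simp)
  have "(h \<longlongrightarrow> a (0 + k)) (at 0)"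
    by (rule powser_limit_0[of "\<rho>/2"]) (use \<rho> summ in \<open>auto simp: h_def summable_sums\<close>)
  then have lim: "(h \<longlongrightarrow> a k) (at_right 0)" by (simp add: filterlim_at_split)
  have h: "h r = g r / r ^ k" if r: "0 < r" "r < \<rho> / 2" for r
  proof -
    have "(\<lambda>i. a (i + k) * r ^ (i + k)) sums (g r - (\<Sum>i<k. a i * r ^ i))"
      using sums[of r] r by (intro sums_split_initial_segment) auto
    moreover have "(\<Sum>i<k. a i * r ^ i) = 0" using less by (intro sum.neutral) auto
    ultimately have "(\<lambda>i. inverse (r ^ k) * (a (i + k) * r ^ (i + k))) sums (inverse (r ^ k) * g r)"
      by (intro sums_mult) simp
    then have "(\<lambda>i. a (i + k) * r ^ i) sums (g r / r ^ k)"
      using r by (simp add: power_add field_simps)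
    then show ?thesis unfolding h_def by (simp add: sums_iff)
  qed
  have ev: "\<forall>\<^sub>F r in at_right 0. 0 < r \<and> r < \<rho>/2"
    using \<rho> by (auto simp: eventually_at_right_field intro: exI[of _ "\<rho>/2"])
  have "((\<lambda>r. C * r ^ (N - k)) \<longlongrightarrow> C * 0 ^ (N - k)) (at_right (0::real))"
    by (intro tendsto_intros)
  then have "((\<lambda>r. C * r ^ (N - k)) \<longlongrightarrow> 0) (at_right (0::real))" using less by (simp add: power_0_left)
  then have "(h \<longlongrightarrow> 0) (at_right 0)"
  proof (rule Lim_null_comparison[rotated])
    show "\<forall>\<^sub>F r in at_right 0. norm (h r) \<le> C * r ^ (N - k)"
      using ev
    proof eventually_elim
      case (elim r)
      have "\<bar>g r\<bar> / r ^ k \<le> C * r ^ N / r ^ k"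
        using small[of r] elim \<rho> by (intro divide_right_mono) auto
      also have "\<dots> = C * r ^ (N - k)" using elim less by (simp add: power_diff)
      finally show ?case using h[of r] elim by (simp add: abs_mult)
    qed
  qed
  with lim show ?case using tendsto_unique[of "at_right (0::real)"] by auto
qed

text \<open>Two expansions of the same function differ by a series with sum 0, whose coefficients
  vanish. This resolves the definite description in \<open>W_coeff\<close>.\<close>

lemma W_coeff_eq:
  assumes "displacement_series F W"
  shows "W_coeff F = W"
proof -
  have "W' = W" if W': "displacement_series F W'" for W'
  proof
    fix k
    obtain \<rho> \<rho>' where \<rho>: "\<rho> > 0" "\<And>r. 0 < r \<Longrightarrow> r < \<rho> \<Longrightarrow> (\<lambda>k. W k * r ^ k) sums displacement F r"
      "\<rho>' > 0" "\<And>r. 0 < r \<Longrightarrow> r < \<rho>' \<Longrightarrow> (\<lambda>k. W' k * r ^ k) sums displacement F r"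
      using assms W' unfolding displacement_series_def by blast
    have "W' k - W k = 0"
    proof (rule powser_coeff_zero)
      show "min \<rho> \<rho>' > 0" using \<rho> by simp
      show "(\<lambda>k. (W' k - W k) * r ^ k) sums 0" if "0 < r" "r < min \<rho> \<rho>'" for r
        using sums_diff[OF \<rho>(4)[of r] \<rho>(2)[of r]] that by (simp add: left_diff_distrib)
      show "\<bar>0\<bar> \<le> 0 * r ^ Suc k" for r :: real by simp
    qed simp
    then show "W' k = W k" by simp
  qed
  with assms show ?thesis unfolding W_coeff_def by (intro the_equality)
qed

lemma W_coeff_zero:
  assumes "\<rho> > 0" "\<And>r. 0 < r \<Longrightarrow> r < \<rho> \<Longrightarrow> displacement_defined F r \<and> displacement F r = 0"
  shows "W_coeff F k = 0"
proof -
  have "displacement_series F (\<lambda>_. 0)"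
    unfolding displacement_series_def using assms by auto
  then show ?thesis by (simp add: W_coeff_eq)
qed

definition std_radius :: "real \<Rightarrow> real \<Rightarrow> real \<Rightarrow> real" where
  "std_radius l m n = 1 / (300 * coeff_bound l m n)"

lemma std_radius_pos: "std_radius l m n > 0"
  using coeff_bound_ge_1[of l m n] by (simp add: std_radius_def)

lemma half_map_std: "\<exists>f. half_map_spec 0 l m n (std_radius l m n) f"
  using coeff_bound_ge_1[of l m n] by (intro half_map_exists) (auto simp: std_radius_def)

theorem W_coeff_center_type:
  fixes l1 l2 m1 m2 n :: real
  defines "F \<equiv> pw_field (0, 0, l1, l2, m1, m2, n)"
  shows "W_coeff F 1 = 0" and "W_coeff F 2 = 4/3 * (l2 - l1)"
    and "W_coeff F 3 = ((4 * l2 + 2 * (n - 1)) / 3)^2 - ((4 * l1 + 2 * (n - 1)) / 3)^2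
      - pi / 8 * (m2 * (l2 + n) + m1 * (l1 + n))"
proof -
  let ?e1 = "std_radius l1 m1 n" and ?e2 = "std_radius l2 (- m2) n"
  obtain f1 f2 where f1: "half_map_spec 0 l1 m1 n ?e1 f1" and f2: "half_map_spec (- 0) l2 (- m2) n ?e2 f2"
    using half_map_std[of l1 m1 n] half_map_std[of l2 "- m2" n] by auto
  define \<rho> where "\<rho> = min ?e1 ?e2"
  have \<rho>: "\<rho> > 0" using std_radius_pos by (simp add: \<rho>_def)
  \<comment> \<open>Real parts of the Taylor coefficients at 0. Holomorphy of f on a ball is what
    turns the displacement map into a convergent series.\<close>
  define c where "c f k = Re ((deriv ^^ k) f 0 / fact k)" for f :: "complex \<Rightarrow> complex" and k
  have cs: "(\<lambda>k. c f k * r ^ k) sums Re (f (of_real r))"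
    if f: "half_map_spec d l m n e f" and r: "0 < r" "r < e" for d l m n e f r
  proof -
    have "(\<lambda>k. (deriv ^^ k) f 0 / fact k * (complex_of_real r - 0) ^ k) sums f (of_real r)"
      by (rule holomorphic_power_series) (use f r in \<open>auto simp: half_map_spec_def\<close>)
    then have "(\<lambda>k. Re ((deriv ^^ k) f 0 / fact k * of_real (r ^ k))) sums Re (f (of_real r))"
      by (intro sums_Re) simp
    moreover have "Re (w * of_real x) = Re w * x" for w x by simp
    ultimately show ?thesis by (simp only: c_def)
  qed
  \<comment> \<open>The displacement map is r times a difference of Taylor series, so the index
    shifts by one and the entry at 0 is 0, as \<open>displacement_series\<close> demands.\<close>
  define W where "W k = (case k of 0 \<Rightarrow> 0 | Suc j \<Rightarrow> c f2 j - c f1 j)" for k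
  have sums: "(\<lambda>k. W k * r ^ k) sums displacement F r" if r: "0 < r" "r < \<rho>" for r
  proof -
    have "(\<lambda>k. r * ((c f2 k - c f1 k) * r ^ k)) sums displacement F r"
      using sums_mult[OF sums_diff[OF cs[OF f2, of r] cs[OF f1, of r]], of r]
        half_map_displacement(2)[OF f1 f2, of r] r
      by (simp add: F_def \<rho>_def left_diff_distrib)
    then have "(\<lambda>k. W (Suc k) * r ^ Suc k) sums displacement F r"
      by (simp add: W_def mult_ac)
    then show ?thesis by (subst (asm) sums_Suc_iff) (simp add: W_def)
  qed
  have "displacement_series F W"
    unfolding displacement_series_def
    using \<rho> sums half_map_displacement(1)[OF f1 f2]
    by (auto simp: W_def F_def \<rho>_def intro!: exI[of _ "min ?e1 ?e2"])
  then have WF: "W_coeff F = W" by (rule W_coeff_eq)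
  define A where "A l = (4 * l + 2 * (n - 1)) / 3" for l
  define Q where "Q l m = A l ^ 2 + pi / 8 * m * (l + n)" for l m
  define w2 w3 where "w2 = A l2 - A l1" and "w3 = Q l2 (- m2) - Q l1 m1"
  define K where "K l m = 11000 * coeff_bound l m n ^ 3" for l m
  have est: "\<bar>Re (f (of_real r)) - (1 + A l * r + Q l m * r^2)\<bar> \<le> K l m * r ^ 3"
    if f: "half_map_spec 0 l m n e f" and r: "0 < r" "r < e" for l m e f r
  proof -
    have "norm (f (of_real r) - (1 + of_real (0 * pi / 2) + of_real ((4 * l + 2 * (n - 1)) / 3) * of_real r +
          of_real (((4 * l + 2 * (n - 1)) / 3)^2 + pi / 8 * m * (l + n)) * (of_real r)^2))
        \<le> 11000 * (r * coeff_bound l m n)^3"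
      using f r unfolding half_map_spec_def by auto
    then have "norm (f (of_real r) - of_real (1 + A l * r + Q l m * r^2)) \<le> K l m * r ^ 3"
      by (simp add: A_def Q_def K_def power_mult_distrib mult_ac)
    then show ?thesis
      using abs_Re_le_cmod[of "f (of_real r) - of_real (1 + A l * r + Q l m * r^2)"]
      by (simp only: minus_complex.sel Re_complex_of_real)
  qed
  \<comment> \<open>The predicted cubic polynomial as a coefficient sequence. The displacement map
    minus this polynomial is bounded by a multiple of r^4, so the coefficients agree below index
    4.\<close>
  define P where "P k = (if k = 2 then w2 else if k = 3 then w3 else 0)" for k :: nat
  have Psums: "(\<lambda>k. P k * r ^ k) sums (w2 * r^2 + w3 * r^3)" for r
    using sums_finite[of "{2, 3}" "\<lambda>k. P k * r ^ k"] by (simp add: P_def)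
  have "W k - P k = 0" if "k < 4" for k
  proof (rule powser_coeff_zero[OF \<rho> _ _ that])
    fix r assume r: "0 < r" "r < \<rho>"
    show "(\<lambda>k. (W k - P k) * r ^ k) sums (displacement F r - (w2 * r^2 + w3 * r^3))"
      using sums_diff[OF sums[OF r] Psums[of r]] by (simp add: left_diff_distrib)
    have D: "displacement F r = r * (Re (f2 (of_real r)) - Re (f1 (of_real r)))"
      using half_map_displacement(2)[OF f1 f2, of r] r by (simp add: F_def \<rho>_def)
    have e1: "\<bar>Re (f1 (of_real r)) - (1 + A l1 * r + Q l1 m1 * r^2)\<bar> \<le> K l1 m1 * r ^ 3"
      by (rule est[OF f1]) (use r in \<open>auto simp: \<rho>_def\<close>)
    have e2: "\<bar>Re (f2 (of_real r)) - (1 + A l2 * r + Q l2 (- m2) * r^2)\<bar> \<le> K l2 (- m2) * r ^ 3"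
      by (rule est[of l2 "- m2" ?e2]) (use f2 r in \<open>auto simp: \<rho>_def\<close>)
    have "displacement F r - (w2 * r^2 + w3 * r^3) =
        r * ((Re (f2 (of_real r)) - (1 + A l2 * r + Q l2 (- m2) * r^2)) - (Re (f1 (of_real r)) - (1 + A l1 * r + Q l1 m1 * r^2)))"
      unfolding D w2_def w3_def by (simp add: algebra_simps power2_eq_square power3_eq_cube)
    also have "\<bar>\<dots>\<bar> \<le> r * (K l2 (- m2) * r ^ 3 + K l1 m1 * r ^ 3)"
      using mult_left_mono[OF order.trans[OF abs_triangle_ineq4 add_mono[OF e2 e1]], of r] r
      by (simp only: abs_mult) simp
    finally show "\<bar>displacement F r - (w2 * r^2 + w3 * r^3)\<bar> \<le> (K l2 (- m2) + K l1 m1) * r ^ 4"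
      by (simp add: algebra_simps eval_nat_numeral)
  qed
  from this[of 1] this[of 2] this[of 3]
  show "W_coeff F 1 = 0" "W_coeff F 2 = 4/3 * (l2 - l1)"
    "W_coeff F 3 = ((4 * l2 + 2 * (n - 1)) / 3)^2 - ((4 * l1 + 2 * (n - 1)) / 3)^2
      - pi / 8 * (m2 * (l2 + n) + m1 * (l1 + n))"
    unfolding WF by (auto simp: P_def w2_def w3_def A_def Q_def field_simps)
qed

subsection \<open>Centers\<close>

lemma antiderivative_interval:
  fixes g :: "real \<Rightarrow> real"
  assumes "c > 0" "continuous_on {-c..c} g"
  shows "\<exists>G. G 0 = 0 \<and> (\<forall>x\<in>{-c<..<c}. (G has_real_derivative g x) (at x)) \<and> continuous_on {-c..c} G"
proof -
  obtain G0 where G0: "\<And>x. x \<in> {-c..c} \<Longrightarrow> (G0 has_vector_derivative g x) (at x within {-c..c})"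
    using antiderivative_continuous[OF assms(2)] by blast
  define G where "G x = G0 x - G0 0" for x
  have 1: "(G has_vector_derivative g x) (at x within {-c..c})" if "x \<in> {-c..c}" for x
    unfolding G_def[abs_def]
    using has_vector_derivative_diff[OF G0[OF that] has_vector_derivative_const] by simp
  have "(G has_real_derivative g x) (at x)" if "x \<in> {-c<..<c}" for x
  proof -
    have "(G has_vector_derivative g x) (at x within {-c..c})" by (rule 1) (use that in simp)
    then show ?thesis
      using at_within_Icc_at[of "-c" x c] that unfolding has_real_derivative_iff_has_vector_derivative
      by (metis greaterThanLessThan_iff)
  qed
  moreover have "continuous_on {-c..c} G"
    unfolding continuous_on_eq_continuous_within using 1 has_vector_derivative_continuous by blast
  ultimately show ?thesis by (intro exI[of _ G]) (simp add: G_def)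
qed

lemma zero_derivative_endpoints:
  fixes f :: "real \<Rightarrow> real"
  assumes "a \<le> b" "\<And>t. t \<in> {a..b} \<Longrightarrow> (f has_real_derivative 0) (at t within {a..b})"
  shows "f b = f a"
proof -
  have "norm (f b - f a) \<le> 0 * (b - a)"
    by (rule vector_derivative_bound[where f' = "\<lambda>_. 0"])
      (use assms in \<open>auto simp: has_real_derivative_iff_has_vector_derivative\<close>)
  then show ?thesis by simp
qed

text \<open>The quadrature in y of the invariant-line case n = - l. It depends on l alone: a
  relation between the two endpoints of a half orbit stated through it is blind to m, and this makes
  both half-return maps equal.\<close>

definition lv_primitive :: "real \<Rightarrow> real \<Rightarrow> real" where
  "lv_primitive l = (SOME P. P 0 = 0 \<and>
     (\<forall>y\<in>{-1/2<..<1/2}. (P has_real_derivative y * (1 - y) powr (l - 1)) (at y)))"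

lemma lv_primitive:
  "lv_primitive l 0 = 0"
  "y \<in> {-1/2<..<1/2} \<Longrightarrow> (lv_primitive l has_real_derivative y * (1 - y) powr (l - 1)) (at y)"
proof -
  have "continuous_on {-1/2..1/2} (\<lambda>y::real. y * (1 - y) powr (l - 1))"
    by (intro continuous_intros) auto
  then have "\<exists>P. P 0 = 0 \<and> (\<forall>y\<in>{-1/2<..<1/2}. (P has_real_derivative y * (1 - y) powr (l - 1)) (at y))"
    using antiderivative_interval[of "1/2" "\<lambda>y. y * (1 - y) powr (l - 1)"] by auto
  from someI_ex[OF this]
  have *: "lv_primitive l 0 = 0 \<and> (\<forall>y\<in>{-1/2<..<1/2}.
      (lv_primitive l has_real_derivative y * (1 - y) powr (l - 1)) (at y))"
    unfolding lv_primitive_def .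
  show "lv_primitive l 0 = 0" using * by blast
  show "y \<in> {-1/2<..<1/2} \<Longrightarrow> (lv_primitive l has_real_derivative y * (1 - y) powr (l - 1)) (at y)"
    using * by blast
qed

text \<open>The integrand y (1 - y)^(l - 1) is positive for 0 < y < 1/2. Hence the value of the
  primitive determines the upper endpoint of a half orbit.\<close>

lemma lv_primitive_strict_mono:
  assumes "0 < s" "s < s'" "s' < 1/2"
  shows "lv_primitive l s < lv_primitive l s'"
proof (rule DERIV_pos_imp_increasing[OF assms(2)])
  fix y assume "s \<le> y" "y \<le> s'"
  then have y: "0 < y" "y < 1/2" using assms by auto
  then have "(lv_primitive l has_real_derivative y * (1 - y) powr (l - 1)) (at y)"
    by (intro lv_primitive) auto
  moreover have "y * (1 - y) powr (l - 1) > 0" using y by simp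
  ultimately show "\<exists>D. (lv_primitive l has_real_derivative D) (at y) \<and> 0 < D" by blast
qed

text \<open>For \<open>n = - l\<close> the field has three invariant lines. In the variable \<open>\<xi> = - x / (1 + l y - m x)\<close>
  the two first integrals below become explicit quadratures, and both endpoints of a half orbit have
  \<open>\<xi> = 0\<close>; this avoids distinguishing real from complex lines.\<close>

lemma lv_half_orbit:
  fixes l m :: real
  shows "\<exists>\<epsilon>>0. \<forall>\<gamma> T r s. T > 0 \<and> solution_on (quad 0 l m (- l)) \<gamma> {0..T} \<and>
    (\<forall>t\<in>{0..T}. norm (\<gamma> t) < \<epsilon>) \<and> \<gamma> 0 = (0, - r) \<and> \<gamma> T = (0, s) \<longrightarrow>
    lv_primitive l s = lv_primitive l (- r)"
proof -
  define \<kappa> where "\<kappa> = l * (l + 1)"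
  \<comment> \<open>\<open>K\<close> and \<open>c\<close> are chosen so that |m| c + |\<kappa>| c <
    K c = 1/2; this keeps the quadratic \<open>q\<close> positive on [-c, c].\<close>
  define K where "K = 1 + \<bar>m\<bar> + \<bar>\<kappa>\<bar>"
  define c where "c = 1 / (2 * K)"
  have K: "K \<ge> 1" by (simp add: K_def)
  have c: "c > 0" "c \<le> 1/2" using K by (simp_all add: c_def field_simps)
  \<comment> \<open>The quadratic for which the derivative of \<xi> along orbits is y q(\<xi>). The
    coefficient \<kappa> = l (l + 1) comes out of that computation. Positivity of \<open>q\<close>
    suffices; it is never factored.\<close>
  define q where "q \<xi> = 1 - m * \<xi> - \<kappa> * \<xi>^2" for \<xi>
  have q: "q \<xi> > 0" if "\<xi> \<in> {-c..c}" for \<xi>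
  proof -
    have x: "\<bar>\<xi>\<bar> \<le> c" using that by auto
    have "\<bar>m * \<xi>\<bar> \<le> \<bar>m\<bar> * c" unfolding abs_mult using x by (intro mult_left_mono) auto
    moreover have "\<bar>\<kappa> * \<xi>^2\<bar> \<le> \<bar>\<kappa>\<bar> * c"
    proof -
      have "\<bar>\<xi>\<bar> * \<bar>\<xi>\<bar> \<le> c * 1" using x c by (intro mult_mono) auto
      then have "\<xi>^2 \<le> c" by (simp add: power2_eq_square)
      then show ?thesis unfolding abs_mult by (intro mult_left_mono) auto
    qed
    moreover have "K * c = 1/2" using K by (simp add: c_def)
    then have "\<bar>m\<bar> * c + \<bar>\<kappa>\<bar> * c < 1" using c unfolding K_def by (simp add: distrib_right)
    ultimately show ?thesis unfolding q_def by linarith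
  qed
  have q0: "q \<xi> \<noteq> 0" if "\<xi> \<in> {-c..c}" for \<xi> using q[OF that] by simp
  have "continuous_on {-c..c} (\<lambda>\<xi>. (\<kappa> * \<xi> + m) / q \<xi>)"
    using q0 unfolding q_def by (intro continuous_intros) auto
  then obtain \<Omega> where \<Omega>: "\<Omega> 0 = 0" "\<And>\<xi>. \<xi> \<in> {-c<..<c} \<Longrightarrow> (\<Omega> has_real_derivative (\<kappa> * \<xi> + m) / q \<xi>) (at \<xi>)"
    "continuous_on {-c..c} \<Omega>"
    using antiderivative_interval[OF c(1)] by blast
  have "continuous_on {-c..c} (\<lambda>\<xi>. \<xi> * exp (\<Omega> \<xi>) / q \<xi>)"
    using q0 \<Omega>(3) unfolding q_def by (intro continuous_intros) auto
  then obtain \<Gamma> where \<Gamma>: "\<Gamma> 0 = 0" "\<And>\<xi>. \<xi> \<in> {-c<..<c} \<Longrightarrow> (\<Gamma> has_real_derivative \<xi> * exp (\<Omega> \<xi>) / q \<xi>) (at \<xi>)"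
    using antiderivative_interval[OF c(1)] by blast
  \<comment> \<open>Within this radius M = 1 + l y - m x is at least 3/4 and \<xi> stays in the open
    interval (-c, c), the domain of both quadratures.\<close>
  define \<epsilon> where "\<epsilon> = c / (2 * (1 + \<bar>l\<bar> + \<bar>m\<bar>))"
  have \<epsilon>pos: "\<epsilon> > 0" using c by (simp add: \<epsilon>_def)
  have \<epsilon>le: "\<epsilon> \<le> c / 2" "\<bar>l\<bar> * \<epsilon> + \<bar>m\<bar> * \<epsilon> \<le> 1/4"
  proof -
    have "\<epsilon> * (1 + \<bar>l\<bar> + \<bar>m\<bar>) = c / 2" unfolding \<epsilon>_def by (simp add: field_simps)
    then have *: "\<epsilon> + (\<bar>l\<bar> * \<epsilon> + \<bar>m\<bar> * \<epsilon>) = c / 2" by (simp add: algebra_simps)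
    moreover have "0 \<le> \<bar>l\<bar> * \<epsilon> + \<bar>m\<bar> * \<epsilon>" using \<epsilon>pos by simp
    ultimately show "\<epsilon> \<le> c / 2" "\<bar>l\<bar> * \<epsilon> + \<bar>m\<bar> * \<epsilon> \<le> 1/4" using c \<epsilon>pos by linarith+
  qed
  show ?thesis
  proof (intro exI[of _ \<epsilon>] conjI allI impI \<epsilon>pos)
    fix \<gamma> :: "real \<Rightarrow> real \<times> real" and T r s
    assume A: "T > 0 \<and> solution_on (quad 0 l m (- l)) \<gamma> {0..T} \<and>
      (\<forall>t\<in>{0..T}. norm (\<gamma> t) < \<epsilon>) \<and> \<gamma> 0 = (0, - r) \<and> \<gamma> T = (0, s)"
    define x y where "x t = fst (\<gamma> t)" and "y t = snd (\<gamma> t)" for t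
    define M where "M t = 1 + l * y t - m * x t" for t
    define \<xi> where "\<xi> t = - x t / M t" for t
    define p where "p t = (1 - y t) powr l" for t
    define N where "N t = - p t * M t" for t
    have small: "\<bar>x t\<bar> < \<epsilon>" "\<bar>y t\<bar> < \<epsilon>" if "t \<in> {0..T}" for t
      using A that norm_fst_le[of "fst (\<gamma> t)" "snd (\<gamma> t)"] norm_snd_le[of "snd (\<gamma> t)" "fst (\<gamma> t)"]
      unfolding x_def y_def by (simp_all only: prod.collapse real_norm_def) (meson le_less_trans)+
    have M: "M t \<ge> 3/4" if t: "t \<in> {0..T}" for t
    proof -
      have "\<bar>l * y t\<bar> \<le> \<bar>l\<bar> * \<epsilon>" "\<bar>m * x t\<bar> \<le> \<bar>m\<bar> * \<epsilon>"
        unfolding abs_mult using small[OF t] by (auto intro: mult_left_mono)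
      then show ?thesis using \<epsilon>le(2) unfolding M_def by linarith
    qed
    have \<xi>c: "\<xi> t \<in> {-c<..<c}" if t: "t \<in> {0..T}" for t
    proof -
      have "\<bar>\<xi> t\<bar> = \<bar>x t\<bar> / M t" using M[OF t] by (simp add: \<xi>_def)
      also have "\<dots> \<le> \<bar>x t\<bar> / (3/4)" using M[OF t] by (intro divide_left_mono) auto
      also have "\<dots> < c" using small[OF t] \<epsilon>le(1) c by simp
      finally show ?thesis by auto
    qed
    have y1: "1 - y t > 0" "y t \<in> {-1/2<..<1/2}" if t: "t \<in> {0..T}" for t
      using small[OF t] \<epsilon>le(1) c by auto
    have dxy: "(x has_real_derivative - y t + l * x t^2 + m * x t * y t - l * y t^2) (at t within {0..T})"
      "(y has_real_derivative x t * (1 - y t)) (at t within {0..T})" if t: "t \<in> {0..T}" for t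
    proof -
      have "(\<gamma> has_vector_derivative quad 0 l m (- l) (\<gamma> t)) (at t within {0..T})"
        using A t unfolding solution_on_def by blast
      from bounded_linear.has_vector_derivative[OF bounded_linear_fst this]
        bounded_linear.has_vector_derivative[OF bounded_linear_snd this]
      show "(x has_real_derivative - y t + l * x t^2 + m * x t * y t - l * y t^2) (at t within {0..T})"
        "(y has_real_derivative x t * (1 - y t)) (at t within {0..T})"
        unfolding has_real_derivative_iff_has_vector_derivative x_def[abs_def] y_def[abs_def]
        by (simp_all add: quad_def case_prod_unfold)
    qed
    have d\<xi>: "(\<xi> has_real_derivative y t * q (\<xi> t)) (at t within {0..T})" if t: "t \<in> {0..T}" for t
    proof -
      let ?x' = "- y t + l * x t^2 + m * x t * y t - l * y t^2" and ?y' = "x t * (1 - y t)"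
      have M0: "M t \<noteq> 0" using M[OF t] by auto
      have dM: "(M has_real_derivative l * ?y' - m * ?x') (at t within {0..T})"
        unfolding M_def[abs_def]
        by (rule derivative_eq_intros dxy[OF t] refl)+ simp
      have "(\<xi> has_real_derivative (- ?x' * M t - (- x t) * (l * ?y' - m * ?x')) / (M t * M t)) (at t within {0..T})"
        unfolding \<xi>_def[abs_def] by (intro DERIV_divide DERIV_minus dxy[OF t] dM M0)
      moreover have "(- ?x' * M t - (- x t) * (l * ?y' - m * ?x')) = y t * (M t * M t * q (\<xi> t))"
      proof -
        have eq: "M t * M t * q (\<xi> t) = M t * M t + m * x t * M t - \<kappa> * x t^2"
          unfolding q_def \<xi>_def using M0 by (simp add: field_simps power2_eq_square)
        show ?thesis unfolding eq unfolding M_def \<kappa>_def by (simp add: algebra_simps power2_eq_square)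
      qed
      ultimately show ?thesis using M0 by simp
    qed
    have dp: "(p has_real_derivative - l * x t * p t) (at t within {0..T})" if t: "t \<in> {0..T}" for t
    proof -
      have "((\<lambda>t. 1 - y t) has_real_derivative - (x t * (1 - y t))) (at t within {0..T})"
        by (rule derivative_eq_intros dxy[OF t] refl)+ simp
      from has_real_derivative_powr[OF y1(1)[OF t], of l] this
      have "((\<lambda>t. (1 - y t) powr l) has_real_derivative l * (1 - y t) powr (l - 1) * - (x t * (1 - y t))) (at t within {0..T})"
        by (rule DERIV_chain2)
      moreover have "(1 - y t) powr l = (1 - y t) powr (l - 1) * (1 - y t)"
        using powr_add[of "1 - y t" "l - 1" 1] y1(1)[OF t] by simp
      ultimately show ?thesis by (simp add: p_def[abs_def] mult_ac)
    qed
    have dN: "(N has_real_derivative y t * (\<kappa> * \<xi> t + m) * N t) (at t within {0..T})" if t: "t \<in> {0..T}" for t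
    proof -
      let ?x' = "- y t + l * x t^2 + m * x t * y t - l * y t^2" and ?y' = "x t * (1 - y t)"
      have M0: "M t \<noteq> 0" using M[OF t] by auto
      have dM: "(M has_real_derivative l * ?y' - m * ?x') (at t within {0..T})"
        unfolding M_def[abs_def]
        by (rule derivative_eq_intros dxy[OF t] refl)+ simp
      have "(N has_real_derivative - (- l * x t * p t) * M t + (l * ?y' - m * ?x') * (- p t)) (at t within {0..T})"
        unfolding N_def[abs_def] by (intro DERIV_mult DERIV_minus dp[OF t] dM)
      moreover have "- (- l * x t * p t) * M t + (l * ?y' - m * ?x') * (- p t) = y t * (\<kappa> * \<xi> t + m) * N t"
      proof -
        have *: "(\<kappa> * \<xi> t + m) * M t = m * M t - \<kappa> * x t"
          unfolding \<xi>_def using M0 by (simp add: field_simps)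
        have "y t * (\<kappa> * \<xi> t + m) * N t = - y t * p t * ((\<kappa> * \<xi> t + m) * M t)"
          unfolding N_def by simp
        then have eq: "y t * (\<kappa> * \<xi> t + m) * N t = - y t * p t * (m * M t - \<kappa> * x t)"
          unfolding * .
        show ?thesis unfolding eq unfolding M_def \<kappa>_def by (simp add: algebra_simps power2_eq_square)
      qed
      ultimately show ?thesis by simp
    qed
    have chain: "((\<lambda>t. g (\<xi> t)) has_real_derivative g' * (y t * q (\<xi> t))) (at t within {0..T})"
      if "t \<in> {0..T}" "(g has_real_derivative g') (at (\<xi> t))" for g g' t
      by (rule DERIV_chain2[OF that(2) d\<xi>[OF that(1)]])
    have T: "0 \<le> T" "0 \<in> {0..T}" using A by auto
    \<comment> \<open>The first conserved quantity. The logarithmic derivative of N is y (\<kappa>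
      \<xi> + m), and \<Omega>(\<xi>) has the same derivative because the factor q cancels against
      that of \<xi>.\<close>
    have NE: "N t * exp (- \<Omega> (\<xi> t)) = N 0 * exp (- \<Omega> (\<xi> 0))" if t: "t \<in> {0..T}" for t
    proof (rule zero_derivative_endpoints[of 0 t "\<lambda>t. N t * exp (- \<Omega> (\<xi> t))"])
      fix u assume u: "u \<in> {0..t}"
      then have u': "u \<in> {0..T}" using t by auto
      have "((\<lambda>t. \<Omega> (\<xi> t)) has_real_derivative (\<kappa> * \<xi> u + m) / q (\<xi> u) * (y u * q (\<xi> u))) (at u within {0..T})"
        by (rule chain[OF u' \<Omega>(2)[OF \<xi>c[OF u']]])
      then have dO: "((\<lambda>t. \<Omega> (\<xi> t)) has_real_derivative (\<kappa> * \<xi> u + m) * y u) (at u within {0..T})"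
        using q0[of "\<xi> u"] \<xi>c[OF u'] by simp
      have "((\<lambda>t. N t * exp (- \<Omega> (\<xi> t))) has_real_derivative 0) (at u within {0..T})"
        by (rule derivative_eq_intros dO dN[OF u'] refl)+ (simp add: algebra_simps)
      then show "((\<lambda>t. N t * exp (- \<Omega> (\<xi> t))) has_real_derivative 0) (at u within {0..t})"
        by (rule has_field_derivative_subset) (use t in auto)
    qed (use t in simp)
    define C where "C = N 0 * exp (- \<Omega> (\<xi> 0))"
    have N: "N t = C * exp (\<Omega> (\<xi> t))" if t: "t \<in> {0..T}" for t
      using NE[OF t] unfolding C_def exp_minus by (simp add: field_simps)
    \<comment> \<open>The second conserved quantity. Both terms have derivative p x y, since N \<xi>
      = p x and N = C exp(\<Omega>(\<xi>)). At the endpoints x = 0, hence \<xi> = 0 and the term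
      with \<Gamma> drops out.\<close>
    have "lv_primitive l (y T) - C * \<Gamma> (\<xi> T) = lv_primitive l (y 0) - C * \<Gamma> (\<xi> 0)"
    proof (rule zero_derivative_endpoints[OF T(1)])
      fix t assume t: "t \<in> {0..T}"
      have "((\<lambda>t. lv_primitive l (y t)) has_real_derivative y t * (1 - y t) powr (l - 1) * (x t * (1 - y t))) (at t within {0..T})"
        by (rule DERIV_chain2[OF lv_primitive(2)[OF y1(2)[OF t]] dxy(2)[OF t]])
      moreover have "(1 - y t) powr (l - 1) * (1 - y t) = p t"
        using powr_add[of "1 - y t" "l - 1" 1] y1(1)[OF t] by (simp add: p_def)
      then have "y t * (1 - y t) powr (l - 1) * (x t * (1 - y t)) = y t * x t * p t"
        by (metis mult.assoc mult.left_commute)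
      ultimately have 1: "((\<lambda>t. lv_primitive l (y t)) has_real_derivative y t * x t * p t) (at t within {0..T})"
        by metis
      have "((\<lambda>t. C * \<Gamma> (\<xi> t)) has_real_derivative C * (\<xi> t * exp (\<Omega> (\<xi> t)) / q (\<xi> t) * (y t * q (\<xi> t)))) (at t within {0..T})"
        by (rule DERIV_cmult[OF chain[OF t \<Gamma>(2)[OF \<xi>c[OF t]]]])
      moreover have "C * (\<xi> t * exp (\<Omega> (\<xi> t)) / q (\<xi> t) * (y t * q (\<xi> t))) = N t * \<xi> t * y t"
        using q0[of "\<xi> t"] \<xi>c[OF t] N[OF t] by simp
      moreover have "N t * \<xi> t = p t * x t"
        unfolding N_def \<xi>_def using M[OF t] by simp
      ultimately have 2: "((\<lambda>t. C * \<Gamma> (\<xi> t)) has_real_derivative p t * x t * y t) (at t within {0..T})"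
        by metis
      show "((\<lambda>t. lv_primitive l (y t) - C * \<Gamma> (\<xi> t)) has_real_derivative 0) (at t within {0..T})"
        using DERIV_diff[OF 1 2] by (simp add: mult_ac)
    qed
    then show "lv_primitive l s = lv_primitive l (- r)"
      using A by (simp add: \<xi>_def x_def y_def)
  qed
qed


lemma polar_norm:
  fixes \<rho> \<theta> :: real
  assumes "\<rho> \<ge> 0"
  shows "norm (\<rho> * sin \<theta>, - \<rho> * cos \<theta>) = \<rho>"
proof -
  have "(\<rho> * sin \<theta>)^2 + (- \<rho> * cos \<theta>)^2 = \<rho>^2"
    using sin_cos_squared_add[of \<theta>] by (simp add: power_mult_distrib flip: distrib_left)
  then show ?thesis using assms unfolding norm_Pair real_norm_def power2_abs by simp
qed

lemma half_orbit_norm: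
  assumes "half_orbit F r s \<rho> T \<gamma>" "t \<in> {0..T}"
  shows "norm (\<gamma> t) \<le> 3/2 * r" "fst (\<gamma> t) \<ge> 0"
proof -
  have "\<gamma> t \<in> \<gamma> ` {0..T}" using assms(2) by blast
  then obtain \<theta> where \<theta>: "\<theta> \<in> {0..pi}" "\<gamma> t = (\<rho> \<theta> * sin \<theta>, - \<rho> \<theta> * cos \<theta>)"
    using assms(1) unfolding half_orbit_def by auto
  have \<rho>: "r / 2 \<le> \<rho> \<theta>" "\<rho> \<theta> \<le> 3 / 2 * r"
    using assms(1) \<theta>(1) unfolding half_orbit_def by blast+
  then have "0 \<le> r" by linarith
  then have "0 \<le> \<rho> \<theta>" using \<rho> by linarith
  then have "norm (\<gamma> t) = \<rho> \<theta>" unfolding \<theta>(2) by (rule polar_norm)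
  then show "norm (\<gamma> t) \<le> 3/2 * r" using \<rho> by simp
  show "fst (\<gamma> t) \<ge> 0"
    using \<open>0 \<le> \<rho> \<theta>\<close> \<theta>(1) sin_ge_zero[of \<theta>] unfolding \<theta>(2) by simp
qed

lemma center_symmetric:
  "\<exists>\<rho>>0. \<forall>r. 0 < r \<and> r < \<rho> \<longrightarrow> displacement_defined (pw_field (0, 0, l, l, m, - m, n)) r \<and>
     displacement (pw_field (0, 0, l, l, m, - m, n)) r = 0"
proof -
  obtain f where f: "half_map_spec 0 l m n (std_radius l m n) f" using half_map_std by blast
  then have f': "half_map_spec (- 0) l (- (- m)) n (std_radius l m n) f" by simp
  show ?thesis
    using half_map_displacement[OF f f'] std_radius_pos by (auto intro!: exI[of _ "std_radius l m n"])
qed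

text \<open>For a given r the endpoints of both half orbits solve the same equation P(s) = P(- r) in
  (0, 1/2), where P is strictly increasing; so they coincide although m1 and m2 are
  unrelated.\<close>

lemma center_lotka_volterra:
  "\<exists>\<rho>>0. \<forall>r. 0 < r \<and> r < \<rho> \<longrightarrow> displacement_defined (pw_field (0, 0, l, l, m1, m2, - l)) r \<and>
     displacement (pw_field (0, 0, l, l, m1, m2, - l)) r = 0"
proof -
  let ?e1 = "std_radius l m1 (- l)" and ?e2 = "std_radius l (- m2) (- l)"
  obtain f1 where f1: "half_map_spec 0 l m1 (- l) ?e1 f1" using half_map_std by blast
  obtain f2 where f2': "half_map_spec 0 l (- m2) (- l) ?e2 f2" using half_map_std by blast
  then have f2: "half_map_spec (- 0) l (- m2) (- l) ?e2 f2" unfolding minus_zero .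
  have main: "\<exists>\<rho>>0. \<forall>r. 0 < r \<and> r < \<rho> \<longrightarrow>
      lv_primitive l (r * Re (f (complex_of_real r))) = lv_primitive l (- r) \<and>
      0 < r * Re (f (complex_of_real r)) \<and> r * Re (f (complex_of_real r)) < 1/2"
    if f: "half_map_spec 0 l m (- l) e f" and e: "e > 0" for m e and f :: "complex \<Rightarrow> complex"
  proof -
    obtain \<epsilon> where \<epsilon>: "\<epsilon> > 0" "\<forall>\<gamma> T r s. T > 0 \<and> solution_on (quad 0 l m (- l)) \<gamma> {0..T} \<and>
      (\<forall>t\<in>{0..T}. norm (\<gamma> t) < \<epsilon>) \<and> \<gamma> 0 = (0, - r) \<and> \<gamma> T = (0, s) \<longrightarrow>
      lv_primitive l s = lv_primitive l (- r)"
      using lv_half_orbit[of l m] by (elim exE conjE)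
    show ?thesis
    proof (intro exI[of _ "min e (min (\<epsilon> / 2) (1/4))"] conjI allI impI)
      show "0 < min e (min (\<epsilon> / 2) (1/4))" using e \<epsilon> by simp
      \<comment> \<open>A half orbit stays within distance 3 r / 2: r < \<epsilon>/2 keeps it in the
        domain of the conserved quantities, and r < 1/4 keeps its endpoint below 1/2.\<close>
      fix r assume r: "0 < r \<and> r < min e (min (\<epsilon> / 2) (1/4))"
      let ?s = "r * Re (f (complex_of_real r))"
      have r': "0 < r" "r < e" using r by auto
      obtain \<rho> T \<gamma> where O: "half_orbit (pw_field (0, 0, l, 0, m, 0, - l)) r ?s \<rho> T \<gamma>"
        using half_map_orbit[OF f r', of 0 0 0] by (elim exE)
      have T: "T > 0" "\<gamma> 0 = (0, - r)" "\<gamma> T = (0, ?s)"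
        and sol: "solution_on (pw_field (0, 0, l, 0, m, 0, - l)) \<gamma> {0..T}"
        using O unfolding half_orbit_def by blast+
      have "solution_on (quad 0 l m (- l)) \<gamma> {0..T}"
        using sol half_orbit_norm(2)[OF O] unfolding solution_on_def by (simp add: pw_field_right)
      moreover have "norm (\<gamma> t) < \<epsilon>" if "t \<in> {0..T}" for t
        using half_orbit_norm(1)[OF O that] r by simp
      ultimately show "lv_primitive l ?s = lv_primitive l (- r)"
        using \<epsilon>(2)[rule_format, of T \<gamma> r ?s] T by blast
      have "right_return (pw_field (0, 0, l, 0, m, 0, - l)) r ?s"
        by (rule half_orbit_imp_right_return[OF O]) (use r in simp)
      then show "?s > 0" unfolding right_return_def by blast
      have "T \<in> {0..T}" using T(1) by simp
      from half_orbit_norm(1)[OF O this] have "\<bar>?s\<bar> \<le> 3/2 * r"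
        unfolding T(3) norm_Pair real_norm_def power2_abs by (simp only: power_zero_numeral add_0 real_sqrt_abs)
      moreover have "r < 1/4" using r by simp
      ultimately show "?s < 1/2" using \<open>?s > 0\<close> by linarith
    qed
  qed
  obtain \<rho>1 where \<rho>1: "\<rho>1 > 0" "\<And>r. 0 < r \<Longrightarrow> r < \<rho>1 \<Longrightarrow>
      lv_primitive l (r * Re (f1 (complex_of_real r))) = lv_primitive l (- r) \<and>
      0 < r * Re (f1 (complex_of_real r)) \<and> r * Re (f1 (complex_of_real r)) < 1/2"
    using main[OF f1 std_radius_pos] by blast
  obtain \<rho>2 where \<rho>2: "\<rho>2 > 0" "\<And>r. 0 < r \<Longrightarrow> r < \<rho>2 \<Longrightarrow>
      lv_primitive l (r * Re (f2 (complex_of_real r))) = lv_primitive l (- r) \<and>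
      0 < r * Re (f2 (complex_of_real r)) \<and> r * Re (f2 (complex_of_real r)) < 1/2"
    using main[OF f2' std_radius_pos] by blast
  show ?thesis
  proof (intro exI[of _ "min (min ?e1 ?e2) (min \<rho>1 \<rho>2)"] conjI allI impI)
    show "0 < min (min ?e1 ?e2) (min \<rho>1 \<rho>2)" using std_radius_pos \<rho>1 \<rho>2 by simp
    fix r assume r: "0 < r \<and> r < min (min ?e1 ?e2) (min \<rho>1 \<rho>2)"
    have r': "0 < r" "r < ?e1" "r < ?e2" using r by auto
    show "displacement_defined (pw_field (0, 0, l, l, m1, m2, - l)) r"
      by (rule half_map_displacement(1)[OF f1 f2 r'])
    let ?s1 = "r * Re (f1 (complex_of_real r))" and ?s2 = "r * Re (f2 (complex_of_real r))"
    have "?s1 = ?s2"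
      using lv_primitive_strict_mono[of ?s1 ?s2 l] lv_primitive_strict_mono[of ?s2 ?s1 l]
        \<rho>1(2)[of r] \<rho>2(2)[of r] r by (cases ?s1 ?s2 rule: linorder_cases) auto
    then show "displacement (pw_field (0, 0, l, l, m1, m2, - l)) r = 0"
      using half_map_displacement(2)[OF f1 f2 r'] by auto
  qed
qed

text \<open>Order above 3 would need W_2 = W_3 = 0. The first equation gives l1 = l2, the second
  then gives one of the two center cases, in which every coefficient vanishes.\<close>

theorem weak_focus_order_le_3:
  assumes "weak_focus_order p k"
  shows "k \<le> 3"
proof (rule ccontr)
  assume "\<not> k \<le> 3"
  obtain d1 d2 l1 l2 m1 m2 n where p: "p = (d1, d2, l1, l2, m1, m2, n)" by (cases p) auto
  have d: "d1 = 0" "d2 = 0" using assms unfolding p weak_focus_order_def by auto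
  define F where "F = pw_field (0, 0, l1, l2, m1, m2, n)"
  have W: "W_coeff F i = 0" if "1 \<le> i" "i \<le> 3" for i
    using assms that \<open>\<not> k \<le> 3\<close> unfolding p weak_focus_order_def d F_def by auto
  have Wk: "W_coeff F k \<noteq> 0" using assms unfolding p weak_focus_order_def d F_def by auto
  have l: "l1 = l2" using W[of 2] W_coeff_center_type(2)[of l1 l2 m1 m2 n] by (simp add: F_def)
  have "pi / 8 * ((m1 + m2) * (l2 + n)) = 0"
    using W[of 3] W_coeff_center_type(3)[of l1 l2 m1 m2 n] l by (simp add: F_def algebra_simps)
  then have "m2 = - m1 \<or> n = - l2" by auto
  then have "\<exists>\<rho>>0. \<forall>r. 0 < r \<and> r < \<rho> \<longrightarrow> displacement_defined F r \<and> displacement F r = 0"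
    using center_symmetric[of l2 m1 n] center_lotka_volterra[of l2 m1 m2] l unfolding F_def by auto
  then have "W_coeff F k = 0" using W_coeff_zero by metis
  with Wk show False by simp
qed

theorem weak_focus_order_Fc:
  assumes "p \<in> Fc"
  shows "weak_focus_order p 3"
proof -
  obtain l m1 m2 n where p: "p = (0, 0, l, l, m1, m2, n)" and nz: "(m1 + m2) * (l + n) \<noteq> 0"
    using assms unfolding Fc_def by auto
  define F where "F = pw_field (0, 0, l, l, m1, m2, n)"
  have "W_coeff F 1 = 0" "W_coeff F 2 = 0"
    using W_coeff_center_type(1,2)[of l l m1 m2 n] by (simp_all add: F_def)
  moreover have "W_coeff F 3 = - (pi / 8) * ((m1 + m2) * (l + n))"
    using W_coeff_center_type(3)[of l l m1 m2 n] by (simp add: F_def algebra_simps)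
  then have "W_coeff F 3 \<noteq> 0" using nz by simp
  moreover have "i = 1 \<or> i = 2" if "1 \<le> i \<and> i \<le> 3 - 1" for i :: nat using that by auto
  ultimately show ?thesis unfolding p weak_focus_order_def prod.case F_def[symmetric] by fastforce
qed

subsection \<open>Periodic orbits\<close>

lemma solution_on_cong:
  assumes "solution_on F \<gamma> I" "\<And>t. t \<in> I \<Longrightarrow> \<delta> t = \<gamma> t"
  shows "solution_on F \<delta> I"
  unfolding solution_on_def
proof
  fix t assume t: "t \<in> I"
  have "(\<gamma> has_vector_derivative F (\<delta> t)) (at t within I)"
    using assms t unfolding solution_on_def by simp
  then show "(\<delta> has_vector_derivative F (\<delta> t)) (at t within I)"
    by (rule has_vector_derivative_transform[rotated 2]) (use t assms(2) in simp_all)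
qed

lemma solution_on_shift:
  assumes "solution_on F \<gamma> {a..b}"
  shows "solution_on F (\<lambda>t. \<gamma> (t - c)) {a + c..b + c}"
  unfolding solution_on_def
proof
  fix t assume t: "t \<in> {a + c..b + c}"
  have im: "(\<lambda>t. t - c) ` {a + c..b + c} = {a..b}"
    by (simp add: image_diff_atLeastAtMost[symmetric] image_image)
  have "(\<gamma> has_vector_derivative F (\<gamma> (t - c))) (at (t - c) within (\<lambda>t. t - c) ` {a + c..b + c})"
    using assms t unfolding solution_on_def im by auto
  moreover have "((\<lambda>t. t - c) has_vector_derivative 1) (at t within {a + c..b + c})"
    by (rule derivative_eq_intros refl | simp)+
  ultimately show "((\<lambda>t. \<gamma> (t - c)) has_vector_derivative F (\<gamma> (t - c))) (at t within {a + c..b + c})"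
    using vector_diff_chain_within[of "\<lambda>t. t - c" 1 t "{a + c..b + c}" \<gamma> "F (\<gamma> (t - c))"]
    by (simp add: o_def)
qed

lemma solution_on_reverse:
  assumes "solution_on F \<gamma> {a..b}"
  shows "solution_on (\<lambda>p. - F p) (\<lambda>t. \<gamma> (- t)) {- b..- a}"
  unfolding solution_on_def
proof
  fix t assume t: "t \<in> {- b..- a}"
  have im: "uminus ` {- b..- a} = {a..b}" by simp
  have "(\<gamma> has_vector_derivative F (\<gamma> (- t))) (at (- t) within uminus ` {- b..- a})"
    using assms t unfolding solution_on_def im by auto
  moreover have "(uminus has_vector_derivative (- 1 :: real)) (at t within {- b..- a})"
    by (rule derivative_eq_intros refl | simp)+
  ultimately show "((\<lambda>t. \<gamma> (- t)) has_vector_derivative - F (\<gamma> (- t))) (at t within {- b..- a})"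
    using vector_diff_chain_within[of uminus "- 1" t "{- b..- a}" \<gamma> "F (\<gamma> (- t))"]
    by (simp add: o_def)
qed

lemma has_vector_derivative_Un:
  assumes "(f has_vector_derivative f') (at x within S)" "(f has_vector_derivative f') (at x within T)"
  shows "(f has_vector_derivative f') (at x within S \<union> T)"
  using assms unfolding has_vector_derivative_def has_derivative_within by (auto intro: Lim_Un)

lemma solution_on_join:
  assumes "solution_on F \<gamma> {a..b}" "solution_on F \<gamma> {b..c}" "a \<le> b" "b \<le> c"
  shows "solution_on F \<gamma> {a..c}"
  unfolding solution_on_def
proof
  fix t assume t: "t \<in> {a..c}"
  consider "t < b" | "t = b" | "t > b" by linarith
  then show "(\<gamma> has_vector_derivative F (\<gamma> t)) (at t within {a..c})"
  proof cases
    case 1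
    have "at t within {a..c} = at t within {a..b}"
      by (rule at_within_nhd[of t "{..<b}"]) (use 1 assms in auto)
    then show ?thesis using 1 t assms(1) unfolding solution_on_def by simp
  next
    case 2
    have "{a..c} = {a..b} \<union> {b..c}" using assms by auto
    moreover have "b \<in> {a..b}" "b \<in> {b..c}" using assms by auto
    ultimately show ?thesis
      using has_vector_derivative_Un[of \<gamma> "F (\<gamma> t)" t "{a..b}" "{b..c}"] assms(1,2) 2
      unfolding solution_on_def by metis
  next
    case 3
    have "at t within {a..c} = at t within {b..c}"
      by (rule at_within_nhd[of t "{b<..}"]) (use 3 assms in auto)
    then show ?thesis using 3 t assms(2) unfolding solution_on_def by simp
  qed
qed

lemma solution_on_concat:
  assumes "solution_on F \<gamma> {0..a}" "solution_on F \<delta> {0..b}" "\<gamma> a = \<delta> 0" "0 \<le> a" "0 \<le> b"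
  shows "solution_on F (\<lambda>t. if t \<le> a then \<gamma> t else \<delta> (t - a)) {0..a + b}"
proof (rule solution_on_join[of _ _ 0 a])
  show "solution_on F (\<lambda>t. if t \<le> a then \<gamma> t else \<delta> (t - a)) {0..a}"
    by (rule solution_on_cong[OF assms(1)]) simp
  have "solution_on F (\<lambda>t. \<delta> (t - a)) {a..a + b}"
    using solution_on_shift[OF assms(2), of a] by (simp add: add.commute)
  then show "solution_on F (\<lambda>t. if t \<le> a then \<gamma> t else \<delta> (t - a)) {a..a + b}"
    by (rule solution_on_cong) (use assms(3) in auto)
qed (use assms in auto)

text \<open>The time is reduced modulo T. Since \<gamma> T = \<gamma> 0, the formula on each period
  also holds at its closed right end, which lets neighbouring pieces be joined.\<close>

lemma periodic_extension:
  assumes T: "T > 0" and sol: "solution_on F \<gamma> {0..T}" and per: "\<gamma> T = \<gamma> 0"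
  shows "\<exists>\<delta>. solution_on F \<delta> UNIV \<and> (\<forall>t. \<delta> (t + T) = \<delta> t) \<and> range \<delta> = \<gamma> ` {0..T}"
proof -
  define \<delta> where "\<delta> t = \<gamma> (t - T * of_int \<lfloor>t / T\<rfloor>)" for t
  have piece: "\<delta> t = \<gamma> (t - T * of_int k)" if t: "t \<in> {T * of_int k..T * of_int (k + 1)}" for t and k :: int
  proof (cases "t = T * of_int (k + 1)")
    case True
    then have "\<lfloor>t / T\<rfloor> = k + 1" using T by simp
    then show ?thesis using True per by (simp add: \<delta>_def algebra_simps)
  next
    case False
    then have "of_int k \<le> t / T" "t / T < of_int k + 1"
      using t T by (auto simp: field_simps)
    then have "\<lfloor>t / T\<rfloor> = k" by (simp add: floor_eq_iff)
    then show ?thesis by (simp add: \<delta>_def)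
  qed
  have sol': "solution_on F \<delta> {T * of_int k..T * of_int (k + 1)}" for k :: int
  proof (rule solution_on_cong)
    show "solution_on F (\<lambda>t. \<gamma> (t - T * of_int k)) {T * of_int k..T * of_int (k + 1)}"
      using solution_on_shift[OF sol, of "T * of_int k"] by (simp add: algebra_simps)
  qed (rule piece)
  have "(\<delta> has_vector_derivative F (\<delta> t)) (at t)" for t
  proof -
    define k where "k = \<lfloor>t / T\<rfloor>"
    have k: "T * of_int k \<le> t" "t < T * of_int (k + 1)"
      using floor_divide_lower[OF T, of t] floor_divide_upper[OF T, of t]
      unfolding k_def by (simp_all add: algebra_simps)
    \<comment> \<open>Two adjacent periods are joined so that t is an interior point, even when it
      is a multiple of T.\<close>
    have "solution_on F \<delta> {T * of_int (k - 1)..T * of_int (k + 1)}"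
      using solution_on_join[OF _ sol'[of k], of "T * of_int (k - 1)"] sol'[of "k - 1"] T by simp
    moreover have "T * of_int (k - 1) < t" using k T by (simp add: algebra_simps)
    ultimately show ?thesis using k(2) solution_on_at by blast
  qed
  then have "solution_on F \<delta> UNIV" unfolding solution_on_def by simp
  moreover have "\<delta> (t + T) = \<delta> t" for t
  proof -
    have "(t + T) / T = t / T + 1" using T by (simp add: field_simps)
    then have "\<lfloor>(t + T) / T\<rfloor> = \<lfloor>t / T\<rfloor> + 1" by simp
    then show ?thesis by (simp add: \<delta>_def algebra_simps)
  qed
  moreover have "range \<delta> = \<gamma> ` {0..T}"
  proof
    show "range \<delta> \<subseteq> \<gamma> ` {0..T}"
    proof
      fix x assume "x \<in> range \<delta>"
      then obtain t where t: "x = \<delta> t" by blast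
      have "0 \<le> t - T * of_int \<lfloor>t / T\<rfloor>" "t - T * of_int \<lfloor>t / T\<rfloor> \<le> T"
        using floor_divide_lower[OF T, of t] floor_divide_upper[OF T, of t]
        by (simp_all add: algebra_simps)
      then show "x \<in> \<gamma> ` {0..T}" unfolding t \<delta>_def by auto
    qed
    show "\<gamma> ` {0..T} \<subseteq> range \<delta>"
    proof
      fix x assume "x \<in> \<gamma> ` {0..T}"
      then obtain t where t: "t \<in> {0..T}" "x = \<gamma> t" by blast
      then have "\<delta> t = x" using piece[of t 0] by simp
      then show "x \<in> range \<delta>" by blast
    qed
  qed
  ultimately show ?thesis by blast
qed

section \<open>Periodic orbits and the solution segments they meet\<close>

text \<open>The segment and a time shift of the periodic solution agree at one end. From the left
  end forward uniqueness applies directly; from the right end it applies to the reversed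
  field.\<close>

lemma periodic_orbit_absorbs_segment:
  assumes F: "bounded_lipschitz F" and C: "periodic_orbit F C" and sol: "solution_on F \<sigma> {a..b}"
    and ab: "a \<le> b" and touch: "\<sigma> a \<in> C \<or> \<sigma> b \<in> C"
  shows "\<sigma> ` {a..b} \<subseteq> C"
proof -
  obtain \<delta> where \<delta>: "solution_on F \<delta> UNIV" "C = range \<delta>"
    using C unfolding periodic_orbit_def by blast
  have \<delta>I: "solution_on F \<delta> {u..v}" for u v by (rule solution_on_subset[OF \<delta>(1)]) simp
  show ?thesis
    using touch
  proof
    assume "\<sigma> a \<in> C"
    then obtain t0 where t0: "\<sigma> a = \<delta> t0" using \<delta> by blast
    have s: "solution_on F (\<lambda>t. \<delta> (t - (a - t0))) {a..b}"
      using solution_on_shift[OF \<delta>I[of t0 "b - (a - t0)"], of "a - t0"] by simp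
    have "\<sigma> t = \<delta> (t - (a - t0))" if "t \<in> {a..b}" for t
      by (rule solution_unique[OF F sol s _ that]) (simp add: t0)
    then show ?thesis unfolding \<delta>(2) by auto
  next
    assume "\<sigma> b \<in> C"
    then obtain t0 where t0: "\<sigma> b = \<delta> t0" using \<delta> by blast
    have s: "solution_on F (\<lambda>t. \<delta> (t - (b - t0))) {a..b}"
      using solution_on_shift[OF \<delta>I[of "a - (b - t0)" t0], of "b - t0"] by simp
    have "\<sigma> (- t) = \<delta> (- t - (b - t0))" if "t \<in> {- b..- a}" for t
      by (rule solution_unique[OF bounded_lipschitz_uminus[OF F] solution_on_reverse[OF sol]
            solution_on_reverse[OF s] _ that]) (simp add: t0)
    from this[of "- _"] have "\<sigma> t = \<delta> (t - (b - t0))" if "t \<in> {a..b}" for t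
      using that by simp
    then show ?thesis unfolding \<delta>(2) by auto
  qed
qed

lemma periodic_orbit_segment:
  assumes "periodic_orbit F C" "q \<in> C"
  shows "\<exists>\<delta> T. T > 0 \<and> solution_on F \<delta> {0..T} \<and> \<delta> 0 = q \<and> \<delta> ` {0..T} = C"
proof -
  obtain \<gamma> T where \<gamma>: "T > 0" "solution_on F \<gamma> UNIV" "\<And>t. \<gamma> (t + T) = \<gamma> t" "C = range \<gamma>"
    using assms(1) unfolding periodic_orbit_def by blast
  obtain t0 where t0: "q = \<gamma> t0" using assms(2) \<gamma>(4) by blast
  define \<delta> where "\<delta> t = \<gamma> (t - (- t0))" for t
  have "solution_on F \<gamma> {t0..T + t0}" by (rule solution_on_subset[OF \<gamma>(2)]) simp
  from solution_on_shift[OF this, of "- t0"] have "solution_on F \<delta> {0..T}"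
    unfolding \<delta>_def by simp
  moreover have "\<delta> ` {0..T} = C"
  proof
    show "\<delta> ` {0..T} \<subseteq> C" unfolding \<gamma>(4) \<delta>_def by blast
    have perk: "\<gamma> (t + of_nat k * T) = \<gamma> t" for t and k :: nat
    proof (induction k)
      case (Suc k)
      then show ?case using \<gamma>(3)[of "t + of_nat k * T"] by (simp add: algebra_simps)
    qed simp
    have per: "\<gamma> (t + of_int k * T) = \<gamma> t" for t and k :: int
    proof (cases "k \<ge> 0")
      case True
      then show ?thesis using perk[of t "nat k"] by simp
    next
      case False
      then show ?thesis using perk[of "t + of_int k * T" "nat (- k)"] by simp
    qed
    show "C \<subseteq> \<delta> ` {0..T}"
    proof
      fix x assume "x \<in> C"
      then obtain t where t: "x = \<gamma> t" using \<gamma>(4) by blast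
      define k where "k = \<lfloor>(t - t0) / T\<rfloor>"
      define u where "u = t - t0 - of_int k * T"
      have "0 \<le> u" "u \<le> T"
        using floor_divide_lower[OF \<gamma>(1), of "t - t0"] floor_divide_upper[OF \<gamma>(1), of "t - t0"]
        unfolding u_def k_def by (simp_all add: algebra_simps)
      moreover have "\<delta> u = x" using per[of "u + t0" k] by (simp add: \<delta>_def u_def t)
      ultimately show "x \<in> \<delta> ` {0..T}" by force
    qed
  qed
  moreover have "\<delta> 0 = q" by (simp add: \<delta>_def t0)
  ultimately show ?thesis using \<gamma>(1) by blast
qed

lemma periodic_orbits_equal:
  assumes F: "bounded_lipschitz F" and C: "periodic_orbit F C" "periodic_orbit F C'" and q: "q \<in> C" "q \<in> C'"
  shows "C = C'"
proof -
  have "C1 \<subseteq> C2" if C1: "periodic_orbit F C1" and C2: "periodic_orbit F C2" and q: "q \<in> C1" "q \<in> C2" for C1 C2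
  proof -
    obtain \<delta> T where \<delta>: "T > 0" "solution_on F \<delta> {0..T}" "\<delta> 0 = q" "\<delta> ` {0..T} = C1"
      using periodic_orbit_segment[OF C1 q(1)] by blast
    show ?thesis
      using periodic_orbit_absorbs_segment[OF F C2 \<delta>(2)] \<delta> q by simp
  qed
  from this[OF C q] this[OF C(2,1) q(2,1)] show ?thesis by (rule equalityI)
qed

text \<open>A bounded argument along the orbit contradicts its angular speed being bounded below.\<close>

lemma rotating_orbit_meets_axis:
  assumes sol: "solution_on F \<gamma> UNIV" and c: "c > 0"
    and rot: "\<And>t. fst (\<gamma> t) * snd (F (\<gamma> t)) - snd (\<gamma> t) * fst (F (\<gamma> t)) \<ge> c * (norm (\<gamma> t))^2"
    and nz: "\<And>t. \<gamma> t \<noteq> 0"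
  shows "\<exists>t r. r > 0 \<and> \<gamma> t = (0, - r)"
proof (rule ccontr)
  assume neg: "\<not> ?thesis"
  \<comment> \<open>Multiplying x + i y by - i moves the negative y-half-axis to the branch cut of
    \<open>Ln\<close>. An orbit that misses this half-axis therefore has a differentiable argument
    for all times.\<close>
  define w where "w t = Complex (snd (\<gamma> t)) (- fst (\<gamma> t))" for t
  have w: "w t \<notin> \<real>\<^sub>\<le>\<^sub>0" for t
  proof
    assume "w t \<in> \<real>\<^sub>\<le>\<^sub>0"
    then have "fst (\<gamma> t) = 0" "snd (\<gamma> t) \<le> 0" by (auto simp: w_def complex_nonpos_Reals_iff)
    moreover from this have "snd (\<gamma> t) \<noteq> 0" using nz[of t] by (auto simp: prod_eq_iff)
    ultimately have "- snd (\<gamma> t) > 0 \<and> \<gamma> t = (0, - (- snd (\<gamma> t)))" by (auto simp: prod_eq_iff)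
    with neg show False by blast
  qed
  define g where "g t = Im (Ln (w t))" for t
  have dg: "\<exists>D. (g has_real_derivative D) (at t) \<and> D \<ge> c" for t
  proof -
    define a b a' b' where "a = fst (\<gamma> t)" and "b = snd (\<gamma> t)" and "a' = fst (F (\<gamma> t))" and "b' = snd (F (\<gamma> t))"
    have d: "(\<gamma> has_vector_derivative F (\<gamma> t)) (at t)" using sol unfolding solution_on_def by simp
    have "((\<lambda>t. snd (\<gamma> t)) has_vector_derivative b') (at t)" "((\<lambda>t. fst (\<gamma> t)) has_vector_derivative a') (at t)"
      unfolding a'_def b'_def
      using bounded_linear.has_vector_derivative[OF bounded_linear_snd d]
        bounded_linear.has_vector_derivative[OF bounded_linear_fst d] by auto
    then have dw: "(w has_vector_derivative Complex b' (- a')) (at t)"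
      unfolding w_def[abs_def] by (simp add: has_vector_derivative_complex_iff
          has_real_derivative_iff_has_vector_derivative has_vector_derivative_minus)
    have "((Ln \<circ> w) has_vector_derivative Complex b' (- a') * inverse (w t)) (at t)"
      by (rule field_vector_diff_chain_at[OF dw has_field_derivative_Ln[OF w]])
    from bounded_linear.has_vector_derivative[OF bounded_linear_Im this]
    have "(g has_real_derivative Im (Complex b' (- a') * inverse (w t))) (at t)"
      unfolding g_def[abs_def] has_real_derivative_iff_has_vector_derivative by simp
    moreover have "Im (Complex b' (- a') * inverse (w t)) = (a * b' - b * a') / (a^2 + b^2)"
      by (simp add: w_def a_def b_def add_divide_distrib diff_divide_distrib add.commute mult.commute)
    moreover have "(a * b' - b * a') / (a^2 + b^2) \<ge> c"
    proof -
      have n: "(norm (\<gamma> t))^2 = a^2 + b^2" by (simp add: norm_prod_def a_def b_def)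
      have "a^2 + b^2 > 0" using nz[of t] n by (metis zero_less_norm_iff zero_less_power)
      then show ?thesis using rot[of t] unfolding n a_def[symmetric] b_def[symmetric] a'_def[symmetric] b'_def[symmetric]
        by (simp add: pos_le_divide_eq)
    qed
    ultimately show ?thesis by metis
  qed
  \<comment> \<open>In time 8 / c the argument would grow by at least 8 > 2 pi, although it stays in
    (- pi, pi].\<close>
  have "g (8 / c) - c * (8 / c) \<ge> g 0 - c * 0"
  proof (rule DERIV_nonneg_imp_nondecreasing[of 0 "8 / c" "\<lambda>t. g t - c * t"])
    show "0 \<le> 8 / c" using c by simp
    fix t
    obtain D where D: "(g has_real_derivative D) (at t)" "D \<ge> c" using dg by blast
    have "((\<lambda>t. g t - c * t) has_real_derivative D - c * 1) (at t)"
      by (intro DERIV_diff D DERIV_cmult DERIV_ident)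
    then show "\<exists>y. ((\<lambda>t. g t - c * t) has_real_derivative y) (at t) \<and> 0 \<le> y" using D(2) by auto
  qed
  then have "g (8 / c) \<ge> g 0 + 8" using c by simp
  moreover have "w t \<noteq> 0" for t using w[of t] by auto
  then have "g (8 / c) \<le> pi" "g 0 > - pi" unfolding g_def by (auto intro: Im_Ln_le_pi mpi_less_Im_Ln)
  ultimately show False using pi_less_4 by linarith
qed


text \<open>A point in the right half plane has polar angle \<open>arccos (- y / norm p)\<close>, counted from the
  negative y-axis; by mirror symmetry the same formula serves the left half plane.\<close>

lemma inside_radial_curve:
  fixes \<rho>1 \<rho>2 :: "real \<Rightarrow> real"
  assumes c: "continuous_on {0..pi} \<rho>1" "continuous_on {0..pi} \<rho>2"
    and pos: "\<And>\<theta>. \<theta> \<in> {0..pi} \<Longrightarrow> \<rho>1 \<theta> > 0" "\<And>\<theta>. \<theta> \<in> {0..pi} \<Longrightarrow> \<rho>2 \<theta> > 0"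
    and ends: "\<rho>1 0 = \<rho>2 0" "\<rho>1 pi = \<rho>2 pi"
  defines "C \<equiv> (\<lambda>\<theta>. (\<rho>1 \<theta> * sin \<theta>, - \<rho>1 \<theta> * cos \<theta>)) ` {0..pi} \<union>
    mirror_pt ` (\<lambda>\<theta>. (\<rho>2 \<theta> * sin \<theta>, - \<rho>2 \<theta> * cos \<theta>)) ` {0..pi}"
  shows "(0, 0) \<in> inside C"
proof -
  define ang where "ang p = arccos (- snd p / norm p)" for p :: "real \<times> real"
  \<comment> \<open>The distance of the curve from the origin in the direction of p. On the axis
    both branches agree because the angle is 0 or pi there, where the two radii coincide.\<close>
  define h where "h p = (if fst p \<ge> 0 then \<rho>1 (ang p) else \<rho>2 (ang p))" for p
  let ?U = "- {0 :: real \<times> real}"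
  have ratio: "\<bar>- snd p / norm p\<bar> \<le> 1" for p :: "real \<times> real"
    using norm_snd_le[of "snd p" "fst p"] by (cases "p = 0") (auto simp: divide_le_eq_1)
  then have ratio': "-1 \<le> - snd p / norm p" "- snd p / norm p \<le> 1" for p :: "real \<times> real"
    by (simp_all only: abs_le_iff minus_le_iff)
  have ang: "ang p \<in> {0..pi}" for p
    unfolding ang_def using arccos_bounded[OF ratio'] by simp
  have ang_cont: "continuous_on ?U ang"
    unfolding ang_def[abs_def]
    by (rule continuous_on_compose2[OF continuous_on_arccos', of ?U "\<lambda>p. - snd p / norm p"])
      (use ratio' in \<open>auto intro!: continuous_intros\<close>)
  have h_cont: "continuous_on ?U h"
  proof -
    have "continuous_on ({p \<in> ?U. 0 \<le> fst p} \<union> {p \<in> ?U. fst p \<le> 0}) h"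
      unfolding h_def[abs_def]
    proof (rule continuous_on_cases_local)
      show "closedin (top_of_set ({p \<in> ?U. 0 \<le> fst p} \<union> {p \<in> ?U. fst p \<le> 0})) {p \<in> ?U. 0 \<le> fst p}"
        "closedin (top_of_set ({p \<in> ?U. 0 \<le> fst p} \<union> {p \<in> ?U. fst p \<le> 0})) {p \<in> ?U. fst p \<le> 0}"
        unfolding closedin_closed
        by (intro exI[of _ "{p. 0 \<le> fst p}"] conjI closed_Collect_le continuous_intros; auto)
          (intro exI[of _ "{p. fst p \<le> 0}"] conjI closed_Collect_le continuous_intros; auto)
      show "continuous_on {p \<in> ?U. 0 \<le> fst p} (\<lambda>p. \<rho>1 (ang p))"
        by (rule continuous_on_compose2[OF c(1) continuous_on_subset[OF ang_cont]]) (use ang in auto)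
      show "continuous_on {p \<in> ?U. fst p \<le> 0} (\<lambda>p. \<rho>2 (ang p))"
        by (rule continuous_on_compose2[OF c(2) continuous_on_subset[OF ang_cont]]) (use ang in auto)
      fix p assume "p \<in> {p \<in> ?U. 0 \<le> fst p} \<and> \<not> 0 \<le> fst p \<or> p \<in> {p \<in> ?U. fst p \<le> 0} \<and> 0 \<le> fst p"
      then have p: "fst p = 0" "snd p \<noteq> 0" by (auto simp: prod_eq_iff)
      then have "norm p = \<bar>snd p\<bar>" by (simp add: norm_prod_def)
      then have "- snd p / norm p = 1 \<or> - snd p / norm p = - 1" using p by (auto simp: abs_if)
      then have "ang p = 0 \<or> ang p = pi" unfolding ang_def using arccos_1 arccos_minus_1 by metis
      then show "\<rho>1 (ang p) = \<rho>2 (ang p)" using ends by auto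
    qed
    moreover have "{p \<in> ?U. 0 \<le> fst p} \<union> {p \<in> ?U. fst p \<le> 0} = ?U" by auto
    ultimately show ?thesis by simp
  qed
  have h_pos: "h p > 0" for p using pos ang by (simp add: h_def)
  have angle_eq: "ang (x, - r * cos \<theta>) = \<theta>" if "norm (x, - r * cos \<theta>) = r" "r > 0" "\<theta> \<in> {0..pi}" for x r \<theta>
    using that arccos_cos[of \<theta>] by (simp add: ang_def)
  have C_eq: "C = {p. p \<noteq> 0 \<and> norm p = h p}"
  proof
    show "C \<subseteq> {p. p \<noteq> 0 \<and> norm p = h p}"
    proof
      fix p assume "p \<in> C"
      then consider \<theta> where "\<theta> \<in> {0..pi}" "p = (\<rho>1 \<theta> * sin \<theta>, - \<rho>1 \<theta> * cos \<theta>)"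
        | \<theta> where "\<theta> \<in> {0..pi}" "p = (- (\<rho>2 \<theta> * sin \<theta>), - \<rho>2 \<theta> * cos \<theta>)"
        unfolding C_def mirror_pt_def by auto
      then show "p \<in> {p. p \<noteq> 0 \<and> norm p = h p}"
      proof cases
        case 1
        have np: "norm p = \<rho>1 \<theta>" using polar_norm[of "\<rho>1 \<theta>" \<theta>] pos(1)[OF 1(1)] 1(2) by simp
        then have "ang p = \<theta>" using angle_eq[of "\<rho>1 \<theta> * sin \<theta>" "\<rho>1 \<theta>" \<theta>] 1 pos(1)[OF 1(1)] by simp
        moreover have "fst p \<ge> 0" using 1 pos(1)[OF 1(1)] sin_ge_zero[of \<theta>] by simp
        ultimately show ?thesis using np pos(1)[OF 1(1)] by (auto simp: h_def)
      next
        case 2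
        have np: "norm p = \<rho>2 \<theta>" using polar_norm[of "\<rho>2 \<theta>" \<theta>] pos(2)[OF 2(1)] 2(2) by (simp add: norm_Pair)
        then have a: "ang p = \<theta>" using angle_eq[of "- (\<rho>2 \<theta> * sin \<theta>)" "\<rho>2 \<theta>" \<theta>] 2 pos(2)[OF 2(1)] by simp
        have "h p = \<rho>2 \<theta>"
        proof (cases "fst p \<ge> 0")
          case True
          then have "sin \<theta> = 0"
            using 2 pos(2)[OF 2(1)] sin_ge_zero[of \<theta>] by (simp add: mult_le_0_iff)
          then have "\<theta> = 0 \<or> \<theta> = pi" using 2(1) sin_gt_zero[of \<theta>] by force
          then show ?thesis using a ends by (auto simp: h_def)
        qed (simp add: h_def a)
        then show ?thesis using np pos(2)[OF 2(1)] by auto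
      qed
    qed
    show "{p. p \<noteq> 0 \<and> norm p = h p} \<subseteq> C"
    proof
      fix p assume "p \<in> {p. p \<noteq> 0 \<and> norm p = h p}"
      then have p: "p \<noteq> 0" "norm p = h p" by auto
      define \<theta> where "\<theta> = ang p"
      have \<theta>: "\<theta> \<in> {0..pi}" unfolding \<theta>_def by (rule ang)
      have c\<theta>: "cos \<theta> = - snd p / norm p" unfolding \<theta>_def ang_def by (rule cos_arccos[OF ratio'])
      then have sp: "snd p = - norm p * cos \<theta>" using p(1) by simp
      have "(fst p)^2 + (snd p)^2 = (norm p)^2" by (simp add: norm_prod_def)
      then have "(fst p)^2 = (norm p * sin \<theta>)^2"
        unfolding sp by (simp add: power_mult_distrib sin_squared_eq algebra_simps)
      then have fp: "\<bar>fst p\<bar> = norm p * sin \<theta>"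
        using ang[of p] sin_ge_zero[of \<theta>] by (metis \<theta>_def abs_of_nonneg atLeastAtMost_iff mult_nonneg_nonneg norm_ge_zero power2_eq_iff_nonneg abs_ge_zero power2_abs)
      show "p \<in> C"
      proof (cases "fst p \<ge> 0")
        case True
        then have "p = (\<rho>1 \<theta> * sin \<theta>, - \<rho>1 \<theta> * cos \<theta>)"
          using fp sp p(2) by (simp add: h_def \<theta>_def[symmetric] prod_eq_iff)
        then show ?thesis unfolding C_def by (intro UnI1 image_eqI[OF _ \<theta>])
      next
        case False
        then have "p = mirror_pt (\<rho>2 \<theta> * sin \<theta>, - \<rho>2 \<theta> * cos \<theta>)"
          using fp sp p(2) by (simp add: h_def \<theta>_def[symmetric] prod_eq_iff mirror_pt_def)
        then show ?thesis unfolding C_def by (intro UnI2 image_eqI[OF _ image_eqI[OF refl \<theta>]])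
      qed
    qed
  qed
  have "compact ((\<lambda>\<theta>. \<rho>1 \<theta>) ` {0..pi} \<union> \<rho>2 ` {0..pi})"
    by (intro compact_Un compact_continuous_image c) simp_all
  from compact_imp_bounded[OF this]
  obtain B where B0: "\<forall>x\<in>\<rho>1 ` {0..pi} \<union> \<rho>2 ` {0..pi}. norm x \<le> B"
    unfolding bounded_iff by (elim exE)
  have B: "\<rho>1 \<theta> \<le> B \<and> \<rho>2 \<theta> \<le> B" if "\<theta> \<in> {0..pi}" for \<theta>
    using bspec[OF B0, of "\<rho>1 \<theta>"] bspec[OF B0, of "\<rho>2 \<theta>"] that by auto
  have hB: "h p \<le> B" for p using B[OF ang[of p]] by (simp add: h_def)
  \<comment> \<open>The complement of the curve splits into the points nearer to the origin than
    \<open>h\<close> and those farther away. Once both sets are open, the component of 0 lies in the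
    bounded one.\<close>
  define Ain where "Ain = {p. p \<in> ?U \<and> norm p - h p < 0} \<union> {0}"
  define Aout where "Aout = {p. p \<in> ?U \<and> norm p - h p > 0}"
  have opU: "open ?U" by (rule open_Compl[OF closed_singleton])
  have dc: "continuous_on ?U (\<lambda>p. norm p - h p)" by (intro continuous_intros h_cont)
  have o1: "open {p. p \<in> ?U \<and> norm p - h p < 0}"
    using continuous_open_preimage[OF dc opU open_lessThan[of 0]] by (simp add: vimage_def Int_def)
  have o2: "open Aout"
    using continuous_open_preimage[OF dc opU open_greaterThan[of 0]] by (simp add: vimage_def Int_def Aout_def)
  \<comment> \<open>The angle is not continuous at the origin, so openness of \<open>Ain\<close> at
    that point needs a separate argument: a whole ball whose radius is a positive lower bound of
    \<open>h\<close>.\<close>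
  obtain m where m: "m > 0" "\<And>p. h p \<ge> m"
  proof -
    obtain a where a: "a \<in> {0..pi}" "\<And>\<theta>. \<theta> \<in> {0..pi} \<Longrightarrow> \<rho>1 a \<le> \<rho>1 \<theta>"
      using continuous_attains_inf[OF _ _ c(1)] by fastforce
    obtain b where b: "b \<in> {0..pi}" "\<And>\<theta>. \<theta> \<in> {0..pi} \<Longrightarrow> \<rho>2 b \<le> \<rho>2 \<theta>"
      using continuous_attains_inf[OF _ _ c(2)] by fastforce
    show ?thesis
    proof (rule that[of "min (\<rho>1 a) (\<rho>2 b)"])
      show "0 < min (\<rho>1 a) (\<rho>2 b)" using pos a b by simp
      show "min (\<rho>1 a) (\<rho>2 b) \<le> h p" for p
        using a(2)[OF ang[of p]] b(2)[OF ang[of p]] by (auto simp: h_def)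
    qed
  qed
  have "Ain = {p. p \<in> ?U \<and> norm p - h p < 0} \<union> ball 0 m"
  proof -
    have "p \<in> {p. p \<in> ?U \<and> norm p - h p < 0} \<union> {0}" if "p \<in> ball 0 m" for p
      using that m(2)[of p] by auto
    moreover have "0 \<in> ball (0 :: real \<times> real) m" using m(1) by simp
    ultimately show ?thesis unfolding Ain_def by blast
  qed
  then have o1': "open Ain" using o1 by (simp add: open_Un)
  have zero: "(0::real \<times> real) \<notin> C" unfolding C_eq by simp
  let ?K = "connected_component_set (- C) 0"
  have "?K \<subseteq> - C" by (rule connected_component_subset)
  also have "- C = Ain \<union> Aout" unfolding C_eq Ain_def Aout_def by auto
  finally have K: "?K \<subseteq> Ain \<union> Aout" .
  have "Ain \<inter> Aout = {}" unfolding Ain_def Aout_def by auto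
  moreover have "0 \<in> Ain \<inter> ?K" using zero by (simp add: Ain_def)
  ultimately have "Aout \<inter> ?K = {}"
    using connectedD[OF connected_connected_component[of "- C" 0] o1' o2] K by blast
  then have "?K \<subseteq> Ain" using K by blast
  also have "Ain \<subseteq> cball 0 \<bar>B\<bar>"
  proof
    fix p assume "p \<in> Ain"
    then have "norm p \<le> \<bar>B\<bar>" using hB[of p] by (auto simp: Ain_def)
    then show "p \<in> cball 0 \<bar>B\<bar>" by simp
  qed
  finally have "bounded ?K" using bounded_subset bounded_cball by blast
  then show ?thesis using zero unfolding inside_def zero_prod_def by simp
qed

subsection \<open>Limit cycles from isolated zeros of the displacement map\<close>

lemma half_orbit_bounds:
  assumes "half_orbit F r s \<rho> T \<gamma>"
  shows "r / 2 \<le> s" "s \<le> 3 / 2 * r"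
proof -
  have "\<rho> pi = s" and "\<forall>\<theta>\<in>{0..pi}. r / 2 \<le> \<rho> \<theta> \<and> \<rho> \<theta> \<le> 3 / 2 * r"
    using assms unfolding half_orbit_def by blast+
  then show "r / 2 \<le> s" "s \<le> 3 / 2 * r" using pi_ge_zero by force+
qed

lemma half_orbit_mirror_segment:
  assumes "half_orbit (mirror_field F) r s \<rho> T \<gamma>"
  shows "solution_on F (\<lambda>t. mirror_pt (\<gamma> (T - t))) {0..T}"
    and "(\<lambda>t. mirror_pt (\<gamma> (T - t))) ` {0..T} = mirror_pt ` \<gamma> ` {0..T}"
proof -
  have "solution_on (mirror_field F) \<gamma> {0..T}" using assms unfolding half_orbit_def by blast
  from solution_on_mirror[OF this]
  show "solution_on F (\<lambda>t. mirror_pt (\<gamma> (T - t))) {0..T}" by (simp only: mirror_field_mirror_field)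
  have "(\<lambda>t. T - t) ` {0..T} = {0..T}" by (auto simp: image_iff intro!: bexI[of _ "T - _"])
  then show "(\<lambda>t. mirror_pt (\<gamma> (T - t))) ` {0..T} = mirror_pt ` \<gamma> ` {0..T}"
    by (metis (no_types, lifting) image_cong image_image)
qed

text \<open>A half orbit lies entirely in C as soon as one of its endpoints does. This transports
  points of C between the two half-axes in either direction.\<close>

lemma periodic_orbit_half_orbit:
  assumes F: "bounded_lipschitz F" and C: "periodic_orbit F C" and O: "half_orbit F r s \<rho> T \<gamma>"
  shows "(0, - r) \<in> C \<longleftrightarrow> (0, s) \<in> C"
proof -
  have T: "T > 0" "solution_on F \<gamma> {0..T}" "\<gamma> 0 = (0, - r)" "\<gamma> T = (0, s)"
    using O unfolding half_orbit_def by blast+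
  then have ends: "0 \<in> {0..T}" "T \<in> {0..T}" by auto
  have "\<gamma> ` {0..T} \<subseteq> C" if "(0, - r) \<in> C \<or> (0, s) \<in> C"
    by (rule periodic_orbit_absorbs_segment[OF F C T(2)]) (use T that in auto)
  then show ?thesis using ends T(3,4) by (metis image_subset_iff)
qed

lemma periodic_orbit_mirror_half_orbit:
  assumes F: "bounded_lipschitz F" and C: "periodic_orbit F C"
    and O: "half_orbit (mirror_field F) r s \<rho> T \<gamma>"
  shows "(0, - r) \<in> C \<longleftrightarrow> (0, s) \<in> C"
proof -
  have T: "T > 0" "\<gamma> 0 = (0, - r)" "\<gamma> T = (0, s)"
    using O unfolding half_orbit_def by blast+
  then have ends: "0 \<in> {0..T}" "T \<in> {0..T}" by auto
  let ?\<sigma> = "\<lambda>t. mirror_pt (\<gamma> (T - t))"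
  have e: "?\<sigma> 0 = (0, s)" "?\<sigma> T = (0, - r)" using T by (simp_all add: mirror_pt_def)
  have "?\<sigma> ` {0..T} \<subseteq> C" if "(0, - r) \<in> C \<or> (0, s) \<in> C"
    by (rule periodic_orbit_absorbs_segment[OF F C half_orbit_mirror_segment(1)[OF O]]) (use T e that in auto)
  then show ?thesis using ends e by (metis image_subset_iff)
qed

lemma periodic_orbit_compact:
  assumes "periodic_orbit F C"
  shows "compact C"
proof -
  obtain q where q: "q \<in> C" using assms unfolding periodic_orbit_def by blast
  obtain \<delta> T where "solution_on F \<delta> {0..T}" "\<delta> ` {0..T} = C"
    using periodic_orbit_segment[OF assms q] by blast
  then show ?thesis using compact_continuous_image[OF solution_on_continuous] by blast
qed

section \<open>From zeros of the displacement map to isolated cycles\<close>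

context
  fixes F :: vfield and \<Phi>1 \<Phi>2 :: "real \<Rightarrow> real" and e :: real
  assumes lip: "bounded_lipschitz F"
    and orb1: "\<And>r. 0 < r \<Longrightarrow> r < e \<Longrightarrow> \<exists>\<rho> T \<gamma>. half_orbit F r (\<Phi>1 r) \<rho> T \<gamma>"
    and orb2: "\<And>r. 0 < r \<Longrightarrow> r < e \<Longrightarrow> \<exists>\<rho> T \<gamma>. half_orbit (mirror_field F) r (\<Phi>2 r) \<rho> T \<gamma>"
    and cont: "continuous_on {0<..<e} \<Phi>1" "continuous_on {0<..<e} \<Phi>2"
    and rot: "\<And>p. norm p < e \<Longrightarrow> fst p * snd (F p) - snd p * fst (F p) \<ge> 1/2 * (norm p)^2"
begin

lemma half_map_bounds:
  assumes "0 < r" "r < e"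
  shows "r / 2 \<le> \<Phi>1 r" "\<Phi>1 r \<le> 3 / 2 * r" "r / 2 \<le> \<Phi>2 r" "\<Phi>2 r \<le> 3 / 2 * r"
  using orb1[OF assms] orb2[OF assms] half_orbit_bounds by blast+

text \<open>Intermediate values between r and 3 r: at 3 r the map is already at least 3 r / 2. The
  preimage found lies strictly beyond r, which takes the place of monotonicity.\<close>

lemma half_map_surj:
  assumes r: "0 < r" "4 * r < e" and \<Phi>: "\<Phi> = \<Phi>1 \<or> \<Phi> = \<Phi>2" and s: "\<Phi> r < s" "s \<le> 3 / 2 * r"
  shows "\<exists>r'. r < r' \<and> r' < e \<and> \<Phi> r' = s"
proof -
  have "continuous_on {r..3 * r} \<Phi>"
    using \<Phi> cont r by (auto elim!: continuous_on_subset)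
  moreover have "3 * r / 2 \<le> \<Phi> (3 * r)" using half_map_bounds[of "3 * r"] \<Phi> r by auto
  ultimately obtain r' where "r \<le> r'" "r' \<le> 3 * r" "\<Phi> r' = s"
    using IVT'[of \<Phi> r s "3 * r"] s r by auto
  moreover from this have "r \<noteq> r'" using s by auto
  ultimately show ?thesis using r by (intro exI[of _ r']) auto
qed

text \<open>Rotation makes C meet the negative half-axis; let (0, - r) be its farthest point there.
  Both half orbits from this point end on C. If their endpoints differed, the farther one would also
  be the endpoint of a half orbit of the other kind starting at some r' > r, and (0, - r') would lie
  on C, against the choice of r. Nothing is presupposed about the number of crossings of C.\<close>

lemma periodic_orbit_on_axis:
  assumes C: "periodic_orbit F C" and sub: "C \<subseteq> ball 0 e - {0}" and small: "\<And>y. (0, y) \<in> C \<Longrightarrow> 4 * \<bar>y\<bar> < e"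
  shows "\<exists>r. 0 < r \<and> r < e \<and> (0, - r) \<in> C \<and> \<Phi>1 r = \<Phi>2 r"
proof -
  obtain \<gamma> where \<gamma>: "solution_on F \<gamma> UNIV" "C = range \<gamma>" using C unfolding periodic_orbit_def by blast
  have in': "norm (\<gamma> t) < e" "\<gamma> t \<noteq> 0" for t
  proof -
    have "\<gamma> t \<in> ball 0 e - {0}" using sub \<gamma>(2) by blast
    then show "norm (\<gamma> t) < e" "\<gamma> t \<noteq> 0" by simp_all
  qed
  obtain t r1 where r1: "r1 > 0" "\<gamma> t = (0, - r1)"
    using rotating_orbit_meets_axis[OF \<gamma>(1), of "1/2"] rot in' by auto
  \<comment> \<open>The condition is \<open>y \<le> 0\<close> rather than a strict inequality so
    that the set is closed. The origin is not on C, so the minimum is still negative.\<close>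
  define Z where "Z = {y. (0, y) \<in> C \<and> y \<le> 0}"
  have "Z = (\<lambda>y. (0, y)) -` C \<inter> {..0}" by (auto simp: Z_def)
  moreover have "closed ((\<lambda>y::real. (0::real, y)) -` C)"
    by (rule closed_vimage) (auto intro!: compact_imp_closed periodic_orbit_compact[OF C] continuous_intros)
  ultimately have "closed Z" by auto
  moreover have "bounded Z"
    unfolding bounded_iff using small by (intro exI[of _ "e"]) (force simp: Z_def)
  ultimately have "compact Z" by (simp add: compact_eq_bounded_closed)
  moreover have "- r1 \<in> Z" using r1 \<gamma>(2) unfolding Z_def by (metis (mono_tags, lifting) less_imp_le mem_Collect_eq neg_le_0_iff_le rangeI)
  ultimately obtain y where y: "y \<in> Z" "\<And>y'. y' \<in> Z \<Longrightarrow> y \<le> y'"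
    using compact_attains_inf[of Z] by blast
  define r where "r = - y"
  have r: "0 < r" "(0, - r) \<in> C" "4 * r < e"
    using y(1) y(2)[OF \<open>- r1 \<in> Z\<close>] r1(1) small[of y] unfolding Z_def r_def by auto
  have re: "r < e" using r by simp
  have max: "r' \<le> r" if "(0, - r') \<in> C" "0 < r'" for r'
    using y(2)[of "- r'"] that unfolding Z_def r_def by auto
  obtain \<rho>1 T1 \<gamma>1 where o1: "half_orbit F r (\<Phi>1 r) \<rho>1 T1 \<gamma>1" using orb1[OF r(1) re] by blast
  obtain \<rho>2 T2 \<gamma>2 where o2: "half_orbit (mirror_field F) r (\<Phi>2 r) \<rho>2 T2 \<gamma>2" using orb2[OF r(1) re] by blast
  have in1: "(0, \<Phi>1 r) \<in> C" using periodic_orbit_half_orbit[OF lip C o1] r(2) by simp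
  have in2: "(0, \<Phi>2 r) \<in> C" using periodic_orbit_mirror_half_orbit[OF lip C o2] r(2) by simp
  have "\<not> \<Phi>1 r < \<Phi>2 r"
  proof
    assume "\<Phi>1 r < \<Phi>2 r"
    then obtain r' where r': "r < r'" "r' < e" "\<Phi>1 r' = \<Phi>2 r"
      using half_map_surj[of r \<Phi>1 "\<Phi>2 r"] half_map_bounds[OF r(1) re] r by auto
    obtain \<rho> T \<gamma> where "half_orbit F r' (\<Phi>1 r') \<rho> T \<gamma>" using orb1[of r'] r r' by auto
    then have "(0, - r') \<in> C" using periodic_orbit_half_orbit[OF lip C] in2 r'(3) by metis
    then show False using max[of r'] r r' by simp
  qed
  moreover have "\<not> \<Phi>2 r < \<Phi>1 r"
  proof
    assume "\<Phi>2 r < \<Phi>1 r"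
    then obtain r' where r': "r < r'" "r' < e" "\<Phi>2 r' = \<Phi>1 r"
      using half_map_surj[of r \<Phi>2 "\<Phi>1 r"] half_map_bounds[OF r(1) re] r by auto
    obtain \<rho> T \<gamma> where "half_orbit (mirror_field F) r' (\<Phi>2 r') \<rho> T \<gamma>" using orb2[of r'] r r' by auto
    then have "(0, - r') \<in> C" using periodic_orbit_mirror_half_orbit[OF lip C] in1 r'(3) by metis
    then show False using max[of r'] r r' by simp
  qed
  ultimately show ?thesis using r re by (intro exI[of _ r]) auto
qed

text \<open>The two half orbits from (0, - r0) close up to a periodic orbit. Any other periodic
  orbit in a suitable neighbourhood meets the negative half-axis at a zero of the displacement map
  close to r0, hence at r0 itself, and two periodic orbits with a common point coincide.\<close>

theorem isolated_cycle_of_isolated_zero: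
  assumes r0: "0 < r0" "8 * r0 < e" and zero: "\<Phi>1 r0 = \<Phi>2 r0"
    and \<delta>: "\<delta> > 0" and iso: "\<And>r. \<bar>r - r0\<bar> < \<delta> \<Longrightarrow> \<Phi>1 r = \<Phi>2 r \<Longrightarrow> r = r0"
  shows "\<exists>C. isolated_periodic_orbit F C \<and> C \<subseteq> cball 0 (3/2 * r0) \<and> (0, 0) \<in> inside C \<and>
    (\<forall>y\<le>0. (0, y) \<in> C \<longleftrightarrow> y = - r0) \<and> (\<forall>p\<in>C. p \<noteq> 0)"
proof -
  have r0e: "r0 < e" using r0 by simp
  obtain \<rho>1 T1 \<gamma>1 where o1: "half_orbit F r0 (\<Phi>1 r0) \<rho>1 T1 \<gamma>1" using orb1[OF r0(1) r0e] by blast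
  obtain \<rho>2 T2 \<gamma>2 where o2: "half_orbit (mirror_field F) r0 (\<Phi>1 r0) \<rho>2 T2 \<gamma>2"
    using orb2[OF r0(1) r0e] zero by auto
  have T1: "T1 > 0" "\<gamma>1 0 = (0, - r0)" "\<gamma>1 T1 = (0, \<Phi>1 r0)" "solution_on F \<gamma>1 {0..T1}"
    and \<rho>1: "continuous_on {0..pi} \<rho>1" "\<rho>1 0 = r0" "\<rho>1 pi = \<Phi>1 r0"
      "\<forall>\<theta>\<in>{0..pi}. r0 / 2 \<le> \<rho>1 \<theta> \<and> \<rho>1 \<theta> \<le> 3 / 2 * r0"
      "\<gamma>1 ` {0..T1} = (\<lambda>\<theta>. (\<rho>1 \<theta> * sin \<theta>, - \<rho>1 \<theta> * cos \<theta>)) ` {0..pi}"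
    using o1 unfolding half_orbit_def by blast+
  have T2: "T2 > 0" "\<gamma>2 0 = (0, - r0)" "\<gamma>2 T2 = (0, \<Phi>1 r0)"
    and \<rho>2: "continuous_on {0..pi} \<rho>2" "\<rho>2 0 = r0" "\<rho>2 pi = \<Phi>1 r0"
      "\<forall>\<theta>\<in>{0..pi}. r0 / 2 \<le> \<rho>2 \<theta> \<and> \<rho>2 \<theta> \<le> 3 / 2 * r0"
      "\<gamma>2 ` {0..T2} = (\<lambda>\<theta>. (\<rho>2 \<theta> * sin \<theta>, - \<rho>2 \<theta> * cos \<theta>)) ` {0..pi}"
    using o2 unfolding half_orbit_def by blast+
  define \<sigma> where "\<sigma> t = mirror_pt (\<gamma>2 (T2 - t))" for t
  have \<sigma>: "solution_on F \<sigma> {0..T2}" "\<sigma> ` {0..T2} = mirror_pt ` \<gamma>2 ` {0..T2}"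
    using half_orbit_mirror_segment[OF o2] unfolding \<sigma>_def by auto
  have \<sigma>e: "\<sigma> 0 = (0, \<Phi>1 r0)" "\<sigma> T2 = (0, - r0)" using T2 by (simp_all add: \<sigma>_def mirror_pt_def)
  define \<tau> where "\<tau> t = (if t \<le> T1 then \<gamma>1 t else \<sigma> (t - T1))" for t
  have \<tau>1: "solution_on F \<tau> {0..T1 + T2}"
    unfolding \<tau>_def by (rule solution_on_concat[OF T1(4) \<sigma>(1)]) (use T1 T2 \<sigma>e in auto)
  have \<tau>2: "\<tau> (T1 + T2) = \<tau> 0" using T1 T2 \<sigma>e by (simp add: \<tau>_def)
  have T12: "T1 + T2 > 0" using T1(1) T2(1) by simp
  obtain \<delta>' where \<delta>': "solution_on F \<delta>' UNIV" "\<forall>t. \<delta>' (t + (T1 + T2)) = \<delta>' t"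
    "range \<delta>' = \<tau> ` {0..T1 + T2}"
    using periodic_extension[OF T12 \<tau>1 \<tau>2] by (elim exE conjE)
  define C where "C = range \<delta>'"
  have C_union: "C = \<gamma>1 ` {0..T1} \<union> mirror_pt ` \<gamma>2 ` {0..T2}"
  proof -
    have "{0..T1 + T2} = {0..T1} \<union> {T1..T1 + T2}" using T1 T2 by auto
    then have "C = \<tau> ` {0..T1} \<union> \<tau> ` {T1..T1 + T2}" unfolding C_def \<delta>'(3) by auto
    moreover have "\<tau> ` {0..T1} = \<gamma>1 ` {0..T1}" by (rule image_cong) (auto simp: \<tau>_def)
    moreover have "\<tau> ` {T1..T1 + T2} = (\<lambda>t. \<sigma> (t - T1)) ` {T1..T1 + T2}"
      by (rule image_cong) (use T1 \<sigma>e in \<open>auto simp: \<tau>_def\<close>)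
    moreover have "(\<lambda>t. \<sigma> (t - T1)) ` {T1..T1 + T2} = \<sigma> ` (\<lambda>t. t - T1) ` {T1..T1 + T2}"
      by (simp only: image_image)
    moreover have "(\<lambda>t. t - T1) ` {T1..T1 + T2} = {0..T2}"
      by (simp add: image_diff_atLeastAtMost)
    ultimately show ?thesis using \<sigma>(2) by simp
  qed
  have C_polar: "C = (\<lambda>\<theta>. (\<rho>1 \<theta> * sin \<theta>, - \<rho>1 \<theta> * cos \<theta>)) ` {0..pi} \<union>
    mirror_pt ` (\<lambda>\<theta>. (\<rho>2 \<theta> * sin \<theta>, - \<rho>2 \<theta> * cos \<theta>)) ` {0..pi}"
    unfolding C_union \<rho>1(5) \<rho>2(5) ..
  have \<rho>pos: "\<rho>1 \<theta> > 0" "\<rho>2 \<theta> > 0" if "\<theta> \<in> {0..pi}" for \<theta>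
    using bspec[OF \<rho>1(4) that] bspec[OF \<rho>2(4) that] r0(1) by linarith+
  have ins: "(0, 0) \<in> inside C"
    unfolding C_polar
    by (rule inside_radial_curve[OF \<rho>1(1) \<rho>2(1) \<rho>pos]) (simp_all only: \<rho>1(2,3) \<rho>2(2,3))
  have C_pts: "r0 / 2 \<le> norm p \<and> norm p \<le> 3/2 * r0 \<and> (fst p = 0 \<longrightarrow> p = (0, - r0) \<or> snd p > 0)"
    if "p \<in> C" for p
  proof -
    obtain \<theta> \<rho> where \<theta>: "\<theta> \<in> {0..pi}" "\<rho> = \<rho>1 \<theta> \<or> \<rho> = \<rho>2 \<theta>"
      "p = (\<rho> * sin \<theta>, - \<rho> * cos \<theta>) \<or> p = (- (\<rho> * sin \<theta>), - \<rho> * cos \<theta>)"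
    proof -
      from \<open>p \<in> C\<close> consider \<theta> where "\<theta> \<in> {0..pi}" "p = (\<rho>1 \<theta> * sin \<theta>, - \<rho>1 \<theta> * cos \<theta>)"
        | \<theta> where "\<theta> \<in> {0..pi}" "p = (- (\<rho>2 \<theta> * sin \<theta>), - \<rho>2 \<theta> * cos \<theta>)"
        unfolding C_polar mirror_pt_def by auto
      then show thesis using that by cases blast+
    qed
    have \<rho>: "r0 / 2 \<le> \<rho>" "\<rho> \<le> 3 / 2 * r0"
      using \<theta>(2) bspec[OF \<rho>1(4) \<theta>(1)] bspec[OF \<rho>2(4) \<theta>(1)] by metis+
    then have \<rho>0: "\<rho> > 0" using r0 by simp
    have "norm p = norm (\<rho> * sin \<theta>, - \<rho> * cos \<theta>)" using \<theta>(3) by (auto simp: norm_Pair)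
    then have "norm p = \<rho>" using polar_norm[of \<rho> \<theta>] \<rho>0 by simp
    moreover have "p = (0, - r0) \<or> snd p > 0" if "fst p = 0"
    proof -
      have "sin \<theta> = 0" using that \<theta>(3) \<rho>0 by auto
      then have "\<theta> = 0 \<or> \<theta> = pi" using \<theta>(1) sin_gt_zero[of \<theta>] by force
      then show ?thesis using \<theta>(2,3) \<rho>1(2) \<rho>2(2) \<rho>0 by auto
    qed
    ultimately show ?thesis using \<rho> by blast
  qed
  have start: "(0, - r0) \<in> C" unfolding C_union using T1(1,2) by (metis UnI1 atLeastAtMost_iff imageI less_imp_le order_refl)
  have top: "(0, \<Phi>1 r0) \<in> C" unfolding C_union using T1(1,3) by (metis UnI1 atLeastAtMost_iff imageI less_imp_le order_refl)
  have "\<Phi>1 r0 > 0" using half_map_bounds(1)[OF r0(1) r0e] r0 by simp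
  then have "\<not> \<delta>' constant_on UNIV"
    using start top r0 unfolding C_def constant_on_def by (metis (no_types, lifting) Pair_inject imageE neg_0_less_iff_less order_less_asym iso_tuple_UNIV_I)
  then have per: "periodic_orbit F C"
    unfolding periodic_orbit_def C_def using \<delta>'(1,2) T12
    by (intro exI[of _ \<delta>'] exI[of _ "T1 + T2"] conjI) (rule refl | assumption)+
  define \<eta> where "\<eta> = min \<delta> r0"
  \<comment> \<open>From the disc of radius 2 r0 all points of the closed negative half-axis are
    removed that are not within \<open>\<eta>\<close> of (0, - r0). Since
    \<open>\<eta> \<le> r0\<close>, this removes the origin; the radius and 8 r0 < e give the bound
    4 |y| < e needed for points of an orbit on the axis.\<close>
  define N where "N = ball (0 :: real \<times> real) (2 * r0) \<inter> - ({p. fst p = 0} \<inter> {p. snd p \<le> 0} \<inter> {p. \<eta> \<le> \<bar>snd p + r0\<bar>})"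
  have \<eta>: "\<eta> > 0" "\<eta> \<le> \<delta>" "\<eta> \<le> r0" using \<delta> r0 by (auto simp: \<eta>_def)
  have "open N"
    unfolding N_def
    by (intro open_Int open_ball open_Compl closed_Int closed_Collect_eq closed_Collect_le continuous_intros)
  moreover have "C \<subseteq> N"
  proof
    fix p assume "p \<in> C"
    from C_pts[OF this] show "p \<in> N" using r0 \<eta> unfolding N_def by auto
  qed
  moreover have "C' = C" if C': "periodic_orbit F C'" "C' \<subseteq> N" for C'
  proof -
    have zero: "0 \<notin> N" using \<eta> unfolding N_def by simp
    have sub: "C' \<subseteq> ball 0 e - {0}"
    proof
      fix p assume "p \<in> C'"
      then have p: "p \<in> N" using C'(2) by blast
      then have "norm p < 2 * r0" unfolding N_def by simp
      moreover have "p \<noteq> 0" using p zero by metis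
      ultimately show "p \<in> ball 0 e - {0}" using r0 by simp
    qed
    have axis: "\<bar>y\<bar> < 2 * r0" if "(0, y) \<in> C'" for y
      using C'(2) that unfolding N_def by (auto simp: norm_Pair)
    obtain r where r: "0 < r" "r < e" "(0, - r) \<in> C'" "\<Phi>1 r = \<Phi>2 r"
      using periodic_orbit_on_axis[OF C'(1) sub] axis r0 by force
    then have "\<not> \<eta> \<le> \<bar>- r + r0\<bar>" using C'(2) unfolding N_def by auto
    then have "\<bar>r - r0\<bar> < \<delta>" using \<eta> by linarith
    then have "r = r0" using iso r by blast
    then show ?thesis using periodic_orbits_equal[OF lip C'(1) per r(3)] start by simp
  qed
  ultimately have "isolated_periodic_orbit F C" unfolding isolated_periodic_orbit_def using per by blast
  moreover have "C \<subseteq> cball 0 (3/2 * r0)" using C_pts by auto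
  moreover have "\<forall>y\<le>0. (0, y) \<in> C \<longleftrightarrow> y = - r0" using C_pts start by fastforce
  moreover have "\<forall>p\<in>C. p \<noteq> 0"
  proof
    fix p assume "p \<in> C"
    then have "r0 / 2 \<le> norm p" using C_pts by blast
    then have "norm p > 0" using r0 by linarith
    then show "p \<noteq> 0" by simp
  qed
  ultimately show ?thesis using ins by blast
qed

end

subsection \<open>Unfolding of two limit cycles\<close>

text \<open>The angular momentum x y' - y x' equals N^2 up to cubic terms, at most N^2 / 300 in
  total, and the term d x y, at most N^2 / 4. Applied on either side with its own parameters, this
  shows that the glued field rotates.\<close>

lemma quad_rotation:
  assumes e: "e * coeff_bound l m n \<le> 1/300" and d: "\<bar>d\<bar> \<le> 1/4" and q: "norm q < e"
  shows "fst q * snd (quad d l m n q) - snd q * fst (quad d l m n q) \<ge> 1/2 * (norm q)^2"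
proof -
  obtain x y where q_eq: "q = (x, y)" by (cases q) auto
  define N where "N = norm q"
  have N2: "N^2 = x^2 + y^2" by (simp add: N_def q_eq norm_Pair)
  have xy: "\<bar>x\<bar> \<le> N" "\<bar>y\<bar> \<le> N"
    using norm_fst_le[of x y] norm_snd_le[of y x] by (simp_all add: N_def q_eq)
  have N0: "0 \<le> N" by (simp add: N_def)
  have NB: "N * coeff_bound l m n \<le> 1/300"
  proof -
    have "N * coeff_bound l m n \<le> e * coeff_bound l m n"
      using q coeff_bound_ge_1[of l m n] by (intro mult_right_mono) (auto simp: N_def)
    then show ?thesis using e by linarith
  qed
  have "\<bar>x^2 * y\<bar> \<le> N^2 * N" "\<bar>x * y\<bar> \<le> N * N" "\<bar>x * y^2\<bar> \<le> N * N^2" "\<bar>y^3\<bar> \<le> N^3"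
    unfolding abs_mult power_abs by (intro mult_mono power_mono xy; simp add: N0)+
  then have 1: "\<bar>(l + 1) * (x^2 * y)\<bar> \<le> \<bar>l + 1\<bar> * (N^2 * N)" "\<bar>d * (x * y)\<bar> \<le> \<bar>d\<bar> * (N * N)"
    "\<bar>m * (x * y^2)\<bar> \<le> \<bar>m\<bar> * (N * N^2)" "\<bar>n * y^3\<bar> \<le> \<bar>n\<bar> * N^3"
    unfolding abs_mult[of "l + 1"] abs_mult[of d] abs_mult[of m] abs_mult[of n]
    by (intro mult_left_mono; simp)+
  have "\<bar>l + 1\<bar> * (N^2 * N) + \<bar>m\<bar> * (N * N^2) + \<bar>n\<bar> * N^3 = (\<bar>l + 1\<bar> + \<bar>m\<bar> + \<bar>n\<bar>) * N * N^2"
    by (simp add: algebra_simps power2_eq_square power3_eq_cube)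
  also have "\<dots> \<le> (N * coeff_bound l m n) * N^2"
    using N0 by (intro mult_right_mono) (auto simp: coeff_bound_def mult.commute intro!: mult_left_mono)
  also have "\<dots> \<le> 1/300 * N^2" using NB by (intro mult_right_mono) auto
  finally have 2: "\<bar>l + 1\<bar> * (N^2 * N) + \<bar>m\<bar> * (N * N^2) + \<bar>n\<bar> * N^3 \<le> 1/300 * N^2" .
  have 3: "\<bar>d\<bar> * (N * N) \<le> 1/4 * N^2" using mult_right_mono[OF d, of "N^2"] by (simp add: power2_eq_square)
  have "fst q * snd (quad d l m n q) - snd q * fst (quad d l m n q) =
      N^2 - (l + 1) * (x^2 * y) - d * (x * y) - m * (x * y^2) - n * y^3"
    unfolding N2 by (simp add: q_eq quad_def algebra_simps power2_eq_square power3_eq_cube)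
  moreover have "1/300 * N^2 + 1/4 * N^2 \<le> 1/2 * N^2" by simp
  ultimately show ?thesis using 1 2 3 unfolding N_def[symmetric] abs_le_iff by linarith
qed

lemma half_map_real_derivative:
  assumes f: "half_map_spec d l m n e f" and r: "\<bar>r\<bar> < e"
  shows "((\<lambda>r. Re (f (of_real r))) has_real_derivative Re (deriv f (of_real r))) (at r)"
proof -
  have "f holomorphic_on ball 0 e" using f unfolding half_map_spec_def by blast
  then have "(f has_field_derivative deriv f (of_real r)) (at (of_real r))"
    by (rule holomorphic_derivI[OF _ open_ball]) (use r in simp)
  then have "((\<lambda>r. f (of_real r)) has_vector_derivative deriv f (of_real r)) (at r)"
    by (rule has_vector_derivative_real_field)
  from bounded_linear.has_vector_derivative[OF bounded_linear_Re this]
  show ?thesis by (simp add: has_real_derivative_iff_has_vector_derivative)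
qed

lemma isolated_zero_of_derivative:
  fixes D :: "real \<Rightarrow> real"
  assumes "(D has_real_derivative D') (at r0)" "D' \<noteq> 0" "D r0 = 0"
  shows "\<exists>\<delta>>0. \<forall>r. \<bar>r - r0\<bar> < \<delta> \<longrightarrow> D r = 0 \<longrightarrow> r = r0"
proof -
  have "((\<lambda>r. (D r - D r0) / (r - r0)) \<longlongrightarrow> D') (at r0)"
    using assms(1) by (simp add: has_field_derivative_iff)
  then have "\<forall>\<^sub>F r in at r0. (D r - D r0) / (r - r0) \<noteq> 0"
    using assms(2) by (rule tendsto_imp_eventually_ne)
  then obtain \<delta> where "\<delta> > 0" "\<forall>r. r \<noteq> r0 \<and> dist r r0 < \<delta> \<longrightarrow> (D r - D r0) / (r - r0) \<noteq> 0"
    unfolding eventually_at by blast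
  then show ?thesis using assms(3) by (intro exI[of _ \<delta>]) (auto simp: dist_real_def)
qed

text \<open>With D the difference of the normalized half maps, the displacement map is r D(r). A
  simple zero of D at r0 > 0 is isolated and is a simple zero of the displacement map, its
  derivative there being r0 D'(r0).\<close>

theorem limit_cycle_of_simple_zero:
  fixes d1 d2 l1 l2 m1 m2 n e r0 :: real
  defines "p \<equiv> (d1, d2, l1, l2, m1, m2, n)"
  assumes f1: "half_map_spec d1 l1 m1 n e f1" and f2: "half_map_spec (- d2) l2 (- m2) n e f2"
    and d: "\<bar>d1\<bar> \<le> 1/4" "\<bar>d2\<bar> \<le> 1/4"
    and eB: "e * coeff_bound l1 m1 n \<le> 1/300" "e * coeff_bound l2 (- m2) n \<le> 1/300"
    and r0: "0 < r0" "8 * r0 < e"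
    and zero: "Re (f2 (of_real r0)) = Re (f1 (of_real r0))"
    and simple: "Re (deriv f2 (of_real r0)) \<noteq> Re (deriv f1 (of_real r0))"
  shows "\<exists>C. crossing_limit_cycle (X_right p) (X_left p) C \<and> C \<subseteq> cball 0 (3/2 * r0) \<and>
    (0, 0) \<in> inside C \<and> cycle_multiplicity (pw_field p) C 1 \<and> (\<forall>y\<le>0. (0, y) \<in> C \<longleftrightarrow> y = - r0)"
proof -
  define F where "F = pw_field p"
  define \<Phi>1 \<Phi>2 where "\<Phi>1 r = r * Re (f1 (of_real r))" and "\<Phi>2 r = r * Re (f2 (of_real r))" for r
  define D where "D r = Re (f2 (of_real r)) - Re (f1 (of_real r))" for r
  define D' where "D' r = Re (deriv f2 (of_real r)) - Re (deriv f1 (of_real r))" for r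
  have dD: "(D has_real_derivative D' r) (at r)" if "\<bar>r\<bar> < e" for r
    unfolding D_def[abs_def] D'_def
    by (intro DERIV_diff half_map_real_derivative[OF f1 that] half_map_real_derivative[OF f2 that])
  have r0e: "\<bar>r0\<bar> < e" using r0 by simp
  have cont: "continuous_on {0<..<e} \<Phi>1" "continuous_on {0<..<e} \<Phi>2"
    unfolding \<Phi>1_def \<Phi>2_def
    by (intro continuous_on_mult continuous_on_id continuous_at_imp_continuous_on ballI
        DERIV_isCont[OF half_map_real_derivative[OF f1]] DERIV_isCont[OF half_map_real_derivative[OF f2]]; simp)+
  have orb1: "\<exists>\<rho> T \<gamma>. half_orbit F r (\<Phi>1 r) \<rho> T \<gamma>" if "0 < r" "r < e" for r
    unfolding F_def p_def \<Phi>1_def by (rule half_map_orbit[OF f1 that])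
  have orb2: "\<exists>\<rho> T \<gamma>. half_orbit (mirror_field F) r (\<Phi>2 r) \<rho> T \<gamma>" if "0 < r" "r < e" for r
    unfolding F_def p_def \<Phi>2_def mirror_pw_field by (rule half_map_orbit[OF f2 that])
  have lip: "bounded_lipschitz F" unfolding F_def by (rule pw_field_lipschitz)
  have rot: "fst q * snd (F q) - snd q * fst (F q) \<ge> 1/2 * (norm q)^2" if "norm q < e" for q
  proof -
    have "e * coeff_bound l2 m2 n \<le> 1/300" using eB(2) by (simp add: coeff_bound_def)
    from quad_rotation[OF eB(1) d(1) that] quad_rotation[OF this d(2) that]
    show ?thesis by (simp add: F_def p_def pw_field_def glue_def X_right_def X_left_def)
  qed
  have D0: "D r0 = 0" "D' r0 \<noteq> 0" using zero simple by (simp_all add: D_def D'_def)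
  obtain \<delta> where \<delta>: "\<delta> > 0" "\<forall>r. \<bar>r - r0\<bar> < \<delta> \<longrightarrow> D r = 0 \<longrightarrow> r = r0"
    using isolated_zero_of_derivative[OF dD[OF r0e] D0(2,1)] by blast
  define \<delta>' where "\<delta>' = min \<delta> r0"
  have iso: "r = r0" if "\<bar>r - r0\<bar> < \<delta>'" "\<Phi>1 r = \<Phi>2 r" for r
  proof -
    have "r > 0" "\<bar>r - r0\<bar> < \<delta>" using that(1) by (auto simp: \<delta>'_def abs_less_iff)
    then show ?thesis using that(2) \<delta>(2) by (simp add: \<Phi>1_def \<Phi>2_def D_def)
  qed
  have "\<delta>' > 0" using \<delta> r0 by (simp add: \<delta>'_def)
  moreover have "\<Phi>1 r0 = \<Phi>2 r0" using zero by (simp add: \<Phi>1_def \<Phi>2_def)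
  ultimately obtain C where C: "isolated_periodic_orbit F C" "C \<subseteq> cball 0 (3/2 * r0)" "(0, 0) \<in> inside C"
    "\<forall>y\<le>0. (0, y) \<in> C \<longleftrightarrow> y = - r0" "\<forall>q\<in>C. q \<noteq> 0"
    using isolated_cycle_of_isolated_zero[OF lip orb1 orb2 cont rot r0, of \<delta>'] iso by blast
  have "fst (X_right p q) * fst (X_left p q) > 0" if q: "q \<in> C" "fst q = 0" for q
  proof -
    obtain y where y: "q = (0, y)" using q(2) by (cases q) auto
    have y0: "y \<noteq> 0" using C(5) q(1) y by (auto simp: zero_prod_def)
    have "norm q \<le> 3/2 * r0" using C(2) q(1) by auto
    then have "\<bar>y\<bar> \<le> e" using r0 by (simp add: y norm_Pair)
    then have "\<bar>y\<bar> * \<bar>n\<bar> \<le> e * coeff_bound l1 m1 n"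
      using r0 by (intro mult_mono) (auto simp: coeff_bound_def)
    \<comment> \<open>On the axis both fields have first component y (n y - 1), so transversality
      and equal direction amount to this square being positive, which follows from |n y| < 1 and y
      nonzero.\<close>
    then have "\<bar>y * n\<bar> < 1" using eB(1) by (simp add: abs_mult)
    then have "n * y - 1 \<noteq> 0" by (auto simp: mult.commute)
    then have "(y * (n * y - 1))^2 > 0" using y0 by simp
    then show ?thesis
      by (simp add: y p_def X_right_def X_left_def quad_def power2_eq_square algebra_simps)
  qed
  then have "crossing_limit_cycle (X_right p) (X_left p) C"
    using C(1) unfolding crossing_limit_cycle_def F_def pw_field_def by blast
  moreover have "cycle_multiplicity F C 1"
  proof -
    have disp: "displacement F r = r * D r" if "r \<in> {0<..<e}" for r
      using half_map_displacement(2)[OF f1 f2, of r] that unfolding F_def p_def D_def by simp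
    \<comment> \<open>The formula r D(r) is known only on (0, e), so the derivative is transferred
      by equality near r.\<close>
    have dd: "(displacement F has_real_derivative 1 * D r + D' r * r) (at r)" if r: "r \<in> {0<..<e}" for r
    proof (rule DERIV_cong_ev[THEN iffD2, OF refl _ refl])
      show "\<forall>\<^sub>F x in nhds r. displacement F x = x * D x"
        using eventually_nhds_in_open[of "{0<..<e}" r] r disp by (auto elim: eventually_mono)
      show "((\<lambda>x. x * D x) has_real_derivative 1 * D r + D' r * r) (at r)"
        by (intro DERIV_mult DERIV_ident dD) (use r in auto)
    qed
    have r0in: "r0 \<in> {0<..<e}" using r0 by auto
    have "\<forall>\<^sub>F x in nhds r0. displacement F field_differentiable at x"
      using eventually_nhds_in_open[of "{0<..<e}" r0] r0in dd
      by (auto elim!: eventually_mono simp: field_differentiable_def)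
    moreover have "deriv (displacement F) r0 \<noteq> 0"
      using DERIV_imp_deriv[OF dd[OF r0in]] D0 r0 by simp
    ultimately have "zero_multiplicity (displacement F) r0 1"
      unfolding zero_multiplicity_def using disp[OF r0in] D0 by simp
    moreover have "(0, - r0) \<in> C" using C(4) r0 by simp
    ultimately show ?thesis unfolding cycle_multiplicity_def using r0(1) by blast
  qed
  ultimately show ?thesis using C(2-4) unfolding F_def by blast
qed


text \<open>Scaling \<open>r = \<epsilon> \<rho>\<close>, \<open>d\<^sub>1 = a \<epsilon>\<^sup>2\<close>, \<open>l\<^sub>1 = l + b \<epsilon>\<close> balances the terms of order 1, 2 and 3 of the
  displacement map, and \<open>a\<close>, \<open>b\<close> below are such that the rescaled map tends to
  \<open>K (\<rho> - 1) (\<rho> - 2)\<close> with \<open>K = W\<^sub>3\<close>. The estimate holds for complex \<open>\<rho>\<close>, so that Cauchy's inequality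
  also controls the derivative.\<close>

lemma rescaled_difference:
  fixes l m1 m2 n :: real
  assumes K: "K = - (pi / 8) * ((m1 + m2) * (l + n))"
  defines "a \<equiv> - (4 * K / pi)" and "b \<equiv> 9 * K / 4"
  shows "\<exists>M B H. 20 \<le> M \<and> 0 < B \<and> 0 < H \<and> (\<forall>\<epsilon>. 0 < \<epsilon> \<and> \<epsilon> \<le> 1 \<and> M * \<epsilon> * B \<le> 1/300 \<longrightarrow>
    (M * \<epsilon>) * coeff_bound (l + b * \<epsilon>) m1 n \<le> 1/300 \<and> (M * \<epsilon>) * coeff_bound l (- m2) n \<le> 1/300 \<and>
    \<bar>a * \<epsilon>^2\<bar> \<le> (M * \<epsilon>)^2 \<and>
    (\<forall>f1 f2. half_map_spec (a * \<epsilon>^2) (l + b * \<epsilon>) m1 n (M * \<epsilon>) f1 \<longrightarrow>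
       half_map_spec 0 l (- m2) n (M * \<epsilon>) f2 \<longrightarrow>
       (\<forall>\<rho>::complex. norm \<rho> < M \<longrightarrow>
         norm (f2 (of_real \<epsilon> * \<rho>) - f1 (of_real \<epsilon> * \<rho>) - of_real (\<epsilon>^2 * K) * ((\<rho> - 1) * (\<rho> - 2))) \<le> H * \<epsilon>^3)))"
proof -
  \<comment> \<open>The summand |a| gives |a| <= M^2, that is |d1| <= e^2 for the radius e = M
    \<epsilon>. The summand 20 exceeds 8 * 9/4 = 18, so cycles at distance up to 9 \<epsilon> / 4
    satisfy 8 r0 < e.\<close>
  define M where "M = 20 + \<bar>a\<bar>"
  define B where "B = \<bar>l\<bar> + \<bar>b\<bar> + \<bar>m1\<bar> + \<bar>m2\<bar> + \<bar>n\<bar> + 1"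
  define A where "A = (4 * l + 2 * (n - 1)) / 3"
  \<comment> \<open>Moving l1 by b \<epsilon> also changes the quadratic coefficient.
    \<open>G\<close> is this change divided by \<epsilon>; after rescaling it enters only at order
    \<epsilon>^3. \<open>H\<close> adds it to the two third-order remainders, 11000 each.\<close>
  define G where "G \<epsilon> = 4 * b / 3 * (2 * A + 4 * b * \<epsilon> / 3) + pi / 8 * m1 * b" for \<epsilon>
  define G0 where "G0 = \<bar>4 * b / 3\<bar> * (\<bar>2 * A\<bar> + \<bar>4 * b / 3\<bar>) + \<bar>pi / 8 * m1 * b\<bar>"
  define H where "H = 22000 * (M * B)^3 + G0 * M^2"
  have M: "20 \<le> M" by (simp add: M_def)
  have B: "1 \<le> B" by (simp add: B_def)
  have G0: "0 \<le> G0" by (simp add: G0_def)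
  have H: "0 < H" unfolding H_def using M B G0 by (intro add_pos_nonneg mult_pos_pos zero_less_power mult_nonneg_nonneg) auto
  have main: "(M * \<epsilon>) * coeff_bound (l + b * \<epsilon>) m1 n \<le> 1/300 \<and> (M * \<epsilon>) * coeff_bound l (- m2) n \<le> 1/300 \<and>
    \<bar>a * \<epsilon>^2\<bar> \<le> (M * \<epsilon>)^2 \<and>
    (\<forall>f1 f2. half_map_spec (a * \<epsilon>^2) (l + b * \<epsilon>) m1 n (M * \<epsilon>) f1 \<longrightarrow>
       half_map_spec 0 l (- m2) n (M * \<epsilon>) f2 \<longrightarrow>
       (\<forall>\<rho>::complex. norm \<rho> < M \<longrightarrow>
         norm (f2 (of_real \<epsilon> * \<rho>) - f1 (of_real \<epsilon> * \<rho>) - of_real (\<epsilon>^2 * K) * ((\<rho> - 1) * (\<rho> - 2))) \<le> H * \<epsilon>^3))"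
    if \<epsilon>: "0 < \<epsilon>" "\<epsilon> \<le> 1" "M * \<epsilon> * B \<le> 1/300" for \<epsilon>
  proof -
    let ?e = "M * \<epsilon>"
    have e0: "0 < ?e" using M \<epsilon> by simp
    have "\<bar>b * \<epsilon>\<bar> \<le> \<bar>b\<bar>" by (rule abs_mult_le_left) (use \<epsilon> in simp)
    then have B1: "coeff_bound (l + b * \<epsilon>) m1 n \<le> B"
      unfolding coeff_bound_def B_def using abs_triangle_ineq[of l "b * \<epsilon>"] by linarith
    have B2: "coeff_bound l (- m2) n \<le> B" unfolding coeff_bound_def B_def by simp
    have c1: "?e * coeff_bound (l + b * \<epsilon>) m1 n \<le> ?e * B" "?e * coeff_bound l (- m2) n \<le> ?e * B"
      using B1 B2 e0 by (intro mult_left_mono; simp)+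
    have "\<bar>a\<bar> \<le> M * 1" by (simp add: M_def)
    also have "\<dots> \<le> M * M" using M by (intro mult_left_mono) auto
    finally have ae: "\<bar>a * \<epsilon>^2\<bar> \<le> ?e^2"
      by (simp add: abs_mult power_mult_distrib power2_eq_square[of M] mult_right_mono)
    have est: "norm (f2 (of_real \<epsilon> * \<rho>) - f1 (of_real \<epsilon> * \<rho>) - of_real (\<epsilon>^2 * K) * ((\<rho> - 1) * (\<rho> - 2))) \<le> H * \<epsilon>^3"
      if f1: "half_map_spec (a * \<epsilon>^2) (l + b * \<epsilon>) m1 n ?e f1" and f2: "half_map_spec 0 l (- m2) n ?e f2"
        and \<rho>: "norm \<rho> < M" for f1 f2 and \<rho> :: complex
    proof -
      let ?z = "of_real \<epsilon> * \<rho>"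
      define A1 where "A1 = (4 * (l + b * \<epsilon>) + 2 * (n - 1)) / 3"
      define Q1 where "Q1 = A1^2 + pi / 8 * m1 * (l + b * \<epsilon> + n)"
      define Q2 where "Q2 = A^2 + pi / 8 * (- m2) * (l + n)"
      have z: "?z \<in> ball 0 ?e" using \<rho> \<epsilon> by (simp add: norm_mult mult.commute)
      define P1 where "P1 = 1 + of_real (a * \<epsilon>^2 * pi / 2) + of_real A1 * ?z + of_real Q1 * ?z^2"
      define P2 where "P2 = 1 + of_real (0 * pi / 2) + of_real A * ?z + of_real Q2 * ?z^2"
      have z': "norm ?z \<le> ?e" using z by simp
      have "norm (f1 ?z - P1) \<le> 11000 * (?e * coeff_bound (l + b * \<epsilon>) m1 n)^3"
        using f1 z z' e0 ae unfolding half_map_spec_def P1_def A1_def Q1_def by auto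
      also have "\<dots> \<le> 11000 * (?e * B)^3"
        by (intro mult_left_mono power_mono c1) (use e0 coeff_bound_ge_1[of "l + b * \<epsilon>" m1 n] in simp_all)
      finally have n1: "norm (f1 ?z - P1) \<le> 11000 * (?e * B)^3" .
      have "norm (f2 ?z - P2) \<le> 11000 * (?e * coeff_bound l (- m2) n)^3"
        using f2 z z' e0 unfolding half_map_spec_def P2_def A_def Q2_def by auto
      also have "\<dots> \<le> 11000 * (?e * B)^3"
        by (intro mult_left_mono power_mono c1) (use e0 coeff_bound_ge_1[of l "- m2" n] in simp_all)
      finally have n2: "norm (f2 ?z - P2) \<le> 11000 * (?e * B)^3" .
      have A1: "A1 = A + 4 * b * \<epsilon> / 3" unfolding A1_def A_def by (simp add: field_simps)
      have Q: "Q2 - Q1 = K - \<epsilon> * G \<epsilon>"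
        unfolding Q2_def Q1_def A1 K G_def
        by (simp add: power2_eq_square algebra_simps add_divide_distrib)
      have PP: "P2 - P1 = of_real (A - A1) * ?z + of_real (Q2 - Q1) * ?z^2 - of_real (a * \<epsilon>^2 * pi / 2)"
        unfolding P1_def P2_def by (simp add: algebra_simps)
      \<comment> \<open>Matching with K (\<rho> - 1) (\<rho> - 2) = K \<rho>^2 - 3 K \<rho> + 2 K:
        the constant term determines a and the linear term determines b.\<close>
      have e1: "a * \<epsilon>^2 * pi / 2 = - (2 * (\<epsilon>^2 * K))" unfolding a_def by simp
      have e2: "A - A1 = - (3 * (\<epsilon> * K))" unfolding A1 b_def by simp
      have "P2 - P1 = of_real (\<epsilon>^2 * K) * ((\<rho> - 1) * (\<rho> - 2)) - of_real (\<epsilon>^3 * G \<epsilon>) * \<rho>^2"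
        unfolding PP Q e1 e2 by (simp add: power2_eq_square power3_eq_cube algebra_simps)
      then have eq: "f2 ?z - f1 ?z - of_real (\<epsilon>^2 * K) * ((\<rho> - 1) * (\<rho> - 2)) =
          (f2 ?z - P2) - (f1 ?z - P1) - of_real (\<epsilon>^3 * G \<epsilon>) * \<rho>^2"
        by (simp add: algebra_simps)
      have "\<bar>2 * A + 4 * b * \<epsilon> / 3\<bar> \<le> \<bar>2 * A\<bar> + \<bar>4 * b / 3\<bar>"
        using abs_triangle_ineq[of "2 * A" "4 * b / 3 * \<epsilon>"] abs_mult_le_left[of \<epsilon> "4 * b / 3"] \<epsilon> by simp
      then have "\<bar>4 * b / 3 * (2 * A + 4 * b * \<epsilon> / 3)\<bar> \<le> \<bar>4 * b / 3\<bar> * (\<bar>2 * A\<bar> + \<bar>4 * b / 3\<bar>)"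
        unfolding abs_mult[of "4 * b / 3"] by (rule mult_left_mono) simp
      then have G: "\<bar>G \<epsilon>\<bar> \<le> G0"
        unfolding G_def G0_def using abs_triangle_ineq[of "4 * b / 3 * (2 * A + 4 * b * \<epsilon> / 3)" "pi / 8 * m1 * b"] by linarith
      have "norm (of_real (\<epsilon>^3 * G \<epsilon>) * \<rho>^2) = \<epsilon>^3 * \<bar>G \<epsilon>\<bar> * norm \<rho> ^ 2"
        using \<epsilon> by (simp add: norm_mult norm_power abs_mult)
      also have "\<dots> \<le> \<epsilon>^3 * G0 * M^2"
        using \<rho> G G0 \<epsilon> by (intro mult_mono power_mono) auto
      finally have n3: "norm (of_real (\<epsilon>^3 * G \<epsilon>) * \<rho>^2) \<le> \<epsilon>^3 * G0 * M^2" .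
      have "norm ((f2 ?z - P2) - (f1 ?z - P1) - of_real (\<epsilon>^3 * G \<epsilon>) * \<rho>^2) \<le>
          11000 * (?e * B)^3 + 11000 * (?e * B)^3 + \<epsilon>^3 * G0 * M^2"
        by (intro order.trans[OF norm_triangle_ineq4] add_mono n1 n2 n3)
      also have "\<dots> = H * \<epsilon>^3" unfolding H_def by (simp add: power_mult_distrib algebra_simps)
      finally show ?thesis unfolding eq .
    qed
    show ?thesis using c1 \<epsilon>(3) ae est by fastforce
  qed
  show ?thesis
    using M B H main by (intro exI[of _ M] exI[of _ B] exI[of _ H]) auto
qed

text \<open>At c - 1/4 and c + 1/4 the quadratic (\<rho> - 1) (\<rho> - 2) takes the values 5/16 and
  - 3/16 in some order, whereas the error relative to \<epsilon>^2 |K| is below 1/8, so a zero lies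
  between. The same error bound holds for the derivative by Cauchy's inequality, and |2 \<rho> - 3|
  >= 1/2 there, so the zero is simple.\<close>

lemma simple_zero_near:
  fixes g1 g2 :: "complex \<Rightarrow> complex" and \<epsilon> H K c M :: real
  assumes hol: "g1 holomorphic_on ball 0 (M * \<epsilon>)" "g2 holomorphic_on ball 0 (M * \<epsilon>)"
    and \<epsilon>: "\<epsilon> > 0" and M: "M \<ge> 20" and small: "H * \<epsilon> < \<bar>K\<bar> / 8"
    and est: "\<And>\<rho>::complex. norm \<rho> < M \<Longrightarrow>
      norm (g2 (of_real \<epsilon> * \<rho>) - g1 (of_real \<epsilon> * \<rho>) - of_real (\<epsilon>^2 * K) * ((\<rho> - 1) * (\<rho> - 2))) \<le> H * \<epsilon>^3"
    and c: "c = 1 \<or> c = 2"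
  shows "\<exists>\<rho>. c - 1/4 \<le> \<rho> \<and> \<rho> \<le> c + 1/4 \<and> Re (g2 (of_real (\<epsilon> * \<rho>))) = Re (g1 (of_real (\<epsilon> * \<rho>))) \<and>
    Re (deriv g2 (of_real (\<epsilon> * \<rho>))) \<noteq> Re (deriv g1 (of_real (\<epsilon> * \<rho>)))"
proof -
  define h where "h \<rho> = g2 (of_real \<epsilon> * \<rho>) - g1 (of_real \<epsilon> * \<rho>) - of_real (\<epsilon>^2 * K) * ((\<rho> - 1) * (\<rho> - 2))" for \<rho>
  have in': "of_real \<epsilon> * \<rho> \<in> ball 0 (M * \<epsilon>)" if "norm \<rho> < M" for \<rho> :: complex
    using that \<epsilon> by (simp add: norm_mult mult.commute)
  have dh: "(h has_field_derivative of_real \<epsilon> * (deriv g2 (of_real \<epsilon> * \<rho>) - deriv g1 (of_real \<epsilon> * \<rho>))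
      - of_real (\<epsilon>^2 * K) * (2 * \<rho> - 3)) (at \<rho>)" if "norm \<rho> < M" for \<rho>
  proof -
    have lin: "((\<lambda>\<rho>. of_real \<epsilon> * \<rho>) has_field_derivative of_real \<epsilon>) (at \<rho>)"
      using DERIV_cmult[OF DERIV_ident, of "of_real \<epsilon>" \<rho>] by simp
    have 1: "((\<lambda>\<rho>. g1 (of_real \<epsilon> * \<rho>)) has_field_derivative deriv g1 (of_real \<epsilon> * \<rho>) * of_real \<epsilon>) (at \<rho>)"
      "((\<lambda>\<rho>. g2 (of_real \<epsilon> * \<rho>)) has_field_derivative deriv g2 (of_real \<epsilon> * \<rho>) * of_real \<epsilon>) (at \<rho>)"
      by (rule DERIV_chain2[OF holomorphic_derivI[OF hol(1) open_ball in'[OF that]] lin],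
          rule DERIV_chain2[OF holomorphic_derivI[OF hol(2) open_ball in'[OF that]] lin])
    have 2: "((\<lambda>\<rho>. of_real (\<epsilon>^2 * K) * ((\<rho> - 1) * (\<rho> - 2))) has_field_derivative
        of_real (\<epsilon>^2 * K) * (2 * \<rho> - 3)) (at \<rho>)"
      by (rule derivative_eq_intros refl)+ (simp add: algebra_simps)
    show ?thesis
      unfolding h_def[abs_def]
      using DERIV_diff[OF DERIV_diff[OF 1(2) 1(1)] 2] by (simp add: algebra_simps)
  qed
  have hol_h: "h holomorphic_on ball 0 M"
    by (rule holomorphic_onI, rule field_differentiable_at_within, unfold field_differentiable_def)
      (use dh in auto)
  have hb: "norm (h \<rho>) \<le> H * \<epsilon>^3" if "norm \<rho> < M" for \<rho>
    unfolding h_def by (rule est[OF that])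
  have dhb: "norm (deriv h (of_real \<rho>)) \<le> H * \<epsilon>^3" if "\<bar>\<rho>\<bar> \<le> 3" for \<rho> :: real
  proof -
    have sub: "cball (of_real \<rho>) 1 \<subseteq> ball (0::complex) M"
    proof
      fix w :: complex assume "w \<in> cball (of_real \<rho>) 1"
      then have "norm (w - of_real \<rho>) \<le> 1" by (simp add: dist_norm norm_minus_commute)
      then have "norm w \<le> 4" using norm_triangle_ineq[of "w - of_real \<rho>" "of_real \<rho>"] that by simp
      then show "w \<in> ball 0 M" using M by simp
    qed
    \<comment> \<open>Cauchy's inequality on the unit circle around \<rho>. For |\<rho>| <= 3 this
      circle stays within distance 4 < M of the origin, where the error estimate holds, and radius 1
      gives the derivative the same bound as the function.\<close>
    have "norm ((deriv ^^ 1) h (of_real \<rho>)) \<le> fact 1 * (H * \<epsilon>^3) / 1 ^ 1"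
    proof (rule Cauchy_inequality)
      show "h holomorphic_on ball (of_real \<rho>) 1"
        by (rule holomorphic_on_subset[OF hol_h]) (use sub in \<open>auto simp: subset_iff\<close>)
      show "continuous_on (cball (of_real \<rho>) 1) h"
        by (rule continuous_on_subset[OF holomorphic_on_imp_continuous_on[OF hol_h] sub])
      show "norm (h x) \<le> H * \<epsilon>^3" if "norm (of_real \<rho> - x) = 1" for x
      proof -
        have "x \<in> cball (of_real \<rho>) 1" using that by (simp add: dist_norm)
        then have "x \<in> ball 0 M" using sub by blast
        then show ?thesis using hb by simp
      qed
    qed simp
    then show ?thesis by simp
  qed
  define \<psi> where "\<psi> \<rho> = Re (g2 (of_real (\<epsilon> * \<rho>))) - Re (g1 (of_real (\<epsilon> * \<rho>)))" for \<rho> :: real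
  have Hs: "H * \<epsilon>^3 < \<epsilon>^2 * (\<bar>K\<bar> / 8)"
    using mult_strict_left_mono[OF small, of "\<epsilon>^2"] \<epsilon> by (simp add: power2_eq_square power3_eq_cube mult_ac)
  have \<psi>: "\<bar>\<psi> \<rho> - \<epsilon>^2 * K * ((\<rho> - 1) * (\<rho> - 2))\<bar> < \<epsilon>^2 * (\<bar>K\<bar> / 8)" if "\<bar>\<rho>\<bar> \<le> 3" for \<rho>
  proof -
    have "of_real (\<epsilon>^2 * K) * ((complex_of_real \<rho> - 1) * (of_real \<rho> - 2)) = of_real (\<epsilon>^2 * K * ((\<rho> - 1) * (\<rho> - 2)))"
      by simp
    then have "Re (h (of_real \<rho>)) = \<psi> \<rho> - \<epsilon>^2 * K * ((\<rho> - 1) * (\<rho> - 2))"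
      unfolding h_def \<psi>_def by (simp only: minus_complex.sel Re_complex_of_real of_real_mult[symmetric])
    then show ?thesis
      using abs_Re_le_cmod[of "h (of_real \<rho>)"] hb[of "of_real \<rho>"] Hs that M by simp
  qed
  have cont: "continuous_on {c - 1/4..c + 1/4} \<psi>"
  proof -
    have "continuous_on {c - 1/4..c + 1/4} (\<lambda>\<rho>. g (complex_of_real (\<epsilon> * \<rho>)))"
      if "g holomorphic_on ball 0 (M * \<epsilon>)" for g
    proof (rule continuous_on_compose2[OF holomorphic_on_imp_continuous_on[OF that]])
      show "(\<lambda>\<rho>. complex_of_real (\<epsilon> * \<rho>)) ` {c - 1/4..c + 1/4} \<subseteq> ball 0 (M * \<epsilon>)"
      proof
        fix w assume "w \<in> (\<lambda>\<rho>. complex_of_real (\<epsilon> * \<rho>)) ` {c - 1/4..c + 1/4}"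
        then obtain \<rho> where \<rho>: "\<rho> \<in> {c - 1/4..c + 1/4}" "w = of_real \<epsilon> * of_real \<rho>" by auto
        then have "norm (complex_of_real \<rho>) < M" using c M by auto
        then show "w \<in> ball 0 (M * \<epsilon>)" using in' \<rho>(2) by simp
      qed
    qed (intro continuous_intros)
    then show ?thesis unfolding \<psi>_def using hol by (intro continuous_intros) auto
  qed
  \<comment> \<open>Since H bounds a norm, it is nonnegative, and then the smallness assumption
    itself forces K to be nonzero.\<close>
  have "0 \<le> H * \<epsilon>^3" using hb[of 0] M order.trans[OF norm_ge_zero] by simp
  then have "0 \<le> H" using \<epsilon> by (simp add: zero_le_mult_iff)
  then have "0 \<le> H * \<epsilon>" using \<epsilon> by simp
  then have K: "K \<noteq> 0" using small by auto
  have e2: "\<epsilon>^2 * \<bar>K\<bar> > 0" using \<epsilon> K by simp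
  define q where "q \<rho> = \<epsilon>^2 * K * ((\<rho> - 1) * (\<rho> - 2))" for \<rho>
  have "\<exists>\<rho>. c - 1/4 \<le> \<rho> \<and> \<rho> \<le> c + 1/4 \<and> \<psi> \<rho> = 0"
  proof -
    let ?u = "c - 1/4" and ?v = "c + 1/4"
    have near: "\<bar>\<psi> ?u - q ?u\<bar> < \<epsilon>^2 * (\<bar>K\<bar> / 8)" "\<bar>\<psi> ?v - q ?v\<bar> < \<epsilon>^2 * (\<bar>K\<bar> / 8)"
      unfolding q_def using \<psi>[of ?u] \<psi>[of ?v] c by auto
    have vals: "(q ?u = \<epsilon>^2 * K * (5/16) \<and> q ?v = \<epsilon>^2 * K * (-3/16)) \<or>
        (q ?u = \<epsilon>^2 * K * (-3/16) \<and> q ?v = \<epsilon>^2 * K * (5/16))"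
      using c unfolding q_def by auto
    define E where "E = \<epsilon>^2 * K"
    have E: "\<epsilon>^2 * (\<bar>K\<bar> / 8) = \<bar>E\<bar> / 8" "E \<noteq> 0"
      using \<epsilon> K by (auto simp: E_def abs_mult)
    have "(\<psi> ?u \<le> 0 \<and> 0 \<le> \<psi> ?v) \<or> (\<psi> ?v \<le> 0 \<and> 0 \<le> \<psi> ?u)"
    proof -
      have key: "(u \<le> 0 \<and> 0 \<le> v) \<or> (v \<le> 0 \<and> 0 \<le> u)"
        if "\<bar>u - qu\<bar> < \<bar>E\<bar> / 8" "\<bar>v - qv\<bar> < \<bar>E\<bar> / 8"
          "(qu = E * (5/16) \<and> qv = E * (-3/16)) \<or> (qu = E * (-3/16) \<and> qv = E * (5/16))" for u v qu qv
      proof -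
        have a: "qu - \<bar>E\<bar> / 8 < u" "u < qu + \<bar>E\<bar> / 8" "qv - \<bar>E\<bar> / 8 < v" "v < qv + \<bar>E\<bar> / 8"
          using that(1,2) unfolding abs_less_iff by simp_all
        from that(3) show ?thesis
        proof
          assume q: "qu = E * (5/16) \<and> qv = E * (-3/16)"
          show ?thesis
          proof (cases "E \<ge> 0")
            case True
            then have "0 \<le> u \<and> v \<le> 0" using a q by simp
            then show ?thesis by simp
          next
            case False
            then have "u \<le> 0 \<and> 0 \<le> v" using a q by simp
            then show ?thesis by simp
          qed
        next
          assume q: "qu = E * (-3/16) \<and> qv = E * (5/16)"
          show ?thesis
          proof (cases "E \<ge> 0")
            case True
            then have "u \<le> 0 \<and> 0 \<le> v" using a q by simp
            then show ?thesis by simp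
          next
            case False
            then have "0 \<le> u \<and> v \<le> 0" using a q by simp
            then show ?thesis by simp
          qed
        qed
      qed
      show ?thesis
        by (rule key[OF near(1)[unfolded E(1)] near(2)[unfolded E(1)] vals[folded E_def]])
    qed
    then show ?thesis
      using IVT'[of \<psi> ?u 0 ?v] IVT2'[of \<psi> ?v 0 ?u] cont by auto
  qed
  then obtain \<rho> where \<rho>: "c - 1/4 \<le> \<rho>" "\<rho> \<le> c + 1/4" "\<psi> \<rho> = 0" by blast
  have \<rho>3: "\<bar>\<rho>\<bar> \<le> 3" using \<rho> c by auto
  have "Re (deriv g2 (of_real (\<epsilon> * \<rho>))) \<noteq> Re (deriv g1 (of_real (\<epsilon> * \<rho>)))"
  proof
    assume eq: "Re (deriv g2 (of_real (\<epsilon> * \<rho>))) = Re (deriv g1 (of_real (\<epsilon> * \<rho>)))"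
    have "deriv h (of_real \<rho>) = of_real \<epsilon> * (deriv g2 (of_real (\<epsilon> * \<rho>)) - deriv g1 (of_real (\<epsilon> * \<rho>)))
        - of_real (\<epsilon>^2 * K * (2 * \<rho> - 3))"
      using DERIV_imp_deriv[OF dh[of "of_real \<rho>"]] \<rho>3 M by simp
    then have "Re (deriv h (of_real \<rho>)) = - (\<epsilon>^2 * K * (2 * \<rho> - 3))"
      using eq by (simp only: minus_complex.sel Re_complex_of_real Re_complex_of_real times_complex.sel Im_complex_of_real) simp
    then have "\<bar>\<epsilon>^2 * K * (2 * \<rho> - 3)\<bar> \<le> H * \<epsilon>^3"
      using abs_Re_le_cmod[of "deriv h (of_real \<rho>)"] dhb[OF \<rho>3] by simp
    moreover have "\<epsilon>^2 * \<bar>K\<bar> * (1/2) \<le> \<epsilon>^2 * \<bar>K\<bar> * \<bar>2 * \<rho> - 3\<bar>"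
      using \<rho> c e2 by (intro mult_left_mono) auto
    moreover have "\<bar>\<epsilon>^2 * K * (2 * \<rho> - 3)\<bar> = \<epsilon>^2 * \<bar>K\<bar> * \<bar>2 * \<rho> - 3\<bar>"
      by (simp add: abs_mult)
    ultimately show False using Hs e2 by simp
  qed
  then show ?thesis using \<rho> by (intro exI[of _ \<rho>]) (simp add: \<psi>_def)
qed

theorem unfolds_two_limit_cycles:
  assumes "p0 \<in> Fc"
  shows "unfolds_limit_cycles p0 2"
  unfolding unfolds_limit_cycles_def
proof (intro allI impI)
  fix U :: "(real \<times> real) set" and V :: "params set"
  assume UV: "open U \<and> (0, 0) \<in> U \<and> open V \<and> p0 \<in> V"
  obtain l m1 m2 n where p0: "p0 = (0, 0, l, l, m1, m2, n)" and nz: "(m1 + m2) * (l + n) \<noteq> 0"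
    using assms unfolding Fc_def by auto
  define K where "K = - (pi / 8) * ((m1 + m2) * (l + n))"
  define a where "a = - (4 * K / pi)"
  define b where "b = 9 * K / 4"
  have K0: "K \<noteq> 0" using nz by (simp add: K_def)
  obtain M B H where MBH: "20 \<le> M" "0 < B" "0 < H" and main: "\<forall>\<epsilon>. 0 < \<epsilon> \<and> \<epsilon> \<le> 1 \<and> M * \<epsilon> * B \<le> 1/300 \<longrightarrow>
    (M * \<epsilon>) * coeff_bound (l + b * \<epsilon>) m1 n \<le> 1/300 \<and> (M * \<epsilon>) * coeff_bound l (- m2) n \<le> 1/300 \<and>
    \<bar>a * \<epsilon>^2\<bar> \<le> (M * \<epsilon>)^2 \<and>
    (\<forall>f1 f2. half_map_spec (a * \<epsilon>^2) (l + b * \<epsilon>) m1 n (M * \<epsilon>) f1 \<longrightarrow>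
       half_map_spec 0 l (- m2) n (M * \<epsilon>) f2 \<longrightarrow>
       (\<forall>\<rho>::complex. norm \<rho> < M \<longrightarrow>
         norm (f2 (of_real \<epsilon> * \<rho>) - f1 (of_real \<epsilon> * \<rho>) - of_real (\<epsilon>^2 * K) * ((\<rho> - 1) * (\<rho> - 2))) \<le> H * \<epsilon>^3))"
    using rescaled_difference[OF K_def] unfolding a_def[symmetric] b_def[symmetric] by (elim exE conjE)
  obtain \<kappa> where \<kappa>: "\<kappa> > 0" "ball (0, 0) \<kappa> \<subseteq> U" using UV open_contains_ball by metis
  define P where "P \<epsilon> = (a * \<epsilon>^2, 0::real, l + b * \<epsilon>, l, m1, m2, n)" for \<epsilon>
  have "(P \<longlongrightarrow> (a * 0^2, 0, l + b * 0, l, m1, m2, n)) (at_right 0)"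
    unfolding P_def[abs_def] by (intro tendsto_intros)
  then have "(P \<longlongrightarrow> p0) (at_right 0)" by (simp add: p0)
  then have "\<forall>\<^sub>F \<epsilon> in at_right 0. P \<epsilon> \<in> V" using UV topological_tendstoD by blast
  moreover have lim0: "((\<lambda>\<epsilon>. x * \<epsilon>) \<longlongrightarrow> 0) (at_right 0)" for x :: real
    using tendsto_mult[OF tendsto_const[of x] tendsto_ident_at[of 0 "{0<..}"]] by simp
  have small: "\<forall>\<^sub>F \<epsilon> in at_right 0. x * \<epsilon> < y" if "y > 0" for x y :: real
    by (rule order_tendstoD(2)[OF lim0 that])
  have "\<forall>\<^sub>F \<epsilon> in at_right (0::real). 0 < \<epsilon>" by (rule eventually_at_right_less)
  moreover have "\<forall>\<^sub>F \<epsilon> in at_right (0::real). 1 * \<epsilon> < 1" by (rule small) simp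
  moreover have "\<forall>\<^sub>F \<epsilon> in at_right 0. (M * B) * \<epsilon> < 1/300" by (rule small) simp
  moreover have "\<forall>\<^sub>F \<epsilon> in at_right 0. H * \<epsilon> < \<bar>K\<bar> / 8" by (rule small) (use K0 in simp)
  \<comment> \<open>A cycle through distance at most 9 \<epsilon> / 4 stays within 3/2 * 9/4 *
    \<epsilon> = 27 \<epsilon> / 8 < 4 \<epsilon> of the origin, hence inside the given
    neighbourhood.\<close>
  moreover have "\<forall>\<^sub>F \<epsilon> in at_right 0. 4 * \<epsilon> < \<kappa>" by (rule small) (use \<kappa> in simp)
  ultimately have "\<forall>\<^sub>F \<epsilon> in at_right 0. P \<epsilon> \<in> V \<and> 0 < \<epsilon> \<and> 1 * \<epsilon> < 1 \<and> (M * B) * \<epsilon> < 1/300 \<and>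
      H * \<epsilon> < \<bar>K\<bar> / 8 \<and> 4 * \<epsilon> < \<kappa>"
    by (intro eventually_conj)
  from eventually_happens'[OF trivial_limit_at_right_real this]
  obtain \<epsilon> where "P \<epsilon> \<in> V \<and> 0 < \<epsilon> \<and> 1 * \<epsilon> < 1 \<and> (M * B) * \<epsilon> < 1/300 \<and>
      H * \<epsilon> < \<bar>K\<bar> / 8 \<and> 4 * \<epsilon> < \<kappa>" by blast
  then have \<epsilon>: "P \<epsilon> \<in> V" "0 < \<epsilon>" "\<epsilon> \<le> 1" "M * \<epsilon> * B \<le> 1/300" "H * \<epsilon> < \<bar>K\<bar> / 8" "4 * \<epsilon> < \<kappa>"
    by (auto simp: mult_ac)
  let ?e = "M * \<epsilon>"
  have e0: "0 < ?e" using MBH \<epsilon> by simp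
  have me: "?e * coeff_bound (l + b * \<epsilon>) m1 n \<le> 1/300" "?e * coeff_bound l (- m2) n \<le> 1/300"
    "\<bar>a * \<epsilon>^2\<bar> \<le> ?e^2"
    using main[rule_format, of \<epsilon>] \<epsilon> by auto
  obtain f1 where f1: "half_map_spec (a * \<epsilon>^2) (l + b * \<epsilon>) m1 n ?e f1"
    using half_map_exists[OF e0 me(1,3)] by blast
  obtain f2 where f2: "half_map_spec 0 l (- m2) n ?e f2"
    using half_map_exists[OF e0 me(2), of 0] by auto
  have est: "norm (f2 (of_real \<epsilon> * \<rho>) - f1 (of_real \<epsilon> * \<rho>) - of_real (\<epsilon>^2 * K) * ((\<rho> - 1) * (\<rho> - 2))) \<le> H * \<epsilon>^3"
    if "norm \<rho> < M" for \<rho> :: complex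
    using main[rule_format, of \<epsilon>] \<epsilon> f1 f2 that by blast
  have hol: "f1 holomorphic_on ball 0 ?e" "f2 holomorphic_on ball 0 ?e"
    using f1 f2 unfolding half_map_spec_def by blast+
  have "?e * 1 \<le> ?e * coeff_bound (l + b * \<epsilon>) m1 n"
    using e0 coeff_bound_ge_1 by (intro mult_left_mono) auto
  then have "?e \<le> 1/300" using me(1) by linarith
  then have "?e^2 \<le> (1/300)^2" using e0 by (intro power_mono) auto
  then have d: "\<bar>a * \<epsilon>^2\<bar> \<le> 1/4" using me(3) by (simp add: power2_eq_square)
  have f2': "half_map_spec (- 0) l (- m2) n ?e f2" using f2 by simp
  have cyc: "\<exists>C r. crossing_limit_cycle (X_right (P \<epsilon>)) (X_left (P \<epsilon>)) C \<and> C \<subseteq> U \<and> (0, 0) \<in> inside C \<and>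
      cycle_multiplicity (pw_field (P \<epsilon>)) C 1 \<and> \<epsilon> * (c - 1/4) \<le> r \<and> r \<le> \<epsilon> * (c + 1/4) \<and>
      (\<forall>y\<le>0. (0, y) \<in> C \<longleftrightarrow> y = - r)" if c: "c = 1 \<or> c = 2" for c
  proof -
    obtain \<rho> where \<rho>: "c - 1/4 \<le> \<rho>" "\<rho> \<le> c + 1/4" "Re (f2 (of_real (\<epsilon> * \<rho>))) = Re (f1 (of_real (\<epsilon> * \<rho>)))"
      "Re (deriv f2 (of_real (\<epsilon> * \<rho>))) \<noteq> Re (deriv f1 (of_real (\<epsilon> * \<rho>)))"
      using simple_zero_near[OF hol \<epsilon>(2) MBH(1) \<epsilon>(5) est c] by blast
    have \<rho>9: "0 < \<rho>" "\<rho> \<le> 9/4" using \<rho>(1,2) c by auto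
    have r: "0 < \<epsilon> * \<rho>" "\<epsilon> * \<rho> \<le> \<epsilon> * (9/4)" using \<rho>9 \<epsilon>(2) by (simp_all add: mult_left_mono)
    have "20 * \<epsilon> \<le> M * \<epsilon>" using MBH(1) \<epsilon>(2) by (intro mult_right_mono) auto
    then have "8 * (\<epsilon> * \<rho>) < ?e" using r \<epsilon>(2) by linarith
    then obtain C where C: "crossing_limit_cycle (X_right (P \<epsilon>)) (X_left (P \<epsilon>)) C"
      "C \<subseteq> cball 0 (3/2 * (\<epsilon> * \<rho>))" "(0, 0) \<in> inside C" "cycle_multiplicity (pw_field (P \<epsilon>)) C 1"
      "\<forall>y\<le>0. (0, y) \<in> C \<longleftrightarrow> y = - (\<epsilon> * \<rho>)"
      using limit_cycle_of_simple_zero[OF f1 f2' d _ me(1,2) r(1) _ \<rho>(3,4)] unfolding P_def by auto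
    have "C \<subseteq> U"
    proof
      fix q assume "q \<in> C"
      then have "norm q \<le> 3/2 * (\<epsilon> * \<rho>)" using C(2) by auto
      then have "norm q < \<kappa>" using r \<epsilon>(2,6) by linarith
      then have "q \<in> ball (0, 0) \<kappa>" by (simp add: zero_prod_def[symmetric])
      then show "q \<in> U" using \<kappa>(2) by blast
    qed
    moreover have "\<epsilon> * (c - 1/4) \<le> \<epsilon> * \<rho>" "\<epsilon> * \<rho> \<le> \<epsilon> * (c + 1/4)"
      using \<rho>(1,2) \<epsilon>(2) by (simp_all add: mult_left_mono)
    ultimately show ?thesis using C by blast
  qed
  obtain C1 r1 where C1: "crossing_limit_cycle (X_right (P \<epsilon>)) (X_left (P \<epsilon>)) C1 \<and> C1 \<subseteq> U \<and> (0, 0) \<in> inside C1 \<and>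
      cycle_multiplicity (pw_field (P \<epsilon>)) C1 1" "r1 \<le> \<epsilon> * (1 + 1/4)" "\<epsilon> * (1 - 1/4) \<le> r1" "\<forall>y\<le>0. (0, y) \<in> C1 \<longleftrightarrow> y = - r1"
    using cyc[of 1] by blast
  obtain C2 r2 where C2: "crossing_limit_cycle (X_right (P \<epsilon>)) (X_left (P \<epsilon>)) C2 \<and> C2 \<subseteq> U \<and> (0, 0) \<in> inside C2 \<and>
      cycle_multiplicity (pw_field (P \<epsilon>)) C2 1" "\<epsilon> * (2 - 1/4) \<le> r2" "\<forall>y\<le>0. (0, y) \<in> C2 \<longleftrightarrow> y = - r2"
    using cyc[of 2] by blast
  \<comment> \<open>The two cycles differ because they meet the negative half-axis at separated
    distances: r1 <= 5 \<epsilon> / 4 < 7 \<epsilon> / 4 <= r2.\<close>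
  have "r1 < r2" using C1(2) C2(2) \<epsilon>(2) by (simp add: algebra_simps)
  moreover have "0 < r1" using C1(3) \<epsilon>(2) by (simp add: algebra_simps)
  ultimately have "(0, - r1) \<in> C1" "(0, - r1) \<notin> C2" using C1(4) C2(3) by auto
  then have "C1 \<noteq> C2" by blast
  then have "(\<Sum>C\<in>{C1, C2}. 1) = (2 :: nat)" by simp
  then show "\<exists>p\<in>V. \<exists>S \<mu>. finite S \<and>
      (\<forall>C\<in>S. crossing_limit_cycle (X_right p) (X_left p) C \<and>
        C \<subseteq> U \<and> (0, 0) \<in> inside C \<and> cycle_multiplicity (pw_field p) C (\<mu> C)) \<and>
      (\<Sum>C\<in>S. \<mu> C) = 2"
    using C1(1) C2(1) \<epsilon>(1)
    by (intro bexI[of _ "P \<epsilon>"] exI[of _ "{C1, C2}"] exI[of _ "\<lambda>_. 1"]) auto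
qed

theorem proposition4p3:
  shows "(\<exists>p. weak_focus_order p 3) \<and> (\<forall>p k. weak_focus_order p k \<longrightarrow> k \<le> 3) \<and>
    (\<forall>p\<in>Fc. weak_focus_order p 3) \<and>
    (\<forall>p\<in>Fc. unfolds_limit_cycles p 2)"
proof -
  \<comment> \<open>Here (m1 + m2) (l2 + n) = 4. A point of the stratum shows that the bound 3 is
    attained.\<close>
  have "(0, 0, 1, 1, 1, 1, 1) \<in> Fc" by (simp add: Fc_def)
  then show ?thesis
    using weak_focus_order_Fc weak_focus_order_le_3 unfolds_two_limit_cycles by blast
qed

end
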